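(* Let $d\ge2$ and let $\mathbb{P}$ satisfy Assumptions A1–A2 below, with $\epsilon,\lambda,\sigma$ as defined in the context. If $$\lambda>4d\sigma^2(1+9\epsilon),$$ then Kalikow's condition is satisfied in direction $e_1$. In particular, $X$ is ballistic in direction $e_1$, i.e. $\liminf_{n\to\infty}\frac{X_n\cdot e_1}{n}>0$ $P_0$-a.s.
   Context: Let $V=\{x\in\mathbb{Z}^d:|x|_1=1\}$, $\mathcal P$ the probability vectors on $V$, $\Omega=\mathcal P^{\mathbb{Z}^d}$; for $\omega\in\Omega$, $P_{x,\omega}$ is the law of the nearest-neighbour Markov chain $X$ from $x$ with $P_{x,\omega}(X_{n+1}=y+e\mid X_n=y)=\omega(y,e)$; $\mathbb{P}$ is a law on $\Omega$ and $P_x=\mathbb{P}\otimes P_{x,\omega}$ the annealed law. (A1) $\omega(x)$, $x\in\mathbb{Z}^d$, are i.i.d. with law $\mu$; (A2) $\epsilon:=4d\,\|\omega(0)-(\frac1{2d},\dots,\frac1{2d})\|_{L^\infty(\mu)}\in(0,1)$ (the essential sup over $e\in V$ of $|\omega(0,e)-\frac1{2d}|$, times $4d$). $\lambda:=\mathbb{E}(\omega(0,e_1)-\omega(0,-e_1))$, $\sigma:=\sqrt{\sum_{e\in V}\mathrm{Var}_\mu(\omega(0,e))}$. For $B\subsetneq\mathbb{Z}^d$ nonempty connected, $T_B=\inf\{n\ge0:X_n\notin B\}$ and $g_B(x,y,\omega)=E_{x,\omega}\big(\sum_{n=0}^{T_B}\mathbf 1_{\{X_n=y\}}\big)$. Kalikow's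 environment on $B$ from $x\in B$ is $\omega_B^x(y,e)=\mathbb{E}(g_B(x,y,\omega)\omega(y,e))/\mathbb{E}(g_B(x,y,\omega))$ for $y\in B$, and its drift is $\vec d_{B,x}(y)=\sum_{e\in V}\omega_B^x(y,e)e$. Kalikow's condition holds in direction $\ell\in S^{d-1}$ if $\varepsilon_K(\ell):=\inf\{\vec d_{B,0}(y)\cdot\ell: B\subsetneq\mathbb{Z}^d\text{ connected}, 0,y\in B\}>0$. *)

theory Defs
  imports "HOL-Probability.Probability"
begin

text \<open>Sites are elements of int ^ 'd; the dimension is d = CARD('d).\<close>

definition nbr :: "(int ^ 'd) set" where
  "nbr = {x. (\<Sum>i\<in>UNIV. \<bar>x $ i\<bar>) = 1}"

text \<open>Probability vectors on V, seen as functions on Z^d vanishing off V.\<close>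
definition probvecs :: "(int ^ 'd \<Rightarrow> real) set" where
  "probvecs = {p. (\<forall>e. 0 \<le> p e) \<and> (\<forall>e. e \<notin> nbr \<longrightarrow> p e = 0) \<and> (\<Sum>e\<in>nbr. p e) = 1}"

text \<open>Law of the environment: i.i.d. with marginal mu (Assumption A1).\<close>
definition env_law :: "(int ^ 'd \<Rightarrow> real) measure \<Rightarrow> (int ^ 'd \<Rightarrow> int ^ 'd \<Rightarrow> real) measure" where
  "env_law \<mu> = (\<Pi>\<^sub>M x\<in>UNIV. \<mu>)"

definition eps_of :: "(int ^ 'd \<Rightarrow> real) measure \<Rightarrow> real" where
  "eps_of \<mu> = 4 * real CARD('d) *
     real_of_ereal (esssup \<mu> (\<lambda>p. ereal (Max ((\<lambda>e. \<bar>p e - 1 / (2 * real CARD('d))\<bar>) ` (nbr :: (int ^ 'd) set)))))"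

definition lambda_of :: "(int ^ 'd \<Rightarrow> real) measure \<Rightarrow> 'd \<Rightarrow> real" where
  "lambda_of \<mu> i = (\<integral>p. p (axis i 1) - p (- axis i 1) \<partial>\<mu>)"

definition sigma_of :: "(int ^ 'd \<Rightarrow> real) measure \<Rightarrow> real" where
  "sigma_of \<mu> = sqrt (\<Sum>e\<in>(nbr :: (int ^ 'd) set). (\<integral>p. (p e - (\<integral>q. q e \<partial>\<mu>))\<^sup>2 \<partial>\<mu>))"

text \<open>Nearest-neighbour connectedness of a subset of Z^d.\<close>
definition nn_connected :: "(int ^ 'd) set \<Rightarrow> bool" where
  "nn_connected B \<longleftrightarrow> B \<noteq> {} \<and>
     (\<forall>x\<in>B. \<forall>y\<in>B. (x, y) \<in> {(a, b). a \<in> B \<and> b \<in> B \<and> b - a \<in> nbr}\<^sup>*)"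

text \<open>Green function g_B(x,y,omega) = E_{x,omega} sum_{n=0}^{T_B} 1{X_n = y}, written out as
  sum over n and over nearest-neighbour paths (lists of steps es) of length n from x to y
  whose first n positions X_0..X_{n-1} lie in B (i.e. n <= T_B), weighted by their quenched probability.\<close>
definition green :: "(int ^ 'd) set \<Rightarrow> int ^ 'd \<Rightarrow> int ^ 'd \<Rightarrow> (int ^ 'd \<Rightarrow> int ^ 'd \<Rightarrow> real) \<Rightarrow> ennreal" where
  "green B x y \<omega> = (\<Sum>n. ennreal (\<Sum>es\<in>{es. length es = n \<and> set es \<subseteq> nbr}.
      if (\<forall>k<n. x + sum_list (take k es) \<in> B) \<and> x + sum_list es = y
      then (\<Prod>k<n. \<omega> (x + sum_list (take k es)) (es ! k)) else 0))"

text \<open>Kalikow's environment on B from x, and its drift.\<close>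
definition kalikow_env :: "(int ^ 'd \<Rightarrow> int ^ 'd \<Rightarrow> real) measure \<Rightarrow> (int ^ 'd) set \<Rightarrow> int ^ 'd \<Rightarrow> int ^ 'd \<Rightarrow> int ^ 'd \<Rightarrow> real" where
  "kalikow_env P B x y e =
     enn2real ((\<integral>\<^sup>+\<omega>. green B x y \<omega> * ennreal (\<omega> y e) \<partial>P) / (\<integral>\<^sup>+\<omega>. green B x y \<omega> \<partial>P))"

definition kalikow_drift :: "(int ^ 'd \<Rightarrow> int ^ 'd \<Rightarrow> real) measure \<Rightarrow> (int ^ 'd) set \<Rightarrow> int ^ 'd \<Rightarrow> int ^ 'd \<Rightarrow> real ^ 'd" where
  "kalikow_drift P B x y = (\<Sum>e\<in>nbr. kalikow_env P B x y e *\<^sub>R (\<chi> j. real_of_int (e $ j)))"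

definition kalikow_const :: "(int ^ 'd \<Rightarrow> int ^ 'd \<Rightarrow> real) measure \<Rightarrow> real ^ 'd \<Rightarrow> real" where
  "kalikow_const P l = Inf {kalikow_drift P B 0 y \<bullet> l | B y. nn_connected B \<and> B \<noteq> UNIV \<and> 0 \<in> B \<and> y \<in> B}"

definition kalikow_condition :: "(int ^ 'd \<Rightarrow> int ^ 'd \<Rightarrow> real) measure \<Rightarrow> real ^ 'd \<Rightarrow> bool" where
  "kalikow_condition P l \<longleftrightarrow> kalikow_const P l > 0"

text \<open>Path space of the walk and the characterising property of the quenched law P_{0,omega}.\<close>
definition path_space :: "(nat \<Rightarrow> int ^ 'd) measure" where
  "path_space = (\<Pi>\<^sub>M n\<in>UNIV. count_space UNIV)"

definition is_quenched_law :: "(int ^ 'd \<Rightarrow> int ^ 'd \<Rightarrow> real) \<Rightarrow> int ^ 'd \<Rightarrow> (nat \<Rightarrow> int ^ 'd) measure \<Rightarrow> bool" where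
  "is_quenched_law \<omega> x Q \<longleftrightarrow> prob_space Q \<and> sets Q = sets path_space \<and>
     (\<forall>n zs. measure Q {X \<in> space Q. \<forall>k\<le>n. X k = zs k} =
        (if zs 0 = x then (\<Prod>k<n. \<omega> (zs k) (zs (Suc k) - zs k)) else 0))"

end

theory Submission
  imports Defs
begin

text \<open>Conditionally on the environment off a site \<open>y\<close>, the Green function at \<open>y\<close> is a constant times
  \<open>1 / (\<omega> y \<bullet> q)\<close>, where \<open>q e\<close> is the probability to leave \<open>B\<close> from \<open>y + e\<close> without visiting \<open>y\<close>.
  Expanding this quotient around the mean of \<open>\<omega> y\<close> bounds Kalikow's drift below by
  \<open>\<lambda> - 4d\<sigma>\<^sup>2(1 + 9\<epsilon>)\<close>, uniformly in \<open>B\<close> and \<open>y\<close>.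

  For the ballisticity, Kalikow's drift inequality turns the level of the walk, and a decreasing exponential
  of the level, into a sub- and a supersolution for annealed exit problems. This gives an annealed
  mean hitting time of level \<open>L\<close> of order \<open>L\<close>, and a positive probability never to go below the
  starting level. On the latter event the walk after the hitting time of level \<open>k\<close> only sees fresh
  environment, so events for the recentred future intersected with \<open>k\<close> being such a regeneration
  level have probabilities not depending on \<open>k\<close>. This stationarity suffices for a maximal inequality,
  which bounds the hitting times linearly, and for bounding the gaps between regeneration levels;
  no independence between consecutive regenerations is needed.\<close>

section \<open>The single-site estimate\<close>

text \<open>The annealed walk is not Markov, so exit estimates cannot be read off a generator. They
  rest on edge counts: the annealed mean number of steps from \<open>y\<close> to
  \<open>y + e\<close> before the exit from \<open>B\<close> is the integral of
  \<open>green B 0 y \<omega> * \<omega> y e\<close>. The value of a function at the exit is the sum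
  of its increments over these steps, so comparing the counts in the two directions of the axis
  bounds its mean. Kalikow's auxiliary walk is never constructed. In the single-site expansion the
  first-order term averages out. What remains is a product of two fluctuations, which gives
  \<sigma>^2, divided by a denominator that ellipticity keeps away from zero. At a regeneration
  level the walk is strictly below the level before hitting it and never below it afterwards. The
  two pieces thus read the environment at disjoint sets of sites, which is all the independence that
  is used. Only first moments of hitting times are controlled, whence a maximal inequality rather
  than a law of large numbers.\<close>

lemma nbr_iff: "e \<in> nbr \<longleftrightarrow> (\<exists>i. e = axis i 1 \<or> e = - axis i 1)"
proof
  assume "e \<in> nbr"
  hence s: "(\<Sum>i\<in>UNIV. \<bar>e $ i\<bar>) = 1" by (simp add: nbr_def)
  then obtain i where i: "e $ i \<noteq> 0" by (force intro: ccontr)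
  have "(\<Sum>j\<in>UNIV. \<bar>e $ j\<bar>) = \<bar>e $ i\<bar> + (\<Sum>j\<in>UNIV-{i}. \<bar>e $ j\<bar>)"
    by (subst sum.remove[of _ i]) auto
  moreover have "(\<Sum>j\<in>UNIV-{i}. \<bar>e $ j\<bar>) \<ge> 0" by (intro sum_nonneg) auto
  ultimately have 1: "\<bar>e $ i\<bar> = 1" and "(\<Sum>j\<in>UNIV-{i}. \<bar>e $ j\<bar>) = 0" using s i by linarith+
  hence 2: "e $ j = 0" if "j \<noteq> i" for j using that by (subst (asm) sum_nonneg_eq_0_iff) auto
  from 1 have "e $ i = 1 \<or> e $ i = - 1" by linarith
  thus "\<exists>i. e = axis i 1 \<or> e = - axis i 1" using 2
    by (intro exI[of _ i]) (auto simp: vec_eq_iff axis_def)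
next
  assume "\<exists>i. e = axis i 1 \<or> e = - axis i 1"
  then obtain i where "e = axis i 1 \<or> e = - axis i 1" by blast
  hence "\<bar>e $ j\<bar> = (if j = i then 1 else 0)" for j by (auto simp: axis_def)
  thus "e \<in> nbr" by (simp add: nbr_def)
qed

lemma axis_in_nbr [simp]: "axis i 1 \<in> nbr" "- axis i 1 \<in> nbr"
  by (auto simp: nbr_iff)

lemma finite_nbr [simp, intro]: "finite (nbr :: (int ^ 'd) set)"
proof -
  have "nbr = range (\<lambda>i. axis i 1 :: int ^ 'd) \<union> range (\<lambda>i. - axis i 1)"
    by (auto simp: nbr_iff)
  moreover have "finite (range (\<lambda>i. axis i 1 :: int ^ 'd) \<union> range (\<lambda>i. - axis i 1))" by simp
  ultimately show ?thesis by (simp only:)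
qed

lemma axis_neq_uminus: "axis i (1::int) \<noteq> - axis j 1"
proof
  assume "axis i (1::int) = - axis j 1"
  hence "axis i (1::int) $ i = (- axis j 1) $ i" by simp
  thus False by (simp add: axis_def split: if_splits)
qed

lemma uminus_nbr: "e \<in> nbr \<Longrightarrow> - e \<in> nbr"
  by (simp add: nbr_def)

lemma nbr_component: "e \<in> nbr \<Longrightarrow> e $ i = (if e = axis i 1 then 1 else if e = - axis i 1 then -1 else 0)"
proof -
  assume "e \<in> nbr"
  then obtain j where j: "e = axis j 1 \<or> e = - axis j 1" by (auto simp: nbr_iff)
  show ?thesis
  proof (cases "i = j")
    case True
    thus ?thesis using j axis_neq_uminus[of j j] by (auto simp: axis_def)
  next
    case False
    hence "e $ i = 0" using j by (auto simp: axis_def)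
    thus ?thesis by (auto simp: axis_def)
  qed
qed

lemma sum_nbr_component:
  fixes h :: "int ^ 'd \<Rightarrow> real"
  shows "(\<Sum>e\<in>nbr. h e * of_int (e $ i)) = h (axis i 1) - h (- axis i 1)"
proof -
  have "(\<Sum>e\<in>nbr. h e * of_int (e $ i)) =
      (\<Sum>e\<in>{axis i 1, - axis i 1}. h e * of_int (e $ i))"
    by (rule sum.mono_neutral_right) (auto simp: nbr_component)
  also have "\<dots> = h (axis i 1) - h (- axis i 1)"
    using axis_neq_uminus[of i i] by (simp add: axis_def)
  finally show ?thesis .
qed

lemma nn_path_exists: "(z, x) \<in> {(a, b). b - a \<in> nbr}\<^sup>*" for z x :: "int ^ 'd"
proof (induction "nat (\<Sum>i\<in>UNIV. \<bar>x $ i - z $ i\<bar>)" arbitrary: x rule: less_induct)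
  case (less x)
  show ?case
  proof (cases "x = z")
    case False
    then obtain i where i: "x $ i \<noteq> z $ i" by (auto simp: vec_eq_iff)
    define s where "s = sgn (x $ i - z $ i)"
    define e where "e = (axis i s :: int ^ 'd)"
    have s: "s = 1 \<or> s = -1" using i by (auto simp: s_def sgn_if)
    have e: "e \<in> nbr" using s by (auto simp: e_def nbr_iff vec_eq_iff axis_def)
    have "(\<Sum>j\<in>UNIV. \<bar>(x - e) $ j - z $ j\<bar>) < (\<Sum>j\<in>UNIV. \<bar>x $ j - z $ j\<bar>)"
      using i by (intro sum_strict_mono_ex1) (auto simp: e_def axis_def s_def sgn_if intro!: exI[of _ i])
    moreover have "(\<Sum>j\<in>UNIV. \<bar>(x - e) $ j - z $ j\<bar>) \<ge> 0" by (intro sum_nonneg) auto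
    ultimately have "(z, x - e) \<in> {(a, b). b - a \<in> nbr}\<^sup>*" by (intro less) linarith
    moreover have "(x - e, x) \<in> {(a, b). b - a \<in> nbr}" using e by simp
    ultimately show ?thesis by (rule rtrancl_into_rtrancl)
  qed simp
qed

locale rwre =
  fixes \<mu> :: "(int ^ 'd \<Rightarrow> real) measure" and i1 :: 'd
  assumes mu_prob: "prob_space \<mu>"
    and mu_sets: "sets \<mu> = sets (\<Pi>\<^sub>M e\<in>UNIV. (borel :: real measure))"
    and mu_supp: "AE p in \<mu>. p \<in> probvecs"
    and eps_pos: "0 < eps_of \<mu>" and eps_less: "eps_of \<mu> < 1"
    and drift: "lambda_of \<mu> i1 > 4 * real CARD('d) * (sigma_of \<mu>)\<^sup>2 * (1 + 9 * eps_of \<mu>)"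

sublocale rwre \<subseteq> mu: prob_space \<mu>
  by (rule mu_prob)

context rwre
begin

text \<open>This is 1/(2d) lowered by eps/(4d), the largest deviation of a coordinate that A2
  allows.\<close>

definition kap :: real where "kap = (1 - eps_of \<mu> / 2) / (2 * real CARD('d))"
definition cK :: real where
  "cK = lambda_of \<mu> i1 - 4 * real CARD('d) * (sigma_of \<mu>)\<^sup>2 * (1 + 9 * eps_of \<mu>)"

lemma kap_pos: "kap > 0" using eps_less by (simp add: kap_def)
lemma cK_pos: "cK > 0" using drift by (simp add: cK_def)

definition elliptic :: "(int ^ 'd \<Rightarrow> real) \<Rightarrow> bool" where
  "elliptic p \<longleftrightarrow> p \<in> probvecs \<and> (\<forall>e\<in>nbr. kap \<le> p e)"

lemma AE_elliptic: "AE p in \<mu>. elliptic p"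
proof -
  let ?f = "\<lambda>p. Max ((\<lambda>e. \<bar>p e - 1 / (2 * real CARD('d))\<bar>) ` (nbr :: (int ^ 'd) set))"
  let ?s = "esssup \<mu> (\<lambda>p. ereal (?f p))"
  \<comment> \<open>\<open>real_of_ereal\<close> sends infinite values to 0, so positivity of
    \<open>eps_of \<mu>\<close> excludes an infinite essential supremum.\<close>
  have fin: "\<bar>?s\<bar> \<noteq> \<infinity>" using eps_pos by (auto simp: eps_of_def)
  hence s: "?s = ereal (eps_of \<mu> / (4 * real CARD('d)))"
    by (auto simp: eps_of_def field_simps)
  have "AE p in \<mu>. ereal (?f p) \<le> ?s" by (rule esssup_AE)
  with mu_supp show ?thesis
  proof eventually_elim
    case (elim p)
    have "kap \<le> p e" if e: "e \<in> nbr" for e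
    proof -
      have "\<bar>p e - 1 / (2 * real CARD('d))\<bar> \<le> ?f p"
        using e by (intro Max_ge) auto
      also have "\<dots> \<le> eps_of \<mu> / (4 * real CARD('d))" using elim(2) unfolding s by simp
      finally have "p e \<ge> 1 / (2 * real CARD('d)) - eps_of \<mu> / (4 * real CARD('d))" by linarith
      thus ?thesis by (simp add: kap_def diff_divide_distrib)
    qed
    thus ?case using elim(1) by (simp add: elliptic_def)
  qed
qed

lemma ellipticD:
  assumes "elliptic p"
  shows "e \<in> nbr \<Longrightarrow> kap \<le> p e" "0 \<le> p e" "(\<Sum>e\<in>nbr. p e) = 1" "e \<notin> nbr \<Longrightarrow> p e = 0"
  using assms by (auto simp: elliptic_def probvecs_def)

lemma elliptic_le_1: assumes "elliptic p" shows "p e \<le> 1"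
proof (cases "e \<in> nbr")
  case True
  have "p e \<le> (\<Sum>e\<in>nbr. p e)" using True ellipticD[OF assms] by (intro member_le_sum) auto
  thus ?thesis using ellipticD(3)[OF assms] by simp
qed (simp add: ellipticD(4)[OF assms])

lemma measurable_component_mu [measurable]: "(\<lambda>p. p e) \<in> borel_measurable \<mu>"
  by (subst measurable_cong_sets[OF mu_sets refl]) simp

lemma integrable_bounded:
  assumes "f \<in> borel_measurable \<mu>" "\<And>p. elliptic p \<Longrightarrow> \<bar>f p\<bar> \<le> K"
  shows "integrable \<mu> (f :: _ \<Rightarrow> real)"
  using assms AE_elliptic by (intro mu.integrable_const_bound[of _ K]) auto

text \<open>\<open>2 / kap\<close> is the price of the second-order error: 2 for the two opposite
  coordinates in the drift, \<open>1 / kap\<close> for the denominator. Here it is traded for the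
  constant of the drift hypothesis.\<close>

lemma two_over_kap_le: "2 / kap \<le> 4 * real CARD('d) * (1 + 9 * eps_of \<mu>)"
proof -
  let ?e = "eps_of \<mu>"
  have "?e * ?e \<le> ?e" using eps_pos eps_less by (simp add: mult_le_cancel_right1)
  hence "1 \<le> (1 + 9 * ?e) * (1 - ?e / 2)" using eps_pos eps_less by (simp add: algebra_simps)
  hence "1 / (1 - ?e / 2) \<le> 1 + 9 * ?e" using eps_less by (simp add: divide_le_eq)
  hence "4 * real CARD('d) * (1 / (1 - ?e / 2)) \<le> 4 * real CARD('d) * (1 + 9 * ?e)"
    by (intro mult_left_mono) auto
  thus ?thesis by (simp add: kap_def)
qed

text \<open>Let \<open>Db\<close> be the mean of \<open>D\<close> and \<eta> the centred drift.
  Since 1/D = 1/Db - (D - Db)/(Db D) and \<eta> has mean zero, integrating \<eta>/D leaves only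
  -1/Db times the integral of \<eta> (D - Db)/D, a second-order term. The integral of 1/D stays as a
  factor because Kalikow's drift is a quotient of two such integrals.\<close>

lemma single_site_drift:
  fixes q :: "int ^ 'd \<Rightarrow> real"
  assumes q: "\<And>e. e \<in> nbr \<Longrightarrow> 0 \<le> q e" and qpos: "(\<Sum>e\<in>nbr. q e) > 0"
  defines "D \<equiv> \<lambda>p. \<Sum>e\<in>nbr. p e * q e"
  shows "integrable \<mu> (\<lambda>p. 1 / D p)"
    and "integrable \<mu> (\<lambda>p. p e / D p)"
    and "cK * (\<integral>p. 1 / D p \<partial>\<mu>) \<le> (\<integral>p. p (axis i1 1) / D p \<partial>\<mu>) - (\<integral>p. p (- axis i1 1) / D p \<partial>\<mu>)"
proof -
  define Qs where "Qs = (\<Sum>e\<in>nbr. q e)"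
  have Dge: "D p \<ge> kap * Qs" if "elliptic p" for p
    unfolding D_def Qs_def sum_distrib_left
    using that q by (intro sum_mono mult_right_mono) (auto dest: ellipticD)
  have kQ: "kap * Qs > 0" using kap_pos qpos by (simp add: Qs_def)
  have Dpos: "D p > 0" if "elliptic p" for p using Dge[OF that] kQ by linarith
  have Dm [measurable]: "D \<in> borel_measurable \<mu>" unfolding D_def by measurable
  have inv_le: "1 / D p \<le> 1 / (kap * Qs)" if "elliptic p" for p
    using Dge[OF that] kQ by (simp add: frac_le)
  show int1: "integrable \<mu> (\<lambda>p. 1 / D p)"
    by (rule integrable_bounded[of _ "1 / (kap * Qs)"]) (use inv_le Dpos in \<open>auto simp: less_imp_le\<close>)
  have intp: "integrable \<mu> (\<lambda>p. p e / D p)" for e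
  proof (rule integrable_bounded[of _ "1 / (kap * Qs)"])
    fix p assume p: "elliptic p"
    have "\<bar>p e / D p\<bar> = p e * (1 / D p)" using ellipticD(2)[OF p] Dpos[OF p] by (simp add: abs_mult)
    also have "\<dots> \<le> 1 * (1 / D p)"
      using elliptic_le_1[OF p] Dpos[OF p] by (intro mult_right_mono) auto
    finally show "\<bar>p e / D p\<bar> \<le> 1 / (kap * Qs)" using inv_le[OF p] by simp
  qed measurable
  thus "integrable \<mu> (\<lambda>p. p e / D p)" .
  have intc [simp]: "integrable \<mu> (\<lambda>p. p e)" for e
    by (rule integrable_bounded[of _ 1]) (use elliptic_le_1 ellipticD in auto)
  define m where "m e = (\<integral>p. p e \<partial>\<mu>)" for e
  define \<xi> where "\<xi> p e = p e - m e" for p e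
  have \<xi>m [measurable]: "(\<lambda>p. \<xi> p e) \<in> borel_measurable \<mu>" for e unfolding \<xi>_def by measurable
  have m01: "0 \<le> m e" "m e \<le> 1" for e
    unfolding m_def using AE_elliptic ellipticD(2) elliptic_le_1
    by (auto intro!: integral_nonneg_AE mu.integral_le_const)
  have \<xi>1: "\<bar>\<xi> p e\<bar> \<le> 1" if "elliptic p" for p e
    using m01[of e] ellipticD(2)[OF that, of e] elliptic_le_1[OF that, of e] unfolding \<xi>_def by linarith
  define V where "V p = (\<Sum>e\<in>nbr. (\<xi> p e)\<^sup>2)" for p
  have Vm [measurable]: "V \<in> borel_measurable \<mu>" unfolding V_def by measurable
  have intsq: "integrable \<mu> (\<lambda>p. (\<xi> p e)\<^sup>2)" for e
    by (rule integrable_bounded[of _ 1]) (use \<xi>1 in \<open>auto simp: abs_square_le_1\<close>)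
  have intV: "integrable \<mu> V" unfolding V_def by (intro Bochner_Integration.integrable_sum intsq)
  have sig: "(sigma_of \<mu>)\<^sup>2 = (\<integral>p. V p \<partial>\<mu>)"
  proof -
    have "(sigma_of \<mu>)\<^sup>2 = (\<Sum>e\<in>nbr. (\<integral>p. (\<xi> p e)\<^sup>2 \<partial>\<mu>))"
      unfolding sigma_of_def \<xi>_def m_def by (intro real_sqrt_pow2 sum_nonneg) auto
    also have "\<dots> = (\<integral>p. V p \<partial>\<mu>)" unfolding V_def
      by (rule Bochner_Integration.integral_sum[symmetric]) (rule intsq)
    finally show ?thesis .
  qed
  define Db where "Db = (\<Sum>e\<in>nbr. m e * q e)"
  have intD [simp]: "integrable \<mu> D" unfolding D_def by (intro Bochner_Integration.integrable_sum) auto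
  have Db: "Db = (\<integral>p. D p \<partial>\<mu>)" unfolding Db_def D_def m_def
    by (subst Bochner_Integration.integral_sum) auto
  have "kap * Qs \<le> Db" unfolding Db using Dge AE_elliptic
    by (intro mu.integral_ge_const) auto
  hence Dbpos: "Db > 0" using kQ by linarith
  \<comment> \<open>Jensen's inequality for 1/x, from the tangent line at \<open>Db\<close>. It will
    turn the factor 1/Db of the error into the integral of 1/D.\<close>
  have jensen: "1 / Db \<le> (\<integral>p. 1 / D p \<partial>\<mu>)"
  proof -
    have "1 / Db = (\<integral>p. 2 / Db - D p / Db\<^sup>2 \<partial>\<mu>)"
      using Dbpos by (simp add: Db[symmetric] mu.prob_space power2_eq_square field_simps)
    also have "\<dots> \<le> (\<integral>p. 1 / D p \<partial>\<mu>)"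
    proof (intro integral_mono_AE)
      show "AE p in \<mu>. 2 / Db - D p / Db\<^sup>2 \<le> 1 / D p" using AE_elliptic
      proof eventually_elim
        case (elim p)
        have "0 \<le> (Db - D p)\<^sup>2 / (Db\<^sup>2 * D p)" using Dpos[OF elim] by simp
        also have "\<dots> = 1 / D p - (2 / Db - D p / Db\<^sup>2)"
          using Dpos[OF elim] Dbpos by (simp add: field_simps power2_eq_square)
        finally show ?case by simp
      qed
    qed (auto intro: int1)
    finally show ?thesis .
  qed
  define \<eta> where "\<eta> p = \<xi> p (axis i1 1) - \<xi> p (- axis i1 1)" for p
  define l where "l = lambda_of \<mu> i1"
  have l: "l = m (axis i1 1) - m (- axis i1 1)" by (simp add: l_def lambda_of_def m_def)
  have \<eta>_eq: "\<eta> p = p (axis i1 1) - p (- axis i1 1) - l" for p by (simp add: \<eta>_def \<xi>_def l)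
  have \<eta>m [measurable]: "\<eta> \<in> borel_measurable \<mu>" unfolding \<eta>_def by measurable
  define S where "S p = (\<Sum>e\<in>nbr. \<xi> p e * q e)" for p
  have Sm [measurable]: "S \<in> borel_measurable \<mu>" unfolding S_def by measurable
  have SD: "S p = D p - Db" for p
    by (simp add: S_def D_def Db_def \<xi>_def algebra_simps sum_subtractf)
  have int\<eta>: "integrable \<mu> \<eta>" unfolding \<eta>_def \<xi>_def by simp
  have \<eta>0: "(\<integral>p. \<eta> p \<partial>\<mu>) = 0" unfolding \<eta>_eq
    by (simp add: l m_def mu.prob_space)
  have int\<eta>D: "integrable \<mu> (\<lambda>p. \<eta> p / D p)"
  proof -
    have "(\<lambda>p. \<eta> p / D p) = (\<lambda>p. p (axis i1 1) / D p - p (- axis i1 1) / D p - l * (1 / D p))"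
      by (auto simp: \<eta>_eq diff_divide_distrib)
    thus ?thesis using intp int1
      by (simp only:) (intro Bochner_Integration.integrable_diff integrable_mult_right)
  qed
  \<comment> \<open>The root of \<open>V\<close> bounds every single fluctuation. The factor
    \<open>Qs\<close> gained from \<open>S\<close> cancels against
    \<open>D p \<ge> kap * Qs\<close>, so the bound does not depend on \<open>q\<close>.\<close>
  have key: "\<bar>\<eta> p * S p / D p\<bar> \<le> 2 / kap * V p" if p: "elliptic p" for p
  proof -
    have \<xi>V: "\<bar>\<xi> p e\<bar> \<le> sqrt (V p)" if "e \<in> nbr" for e
    proof -
      have "(\<xi> p e)\<^sup>2 \<le> V p" unfolding V_def using that by (intro member_le_sum) auto
      thus ?thesis by (metis real_sqrt_abs real_sqrt_le_mono)
    qed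
    have "\<bar>\<eta> p\<bar> \<le> 2 * sqrt (V p)" using \<xi>V[of "axis i1 1"] \<xi>V[of "- axis i1 1"]
      by (simp add: \<eta>_def)
    moreover have "\<bar>S p\<bar> \<le> sqrt (V p) * Qs"
    proof -
      have "\<bar>S p\<bar> \<le> (\<Sum>e\<in>nbr. \<bar>\<xi> p e * q e\<bar>)" unfolding S_def by (rule sum_abs)
      also have "\<dots> \<le> (\<Sum>e\<in>nbr. sqrt (V p) * q e)"
        using \<xi>V q by (intro sum_mono) (auto simp: abs_mult intro!: mult_right_mono)
      finally show ?thesis by (simp add: Qs_def sum_distrib_left)
    qed
    moreover have V0: "V p \<ge> 0" unfolding V_def by (intro sum_nonneg) auto
    ultimately have "\<bar>\<eta> p\<bar> * \<bar>S p\<bar> \<le> (2 * sqrt (V p)) * (sqrt (V p) * Qs)"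
      by (intro mult_mono) auto
    also have "\<dots> = 2 * V p * Qs" using V0 by simp
    finally have *: "\<bar>\<eta> p\<bar> * \<bar>S p\<bar> \<le> 2 * V p * Qs" .
    have "\<bar>\<eta> p * S p / D p\<bar> = \<bar>\<eta> p\<bar> * \<bar>S p\<bar> / D p" using Dpos[OF p] by (simp add: abs_mult)
    also have "\<dots> \<le> (2 * V p * Qs) / (kap * Qs)"
      using * Dge[OF p] kQ V0 qpos by (intro frac_le) (auto simp: Qs_def)
    also have "\<dots> = 2 / kap * V p" using qpos by (simp add: Qs_def)
    finally show ?thesis .
  qed
  have eqAE: "AE p in \<mu>. \<eta> p * S p / D p = \<eta> p - Db * (\<eta> p / D p)"
    using AE_elliptic
  proof eventually_elim
    case (elim p)
    thus ?case using Dpos[OF elim] by (simp add: SD field_simps)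
  qed
  have intr: "integrable \<mu> (\<lambda>p. \<eta> p * S p / D p)"
  proof (rule Bochner_Integration.integrable_bound)
    show "integrable \<mu> (\<lambda>p. 2 / kap * V p)" using intV by (rule integrable_mult_right)
    show "AE p in \<mu>. norm (\<eta> p * S p / D p) \<le> norm (2 / kap * V p)"
      using AE_elliptic
    proof eventually_elim
      case (elim p)
      show ?case unfolding real_norm_def by (rule order.trans[OF key[OF elim] abs_ge_self])
    qed
  qed measurable
  have "- Db * (\<integral>p. \<eta> p / D p \<partial>\<mu>) = (\<integral>p. \<eta> p - Db * (\<eta> p / D p) \<partial>\<mu>)"
    by (subst Bochner_Integration.integral_diff[OF int\<eta> integrable_mult_right[OF int\<eta>D]])
       (use \<eta>0 integral_mult_right_zero[of \<mu> Db "\<lambda>p. \<eta> p / D p"] in linarith)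
  also have "\<dots> = (\<integral>p. \<eta> p * S p / D p \<partial>\<mu>)"
    using eqAE by (intro integral_cong_AE) auto
  also have "\<dots> \<le> (\<integral>p. 2 / kap * V p \<partial>\<mu>)"
    by (rule integral_mono_AE[OF intr integrable_mult_right[OF intV]])
       (rule eventually_mono[OF AE_elliptic], rule abs_le_D1, rule key)
  also have "\<dots> = 2 / kap * (sigma_of \<mu>)\<^sup>2" by (simp add: sig)
  also have "\<dots> \<le> 4 * real CARD('d) * (1 + 9 * eps_of \<mu>) * (sigma_of \<mu>)\<^sup>2"
    by (intro mult_right_mono two_over_kap_le) auto
  also have "\<dots> = l - cK" by (simp add: cK_def l_def algebra_simps)
  finally have "- Db * (\<integral>p. \<eta> p / D p \<partial>\<mu>) \<le> l - cK" .
  hence "- (\<integral>p. \<eta> p / D p \<partial>\<mu>) \<le> (l - cK) * (1 / Db)" using Dbpos by (simp add: field_simps)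
  \<comment> \<open>Jensen may be multiplied in because \<open>l - cK\<close> is the nonnegative
    quantity subtracted from the drift in \<open>cK\<close>.\<close>
  also have "\<dots> \<le> (l - cK) * (\<integral>p. 1 / D p \<partial>\<mu>)"
    using jensen eps_pos by (intro mult_left_mono) (auto simp: cK_def l_def)
  finally have "cK * (\<integral>p. 1 / D p \<partial>\<mu>) \<le> (\<integral>p. \<eta> p / D p \<partial>\<mu>) + l * (\<integral>p. 1 / D p \<partial>\<mu>)"
    by (simp add: algebra_simps)
  also have "\<dots> = (\<integral>p. \<eta> p / D p + l * (1 / D p) \<partial>\<mu>)"
    by (subst Bochner_Integration.integral_add[OF int\<eta>D integrable_mult_right[OF int1]])
       (use integral_mult_right_zero[of \<mu> l "\<lambda>p. 1 / D p"] in linarith)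
  also have "\<dots> = (\<integral>p. p (axis i1 1) / D p - p (- axis i1 1) / D p \<partial>\<mu>)"
    by (intro Bochner_Integration.integral_cong refl)
       (simp add: \<eta>_eq diff_divide_distrib)
  also have "\<dots> = (\<integral>p. p (axis i1 1) / D p \<partial>\<mu>) - (\<integral>p. p (- axis i1 1) / D p \<partial>\<mu>)"
    using intp by simp
  finally show "cK * (\<integral>p. 1 / D p \<partial>\<mu>) \<le> (\<integral>p. p (axis i1 1) / D p \<partial>\<mu>) - (\<integral>p. p (- axis i1 1) / D p \<partial>\<mu>)" .
qed

end

section \<open>The quenched Green function\<close>

text \<open>The recursion peels off the first step and keeps the target \<open>y\<close> fixed,
  which suits the first-step arguments below. The endpoint need not lie in \<open>B\<close>, in
  accordance with the summation up to and including the exit time.\<close>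

primrec path_wt :: "(int ^ 'd \<Rightarrow> int ^ 'd \<Rightarrow> real) \<Rightarrow> (int ^ 'd) set \<Rightarrow> int ^ 'd \<Rightarrow> nat \<Rightarrow> int ^ 'd \<Rightarrow> real" where
  "path_wt \<omega> B y 0 x = (if x = y then 1 else 0)"
| "path_wt \<omega> B y (Suc n) x = (if x \<in> B then \<Sum>e\<in>nbr. \<omega> x e * path_wt \<omega> B y n (x + e) else 0)"

definition step_lists :: "nat \<Rightarrow> (int ^ 'd) list set" where
  "step_lists n = {es. length es = n \<and> set es \<subseteq> nbr}"

lemma finite_step_lists [simp]: "finite (step_lists n :: (int ^ 'd) list set)"
proof -
  have "(step_lists n :: (int ^ 'd) list set) = {es. set es \<subseteq> nbr \<and> length es = n}" by (auto simp: step_lists_def)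
  thus ?thesis using finite_lists_length_eq[OF finite_nbr] by simp
qed

lemma sum_step_lists_Suc:
  fixes f :: "(int ^ 'd) list \<Rightarrow> _"
  shows "(\<Sum>es\<in>step_lists (Suc n). f es) = (\<Sum>e\<in>nbr. \<Sum>es\<in>step_lists n. f (e # es))"
proof -
  have "(step_lists (Suc n) :: (int ^ 'd) list set) = (\<lambda>(e, es). e # es) ` (nbr \<times> step_lists n)"
    by (auto simp: step_lists_def length_Suc_conv image_iff)
  moreover have "inj_on (\<lambda>(e, es). e # es) (nbr \<times> step_lists n :: ((int ^ 'd) \<times> (int ^ 'd) list) set)" by (auto simp: inj_on_def)
  ultimately show ?thesis
    by (simp add: sum.reindex sum.cartesian_product case_prod_unfold)
qed

lemma path_wt_eq:
  fixes x :: "int ^ 'd"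
  shows "path_wt \<omega> B y n x = (\<Sum>es\<in>step_lists n.
      if (\<forall>k<n. x + sum_list (take k es) \<in> B) \<and> x + sum_list es = y
      then (\<Prod>k<n. \<omega> (x + sum_list (take k es)) (es ! k)) else 0)"
proof (induction n arbitrary: x)
  case 0
  have "step_lists 0 = {[] :: (int ^ 'd) list}" by (auto simp: step_lists_def)
  thus ?case by simp
next
  case (Suc n)
  have all: "(\<forall>k<Suc n. P k) \<longleftrightarrow> P 0 \<and> (\<forall>k<n. P (Suc k))" for P :: "nat \<Rightarrow> bool"
    using less_Suc_eq_0_disj by auto
  show ?case unfolding sum_step_lists_Suc path_wt.simps Suc all prod.lessThan_Suc_shift
    by (cases "x \<in> B") (simp_all add: sum_distrib_left add.assoc if_distrib[of "(*) _"] cong: if_cong)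
qed

lemma green_eq_suminf: "green B x y \<omega> = (\<Sum>n. ennreal (path_wt \<omega> B y n x))"
  unfolding green_def path_wt_eq step_lists_def ..

lemma path_wt_cong: "(\<And>x. x \<in> B \<Longrightarrow> \<omega> x = \<omega>' x) \<Longrightarrow> path_wt \<omega> B y n x = path_wt \<omega>' B y n x"
  by (induction n arbitrary: x) auto

text \<open>Splits a path at the time \<open>j\<close> of its first visit to \<open>y\<close>:
  removing \<open>y\<close> from the set kills every path that goes on after reaching
  \<open>y\<close>.\<close>

lemma path_wt_first_hit:
  assumes "y \<in> B"
  shows "path_wt \<omega> B y n x = (\<Sum>j\<le>n. path_wt \<omega> (B - {y}) y j x * path_wt \<omega> B y (n - j) y)"
proof (induction n arbitrary: x)
  case (Suc n)
  show ?case
  proof (cases "x = y")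
    case True
    have "(\<Sum>j\<le>Suc n. path_wt \<omega> (B - {y}) y j y * path_wt \<omega> B y (Suc n - j) y)
        = path_wt \<omega> B y (Suc n) y + (\<Sum>j\<le>n. path_wt \<omega> (B - {y}) y (Suc j) y * path_wt \<omega> B y (n - j) y)"
      unfolding sum.atMost_Suc_shift by simp
    \<comment> \<open>Started in \<open>y\<close>, the killed walk has weight only at time
      0.\<close>
    also have "(\<Sum>j\<le>n. path_wt \<omega> (B - {y}) y (Suc j) y * path_wt \<omega> B y (n - j) y) = 0"
      by (simp del: sum.atMost_Suc)
    finally show ?thesis using True by simp
  next
    case False
    have "(\<Sum>j\<le>Suc n. path_wt \<omega> (B - {y}) y j x * path_wt \<omega> B y (Suc n - j) y)
        = (\<Sum>j\<le>n. path_wt \<omega> (B - {y}) y (Suc j) x * path_wt \<omega> B y (n - j) y)"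
      unfolding sum.atMost_Suc_shift using False by simp
    also have "\<dots> = path_wt \<omega> B y (Suc n) x"
    proof (cases "x \<in> B")
      case True
      have "(\<Sum>j\<le>n. path_wt \<omega> (B - {y}) y (Suc j) x * path_wt \<omega> B y (n - j) y)
        = (\<Sum>j\<le>n. \<Sum>e\<in>nbr. \<omega> x e * (path_wt \<omega> (B - {y}) y j (x + e) * path_wt \<omega> B y (n - j) y))"
        using True False by (simp add: sum_distrib_right mult.assoc)
      also have "\<dots> = (\<Sum>e\<in>nbr. \<omega> x e * (\<Sum>j\<le>n. path_wt \<omega> (B - {y}) y j (x + e) * path_wt \<omega> B y (n - j) y))"
        by (subst sum.swap) (simp add: sum_distrib_left)
      also have "\<dots> = path_wt \<omega> B y (Suc n) x" using True by (simp add: Suc)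
      finally show ?thesis .
    qed simp
    finally show ?thesis by simp
  qed
qed simp

text \<open>Removing \<open>y\<close> from \<open>B\<close> stops the walk at its first visit to \<open>y\<close>, so the sum is a probability,
  and it does not depend on \<open>\<omega> y\<close>.\<close>
definition hit_prob :: "(int ^ 'd) set \<Rightarrow> int ^ 'd \<Rightarrow> (int ^ 'd \<Rightarrow> int ^ 'd \<Rightarrow> real) \<Rightarrow> int ^ 'd \<Rightarrow> real" where
  "hit_prob B y \<omega> x = (\<Sum>n. path_wt \<omega> (B - {y}) y n x)"

text \<open>The probability of not returning to \<open>y\<close> before the exit from
  \<open>B\<close>. Its reciprocal is the mean number of visits to \<open>y\<close>, and it is the
  only factor of the Green function that involves \<open>\<omega> y\<close>.\<close>

definition escape_prob :: "(int ^ 'd) set \<Rightarrow> int ^ 'd \<Rightarrow> (int ^ 'd \<Rightarrow> int ^ 'd \<Rightarrow> real) \<Rightarrow> real" where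
  "escape_prob B y \<omega> = (\<Sum>e\<in>nbr. \<omega> y e * (1 - hit_prob B y \<omega> (y + e)))"

lemma hit_prob_cong: "(\<And>x. x \<in> B - {y} \<Longrightarrow> \<omega> x = \<omega>' x) \<Longrightarrow> hit_prob B y \<omega> x = hit_prob B y \<omega>' x"
  unfolding hit_prob_def using path_wt_cong[of "B - {y}" \<omega> \<omega>' y] by simp

context rwre
begin

text \<open>The site \<open>y\<close> is exempted so that the conclusions can be used while integrating over \<open>\<omega> y\<close>.\<close>
definition elliptic_off :: "int ^ 'd \<Rightarrow> (int ^ 'd \<Rightarrow> int ^ 'd \<Rightarrow> real) \<Rightarrow> bool" where
  "elliptic_off y \<omega> \<longleftrightarrow> (\<forall>x. x \<noteq> y \<longrightarrow> elliptic (\<omega> x))"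

lemma path_wt_nonneg: "(\<And>x. x \<in> B \<Longrightarrow> elliptic (\<omega> x)) \<Longrightarrow> 0 \<le> path_wt \<omega> B y n x"
  by (induction n arbitrary: x) (auto intro!: sum_nonneg mult_nonneg_nonneg dest: ellipticD(2))

text \<open>Bounding partial sums uniformly in the starting point allows an induction on the number
  of terms, so hitting probabilities are handled without a path measure for \<omega>.\<close>

lemma hit_prob_partial_le_1:
  assumes "elliptic_off y \<omega>"
  shows "(\<Sum>n<N. path_wt \<omega> (B - {y}) y n x) \<le> 1"
proof (induction N arbitrary: x)
  case (Suc N)
  show ?case
  proof (cases "x = y \<or> x \<notin> B")
    case True
    thus ?thesis unfolding sum.lessThan_Suc_shift by (auto simp del: sum.lessThan_Suc)
  next
    case False
    have el: "elliptic (\<omega> x)" using assms False by (auto simp: elliptic_off_def)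
    have "(\<Sum>n<Suc N. path_wt \<omega> (B - {y}) y n x) = (\<Sum>n<N. \<Sum>e\<in>nbr. \<omega> x e * path_wt \<omega> (B - {y}) y n (x + e))"
      unfolding sum.lessThan_Suc_shift using False by (simp del: sum.lessThan_Suc)
    also have "\<dots> = (\<Sum>e\<in>nbr. \<omega> x e * (\<Sum>n<N. path_wt \<omega> (B - {y}) y n (x + e)))"
      by (subst sum.swap) (simp add: sum_distrib_left)
    also have "\<dots> \<le> (\<Sum>e\<in>nbr. \<omega> x e * 1)"
      using Suc ellipticD(2)[OF el] by (intro sum_mono mult_left_mono) auto
    finally show ?thesis using ellipticD(3)[OF el] by simp
  qed
qed simp

lemma hit_prob:
  assumes "elliptic_off y \<omega>"
  shows "summable (\<lambda>n. path_wt \<omega> (B - {y}) y n x)" "0 \<le> hit_prob B y \<omega> x" "hit_prob B y \<omega> x \<le> 1"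
proof -
  have nn: "0 \<le> path_wt \<omega> (B - {y}) y n x" for n
    using assms by (intro path_wt_nonneg) (auto simp: elliptic_off_def)
  show s: "summable (\<lambda>n. path_wt \<omega> (B - {y}) y n x)"
    using nn hit_prob_partial_le_1[OF assms] by (intro summableI_nonneg_bounded) auto
  show "0 \<le> hit_prob B y \<omega> x" unfolding hit_prob_def using nn by (intro suminf_nonneg s)
  show "hit_prob B y \<omega> x \<le> 1" unfolding hit_prob_def
    by (intro suminf_le_const s) (rule hit_prob_partial_le_1[OF assms])
qed

lemma hit_prob_step:
  assumes "elliptic_off y \<omega>" "x \<noteq> y"
  shows "hit_prob B y \<omega> x = (if x \<in> B then \<Sum>e\<in>nbr. \<omega> x e * hit_prob B y \<omega> (x + e) else 0)"
proof -
  have "hit_prob B y \<omega> x = path_wt \<omega> (B - {y}) y 0 x + (\<Sum>n. path_wt \<omega> (B - {y}) y (Suc n) x)"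
    using suminf_split_head[OF hit_prob(1)[OF assms(1), of B x]] unfolding hit_prob_def by linarith
  also have "\<dots> = (if x \<in> B then \<Sum>e\<in>nbr. \<omega> x e * hit_prob B y \<omega> (x + e) else 0)"
    using assms(2) hit_prob(1)[OF assms(1)]
    by (simp add: hit_prob_def suminf_sum suminf_mult summable_mult)
  finally show ?thesis .
qed

text \<open>One way to avoid \<open>y\<close> from \<open>x\<close> is to step to
  \<open>x + e\<close>, at a cost of at least \<open>kap\<close>, and to avoid \<open>y\<close> from
  there.\<close>

lemma one_minus_hit_prob_ge:
  assumes "elliptic_off y \<omega>" "x \<noteq> y" "e \<in> nbr"
  shows "kap * (1 - hit_prob B y \<omega> (x + e)) \<le> 1 - hit_prob B y \<omega> x"
proof -
  have el: "elliptic (\<omega> x)" using assms by (simp add: elliptic_off_def)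
  note h = hit_prob[OF assms(1), of B]
  have "kap * (1 - hit_prob B y \<omega> (x + e)) \<le> \<omega> x e * (1 - hit_prob B y \<omega> (x + e))"
    using h ellipticD(1)[OF el assms(3)] by (intro mult_right_mono) auto
  also have "\<dots> \<le> (\<Sum>e\<in>nbr. \<omega> x e * (1 - hit_prob B y \<omega> (x + e)))"
    using assms(3) h ellipticD(2)[OF el] by (intro member_le_sum) auto
  also have "\<dots> = 1 - (\<Sum>e\<in>nbr. \<omega> x e * hit_prob B y \<omega> (x + e))"
    by (simp add: algebra_simps sum_subtractf ellipticD(3)[OF el])
  also have "\<dots> \<le> 1 - hit_prob B y \<omega> x"
    using hit_prob_step[OF assms(1,2), of B] h ellipticD(2)[OF el]
    by (auto intro!: sum_nonneg)
  finally show ?thesis .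
qed

text \<open>A site outside \<open>B\<close> never leads back to \<open>y\<close>. Along a
  nearest-neighbour path from such a site to \<open>y\<close>, the bound is transported backwards at
  a factor \<open>kap\<close> per step, until a neighbour of \<open>y\<close> is reached. The
  resulting \<open>n\<close> and \<open>e\<close> do not depend on \<omega>.\<close>

lemma escape_direction:
  assumes "y \<in> B" "B \<noteq> UNIV"
  obtains n e where "e \<in> nbr" "\<And>\<omega>. elliptic_off y \<omega> \<Longrightarrow> kap ^ n \<le> 1 - hit_prob B y \<omega> (y + e)"
proof -
  define gd where "gd x \<longleftrightarrow> x \<noteq> y \<and> (\<exists>n. \<forall>\<omega>. elliptic_off y \<omega> \<longrightarrow> kap ^ n \<le> 1 - hit_prob B y \<omega> x)" for x
  obtain z where z: "z \<notin> B" using assms by auto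
  have gz: "gd z"
  proof -
    have zy: "z \<noteq> y" using z assms by auto
    have "hit_prob B y \<omega> z = 0" if "elliptic_off y \<omega>" for \<omega>
      using hit_prob_step[OF that zy, of B] z by simp
    thus ?thesis unfolding gd_def using zy by (auto intro!: exI[of _ 0])
  qed
  \<comment> \<open>The second alternative stops the transport once the path is next to
    \<open>y\<close>, as no bound holds at \<open>y\<close> itself. At \<open>x = y\<close> it is
    the only possible alternative.\<close>
  have "gd x \<or> (\<exists>e\<in>nbr. gd (y + e))" for x
    using nn_path_exists[of z x]
  proof (induction rule: rtrancl_induct)
    case (step a b)
    show ?case
    proof (cases "\<exists>e\<in>nbr. gd (y + e)")
      case False
      with step have ga: "gd a" and e: "b - a \<in> nbr" by auto
      have e': "a - b \<in> nbr" using uminus_nbr[OF e] by simp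
      have "b \<noteq> y"
      proof
        assume "b = y"
        hence "y + (a - b) = a" by simp
        thus False using False ga e' by metis
      qed
      moreover obtain n where n: "\<And>\<omega>. elliptic_off y \<omega> \<Longrightarrow> kap ^ n \<le> 1 - hit_prob B y \<omega> a"
        using ga by (auto simp: gd_def)
      have "kap ^ Suc n \<le> 1 - hit_prob B y \<omega> b" if "elliptic_off y \<omega>" for \<omega>
      proof -
        have "kap ^ Suc n \<le> kap * (1 - hit_prob B y \<omega> (b + (a - b)))"
          using n[OF that] kap_pos by (simp add: mult_left_mono)
        also have "\<dots> \<le> 1 - hit_prob B y \<omega> b" by (rule one_minus_hit_prob_ge) fact+
        finally show ?thesis .
      qed
      ultimately show ?thesis unfolding gd_def by blast
    qed simp
  qed (simp add: gz)
  from this[of y] obtain e where "e \<in> nbr" "gd (y + e)" by (auto simp: gd_def)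
  thus ?thesis using that by (auto simp: gd_def)
qed

text \<open>Uniformity in \<omega> makes the Green function bounded, hence integrable, even for
  infinite \<open>B\<close>. The factor \<open>min 1 kap\<close> lets one constant serve both the
  sum weighted by \<open>\<omega> y\<close> and the unweighted one, in which
  \<open>\<omega> y\<close> is unrestricted.\<close>

lemma escape_prob_ge:
  assumes "y \<in> B" "B \<noteq> UNIV"
  obtains s where "s > 0" "\<And>\<omega>. (\<And>x. elliptic (\<omega> x)) \<Longrightarrow> s \<le> escape_prob B y \<omega>"
    "\<And>\<omega>. elliptic_off y \<omega> \<Longrightarrow> s \<le> (\<Sum>e\<in>nbr. 1 - hit_prob B y \<omega> (y + e))"
proof -
  obtain n e where e: "e \<in> nbr" and n: "\<And>\<omega>. elliptic_off y \<omega> \<Longrightarrow> kap ^ n \<le> 1 - hit_prob B y \<omega> (y + e)"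
    using escape_direction[OF assms] by blast
  show ?thesis
  proof (rule that[of "min 1 kap * kap ^ n"])
    fix \<omega> :: "int ^ 'd \<Rightarrow> int ^ 'd \<Rightarrow> real" assume el: "\<And>x. elliptic (\<omega> x)"
    hence off: "elliptic_off y \<omega>" by (simp add: elliptic_off_def)
    have "min 1 kap * kap ^ n \<le> \<omega> y e * (1 - hit_prob B y \<omega> (y + e))"
      using n[OF off] ellipticD(1)[OF el e, of y] kap_pos hit_prob(3)[OF off] by (intro mult_mono) (auto intro: order.trans[OF min.cobounded2])
    also have "\<dots> \<le> escape_prob B y \<omega>" unfolding escape_prob_def
      using e hit_prob(3)[OF off] ellipticD(2)[OF el] by (intro member_le_sum) auto
    finally show "min 1 kap * kap ^ n \<le> escape_prob B y \<omega>" .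
  next
    fix \<omega> assume off: "elliptic_off y \<omega>"
    have "min 1 kap * kap ^ n \<le> 1 * kap ^ n" using kap_pos by (intro mult_right_mono) auto
    also have "\<dots> \<le> 1 - hit_prob B y \<omega> (y + e)" using n[OF off] by simp
    also have "\<dots> \<le> (\<Sum>e\<in>nbr. 1 - hit_prob B y \<omega> (y + e))"
      using e hit_prob(3)[OF off] by (intro member_le_sum[of e nbr "\<lambda>e. 1 - hit_prob B y \<omega> (y + e)"]) auto
    finally show "min 1 kap * kap ^ n \<le> (\<Sum>e\<in>nbr. 1 - hit_prob B y \<omega> (y + e))" .
  qed (use kap_pos in auto)
qed

text \<open>Decomposition of the Green function at the visits to \<open>y\<close>: this isolates its dependence on \<open>\<omega> y\<close>.\<close>
lemma green_decomposition:
  assumes el: "\<And>x. elliptic (\<omega> x)" and y: "y \<in> B" and s: "escape_prob B y \<omega> > 0"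
  shows "summable (\<lambda>n. path_wt \<omega> B y n x)"
    and "green B x y \<omega> = ennreal (hit_prob B y \<omega> x / escape_prob B y \<omega>)"
proof -
  have off: "elliptic_off y \<omega>" using el by (simp add: elliptic_off_def)
  note h = hit_prob[OF off, of B]
  define s where "s = escape_prob B y \<omega>"
  define F where "F n x = path_wt \<omega> (B - {y}) y n x" for n x
  define p where "p n x = path_wt \<omega> B y n x" for n x
  have F0: "0 \<le> F n x" and p0: "0 \<le> p n x" for n x
    unfolding F_def p_def using el by (auto intro!: path_wt_nonneg)
  have conv: "p n x = (\<Sum>j\<le>n. F j x * p (n - j) y)" for n x
    unfolding p_def F_def by (rule path_wt_first_hit[OF y])
  \<comment> \<open>Partial sums of a convolution are sums over a triangle, bounded here by the
    square that contains it.\<close>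
  have U_le: "(\<Sum>n<N. p n x) \<le> hit_prob B y \<omega> x * (\<Sum>n<N. p n y)" for N x
  proof -
    have "(\<Sum>n<N. p n x) = (\<Sum>n<N. \<Sum>j\<le>n. F j x * p (n - j) y)"
      by (intro sum.cong refl) (rule conv)
    also have "\<dots> = (\<Sum>(j, n)\<in>{(j, n). j + n < N}. F j x * p n y)"
      by (rule sum.triangle_reindex[symmetric])
    also have "\<dots> \<le> (\<Sum>(j, n)\<in>{..<N} \<times> {..<N}. F j x * p n y)"
      using F0 p0 by (intro sum_mono2) auto
    also have "\<dots> = (\<Sum>j<N. F j x * (\<Sum>n<N. p n y))"
      by (simp add: sum.cartesian_product[symmetric] sum_distrib_left)
    also have "\<dots> = (\<Sum>j<N. F j x) * (\<Sum>n<N. p n y)" by (simp add: sum_distrib_right)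
    also have "\<dots> \<le> hit_prob B y \<omega> x * (\<Sum>n<N. p n y)"
      using p0 F0 h(1)[of x] unfolding hit_prob_def
      by (intro mult_right_mono sum_nonneg) (auto intro!: sum_le_suminf simp: F_def)
    finally show ?thesis .
  qed
  have s_eq: "s = 1 - (\<Sum>e\<in>nbr. \<omega> y e * hit_prob B y \<omega> (y + e))"
    by (simp add: s_def escape_prob_def algebra_simps sum_subtractf ellipticD(3)[OF el])
  \<comment> \<open>The finite sum U satisfies U \<le> 1 + (1 - s) U and can be solved for, giving a
    bound before any summability is known.\<close>
  have Ub: "(\<Sum>n<N. p n y) \<le> 1 / s" for N
  proof -
    have "(\<Sum>n<N. p n y) \<le> (\<Sum>n<Suc N. p n y)" using p0 by simp
    also have "\<dots> = 1 + (\<Sum>n<N. \<Sum>e\<in>nbr. \<omega> y e * p n (y + e))"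
      unfolding sum.lessThan_Suc_shift using y by (simp add: p_def del: sum.lessThan_Suc)
    also have "(\<Sum>n<N. \<Sum>e\<in>nbr. \<omega> y e * p n (y + e)) = (\<Sum>e\<in>nbr. \<omega> y e * (\<Sum>n<N. p n (y + e)))"
      by (subst sum.swap) (simp add: sum_distrib_left)
    also have "\<dots> \<le> (\<Sum>e\<in>nbr. \<omega> y e * (hit_prob B y \<omega> (y + e) * (\<Sum>n<N. p n y)))"
      using U_le ellipticD(2)[OF el] by (intro sum_mono mult_left_mono) auto
    also have "\<dots> = (1 - s) * (\<Sum>n<N. p n y)" by (simp add: s_eq sum_distrib_right mult.assoc)
    finally show ?thesis using s unfolding s_def[symmetric] by (simp add: field_simps)
  qed
  have sump_y: "summable (\<lambda>n. p n y)" using p0 Ub by (intro summableI_nonneg_bounded) auto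
  have sumF: "summable (\<lambda>n. F n x)" for x using h(1) by (simp add: F_def)
  \<comment> \<open>With both series summable, the first-hit decomposition becomes a Cauchy product.
    The renewal equation U = 1 + (1 - s) U at \<open>y\<close> then identifies U as 1/s.\<close>
  have sums: "(\<lambda>n. p n x) sums (hit_prob B y \<omega> x * (\<Sum>n. p n y))" for x
    using Cauchy_product_sums[of "\<lambda>n. F n x" "\<lambda>n. p n y"] sumF sump_y F0 p0
    by (simp add: hit_prob_def F_def[symmetric] conv[symmetric])
  have sump: "summable (\<lambda>n. p n x)" for x using sums by (rule sums_summable)
  thus "summable (\<lambda>n. path_wt \<omega> B y n x)" by (simp add: p_def)
  have "(\<Sum>n. p n y) = 1 + (\<Sum>n. \<Sum>e\<in>nbr. \<omega> y e * p n (y + e))"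
    using suminf_split_head[OF sump_y] y by (simp add: p_def)
  also have "(\<Sum>n. \<Sum>e\<in>nbr. \<omega> y e * p n (y + e)) = (\<Sum>e\<in>nbr. \<omega> y e * (\<Sum>n. p n (y + e)))"
    by (subst suminf_sum) (auto simp: suminf_mult sump intro!: summable_mult sump)
  also have "\<dots> = (\<Sum>e\<in>nbr. \<omega> y e * hit_prob B y \<omega> (y + e)) * (\<Sum>n. p n y)"
    unfolding sums_unique[OF sums[of "y + _"], symmetric] by (simp add: sum_distrib_right mult.assoc)
  finally have "(\<Sum>n. p n y) = 1 / s" using s unfolding s_def[symmetric] s_eq by (simp add: field_simps)
  with sums[of x] have sx: "(\<lambda>n. p n x) sums (hit_prob B y \<omega> x / s)" by simp
  have "green B x y \<omega> = (\<Sum>n. ennreal (p n x))" by (simp add: green_eq_suminf p_def)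
  also have "\<dots> = ennreal (hit_prob B y \<omega> x / s)"
    using sx p0 by (simp add: suminf_ennreal2 sums_iff)
  finally show "green B x y \<omega> = ennreal (hit_prob B y \<omega> x / escape_prob B y \<omega>)" by (simp add: s_def)
qed

text \<open>A single path inside \<open>B\<close> contributes at least \<open>kap ^ n\<close>, with
  the same \<open>n\<close> for all \<omega> in \<open>W\<close>. Hence the denominator of Kalikow's
  environment is positive. The induction runs from the start of the path because
  \<open>path_wt\<close> peels off first steps.\<close>

lemma path_wt_pos:
  assumes el: "\<And>\<omega> x. \<omega> \<in> W \<Longrightarrow> elliptic (\<omega> x)"
    and "(x, y) \<in> {(a, b). a \<in> B \<and> b \<in> B \<and> b - a \<in> nbr}\<^sup>*"
  obtains n where "\<And>\<omega>. \<omega> \<in> W \<Longrightarrow> kap ^ n \<le> path_wt \<omega> B y n x"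
proof -
  from assms(2) have "\<exists>n. \<forall>\<omega>\<in>W. kap ^ n \<le> path_wt \<omega> B y n x"
  proof (induction rule: converse_rtrancl_induct)
    case base
    show ?case by (rule exI[of _ 0]) simp
  next
    case (step a b)
    then obtain n where n: "\<And>\<omega>. \<omega> \<in> W \<Longrightarrow> kap ^ n \<le> path_wt \<omega> B y n b" by auto
    have "kap ^ Suc n \<le> path_wt \<omega> B y (Suc n) a" if w: "\<omega> \<in> W" for \<omega>
    proof -
      have e: "b - a \<in> nbr" and a: "a \<in> B" using step by auto
      have "kap ^ Suc n \<le> \<omega> a (b - a) * path_wt \<omega> B y n (a + (b - a))"
        using n[OF w] ellipticD(1,2)[OF el[OF w], of "b - a" a] e kap_pos by (simp add: mult_mono)
      also have "\<dots> \<le> path_wt \<omega> B y (Suc n) a"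
        unfolding path_wt.simps if_P[OF a]
        by (rule member_le_sum[of "b - a" nbr "\<lambda>e. \<omega> a e * path_wt \<omega> B y n (a + e)"])
           (use e ellipticD(2)[OF el[OF w]] path_wt_nonneg[of B \<omega>, OF el[OF w]] in auto)
      finally show ?thesis .
    qed
    thus ?case by blast
  qed
  thus ?thesis using that by blast
qed

end

section \<open>Kalikow's condition\<close>

context rwre
begin

abbreviation env :: "(int ^ 'd \<Rightarrow> int ^ 'd \<Rightarrow> real) measure" where "env \<equiv> env_law \<mu>"

lemma prob_space_env: "prob_space env"
  unfolding env_law_def by (intro prob_space_PiM mu_prob)

sublocale env: prob_space env
  by (rule prob_space_env)

lemma measurable_site [measurable]: "(\<lambda>\<omega>. \<omega> x) \<in> measurable env \<mu>"
  unfolding env_law_def by (rule measurable_component_singleton) simp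

lemma measurable_site_step [measurable]: "(\<lambda>\<omega>. \<omega> x e) \<in> borel_measurable env"
  by (rule measurable_compose[OF measurable_site measurable_component_mu])

lemma AE_env_elliptic: "AE \<omega> in env. \<forall>x. elliptic (\<omega> x)"
  unfolding AE_all_countable env_law_def
  using AE_PiM_component[of UNIV "\<lambda>_. \<mu>" _ elliptic] mu_prob AE_elliptic by auto

lemma measurable_path_wt [measurable]: "(\<lambda>\<omega>. path_wt \<omega> B y n x) \<in> borel_measurable env"
  by (induction n arbitrary: x) auto

lemma measurable_hit_prob [measurable]: "(\<lambda>\<omega>. hit_prob B y \<omega> x) \<in> borel_measurable env"
  unfolding hit_prob_def by measurable

lemma measurable_escape_prob [measurable]: "(\<lambda>\<omega>. escape_prob B y \<omega>) \<in> borel_measurable env"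
  unfolding escape_prob_def by measurable

lemma measurable_green [measurable]: "(\<lambda>\<omega>. green B x y \<omega>) \<in> borel_measurable env"
  unfolding green_eq_suminf by measurable

text \<open>Replacing the coordinate at \<open>y\<close> by an independent copy preserves a product
  law. This realises conditioning on the environment off \<open>y\<close> as an inner integral over
  one site.\<close>

lemma nn_integral_env_resample:
  assumes [measurable]: "f \<in> borel_measurable env"
  shows "(\<integral>\<^sup>+\<omega>. f \<omega> \<partial>env) = (\<integral>\<^sup>+\<omega>. \<integral>\<^sup>+p. f (fun_upd \<omega> y p) \<partial>\<mu> \<partial>env)"
proof -
  interpret pair_prob_space \<mu> env by unfold_locales
  let ?u = "\<lambda>(p, \<omega>). fun_upd \<omega> y p"
  have meas: "?u \<in> measurable (\<mu> \<Otimes>\<^sub>M env) env"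
    unfolding env_law_def case_prod_unfold by (intro measurable_fun_upd[where J = UNIV]) auto
  have "env = distr (\<mu> \<Otimes>\<^sub>M env) env ?u"
    using distr_pair_PiM_eq_PiM[of UNIV "\<lambda>_. \<mu>" y] mu_prob by (simp add: env_law_def)
  hence "(\<integral>\<^sup>+\<omega>. f \<omega> \<partial>env) = (\<integral>\<^sup>+\<omega>. f \<omega> \<partial>distr (\<mu> \<Otimes>\<^sub>M env) env ?u)" by simp
  also have "\<dots> = (\<integral>\<^sup>+z. f (?u z) \<partial>(\<mu> \<Otimes>\<^sub>M env))"
    by (rule nn_integral_distr[OF meas]) simp
  also have "\<dots> = (\<integral>\<^sup>+\<omega>. \<integral>\<^sup>+p. f (?u (p, \<omega>)) \<partial>\<mu> \<partial>env)"
    by (rule nn_integral_snd[symmetric]) (rule measurable_compose[OF meas assms])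
  finally show ?thesis by simp
qed

lemma green_bound:
  assumes "y \<in> B" "B \<noteq> UNIV"
  obtains K where "K > 0" "\<And>\<omega>. (\<And>x. elliptic (\<omega> x)) \<Longrightarrow> green B x y \<omega> \<le> ennreal K"
    "\<And>\<omega>. (\<And>x. elliptic (\<omega> x)) \<Longrightarrow>
       green B x y \<omega> = ennreal (hit_prob B y \<omega> x / escape_prob B y \<omega>)"
proof -
  obtain s where s: "s > 0" "\<And>\<omega>. (\<And>x. elliptic (\<omega> x)) \<Longrightarrow> s \<le> escape_prob B y \<omega>"
    using escape_prob_ge[OF assms] by metis
  show ?thesis
  proof (rule that[of "1 / s"])
    fix \<omega> :: "int ^ 'd \<Rightarrow> int ^ 'd \<Rightarrow> real" assume el: "\<And>x. elliptic (\<omega> x)"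
    have off: "elliptic_off y \<omega>" using el by (simp add: elliptic_off_def)
    have e: "s \<le> escape_prob B y \<omega>" by (rule s(2)) (rule el)
    show g: "green B x y \<omega> = ennreal (hit_prob B y \<omega> x / escape_prob B y \<omega>)"
      by (rule green_decomposition(2)) (use el assms e s(1) in auto)
    show "green B x y \<omega> \<le> ennreal (1 / s)"
      unfolding g using e s(1) hit_prob[OF off, of B x] by (intro ennreal_leI frac_le) auto
  qed (use s in auto)
qed

lemma green_integral_finite:
  assumes "y \<in> B" "B \<noteq> UNIV"
  shows "(\<integral>\<^sup>+\<omega>. green B x y \<omega> \<partial>env) < \<infinity>"
proof -
  obtain K where K: "\<And>\<omega>. (\<And>x. elliptic (\<omega> x)) \<Longrightarrow> green B x y \<omega> \<le> ennreal K"
    using green_bound[OF assms, of x] by metis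
  have "(\<integral>\<^sup>+\<omega>. green B x y \<omega> \<partial>env) \<le> (\<integral>\<^sup>+\<omega>. ennreal K \<partial>env)"
    using AE_env_elliptic by (intro nn_integral_mono_AE) (auto elim!: eventually_mono intro: K)
  also have "\<dots> < \<infinity>" by (simp add: env.emeasure_space_1)
  finally show ?thesis .
qed

lemma green_integral_pos:
  assumes "nn_connected B" "x \<in> B" "y \<in> B"
  shows "(\<integral>\<^sup>+\<omega>. green B x y \<omega> \<partial>env) > 0"
proof -
  have "(x, y) \<in> {(a, b). a \<in> B \<and> b \<in> B \<and> b - a \<in> nbr}\<^sup>*"
    using assms by (auto simp: nn_connected_def)
  then obtain n where n: "\<And>\<omega>. \<omega> \<in> {\<omega>. \<forall>x. elliptic (\<omega> x)} \<Longrightarrow> kap ^ n \<le> path_wt \<omega> B y n x"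
    using path_wt_pos[of "{\<omega>. \<forall>x. elliptic (\<omega> x)}"] by (metis (no_types, lifting) mem_Collect_eq)
  have "0 < ennreal (kap ^ n)" using kap_pos by simp
  also have "\<dots> = (\<integral>\<^sup>+\<omega>. ennreal (kap ^ n) \<partial>env)" by (simp add: env.emeasure_space_1)
  also have "\<dots> \<le> (\<integral>\<^sup>+\<omega>. green B x y \<omega> \<partial>env)"
  proof (intro nn_integral_mono_AE)
    show "AE \<omega> in env. ennreal (kap ^ n) \<le> green B x y \<omega>"
      using AE_env_elliptic
    proof eventually_elim
      case (elim \<omega>)
      have "ennreal (kap ^ n) \<le> ennreal (path_wt \<omega> B y n x)"
        using n elim by (intro ennreal_leI) auto
      also have "\<dots> = (\<Sum>n\<in>{n}. ennreal (path_wt \<omega> B y n x))" by simp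
      also have "\<dots> \<le> green B x y \<omega>" unfolding green_eq_suminf by (rule sum_le_suminf) auto
      finally show ?case .
    qed
  qed
  finally show ?thesis .
qed

text \<open>Conditionally on the environment off \<open>y\<close>, the Green function is a constant times
  \<open>1 / (\<omega> y \<bullet> q)\<close> with \<open>q \<ge> 0\<close> fixed, so the single-site estimate applies.\<close>
lemma kalikow_inequality:
  assumes y: "y \<in> B" and B: "B \<noteq> UNIV"
  shows "(\<integral>\<^sup>+\<omega>. green B x y \<omega> * ennreal (\<omega> y (- axis i1 1)) \<partial>env)
           + ennreal cK * (\<integral>\<^sup>+\<omega>. green B x y \<omega> \<partial>env)
         \<le> (\<integral>\<^sup>+\<omega>. green B x y \<omega> * ennreal (\<omega> y (axis i1 1)) \<partial>env)"
proof -
  let ?a = "axis i1 1 :: int ^ 'd"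
  define gr where "gr \<omega> = hit_prob B y \<omega> x / escape_prob B y \<omega>" for \<omega>
  have [measurable]: "gr \<in> borel_measurable env" unfolding gr_def by measurable
  have g: "green B x y \<omega> = ennreal (gr \<omega>)" if "\<And>x. elliptic (\<omega> x)" for \<omega>
    using green_bound[OF y B, of x] that unfolding gr_def by metis
  have I: "(\<integral>\<^sup>+\<omega>. green B x y \<omega> * ennreal (h (\<omega> y)) \<partial>env)
       = (\<integral>\<^sup>+\<omega>. \<integral>\<^sup>+p. ennreal (gr (fun_upd \<omega> y p)) * ennreal (h p) \<partial>\<mu> \<partial>env)"
    if [measurable]: "h \<in> borel_measurable \<mu>" for h
  proof -
    have [measurable]: "(\<lambda>\<omega>. h (\<omega> y)) \<in> borel_measurable env"
      by (rule measurable_compose[OF measurable_site that])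
    have "(\<integral>\<^sup>+\<omega>. green B x y \<omega> * ennreal (h (\<omega> y)) \<partial>env) = (\<integral>\<^sup>+\<omega>. ennreal (gr \<omega>) * ennreal (h (\<omega> y)) \<partial>env)"
      using AE_env_elliptic by (intro nn_integral_cong_AE) (auto elim!: eventually_mono simp: g)
    also have "\<dots> = (\<integral>\<^sup>+\<omega>. \<integral>\<^sup>+p. ennreal (gr (fun_upd \<omega> y p)) * ennreal (h (fun_upd \<omega> y p y)) \<partial>\<mu> \<partial>env)"
      by (rule nn_integral_env_resample) measurable
    finally show ?thesis by simp
  qed
  have Im: "(\<lambda>\<omega>. \<integral>\<^sup>+p. ennreal (gr (fun_upd \<omega> y p)) * ennreal (h p) \<partial>\<mu>) \<in> borel_measurable env"
    if [measurable]: "h \<in> borel_measurable \<mu>" for h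
  proof -
    have "(\<lambda>(\<omega>, p). fun_upd \<omega> y p) \<in> measurable (env \<Otimes>\<^sub>M \<mu>) env"
      unfolding env_law_def case_prod_unfold by (intro measurable_fun_upd[where J = UNIV]) auto
    from measurable_compose[OF this, of gr borel]
    have [measurable]: "(\<lambda>(\<omega>, p). gr (fun_upd \<omega> y p)) \<in> borel_measurable (env \<Otimes>\<^sub>M \<mu>)"
      by (simp add: case_prod_unfold)
    show ?thesis by measurable
  qed
  \<comment> \<open>The negative term stands on the left because subtraction of extended nonnegative
    reals truncates. The factor \<open>ennreal 1\<close> gives all three integrals the shape covered
    by \<open>I\<close> and \<open>conv\<close>.\<close>
  have inner: "(\<integral>\<^sup>+p. ennreal (gr (fun_upd \<omega> y p)) * ennreal (p (- ?a)) \<partial>\<mu>)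
        + ennreal cK * (\<integral>\<^sup>+p. ennreal (gr (fun_upd \<omega> y p)) * ennreal 1 \<partial>\<mu>)
      \<le> (\<integral>\<^sup>+p. ennreal (gr (fun_upd \<omega> y p)) * ennreal (p ?a) \<partial>\<mu>)" if off: "elliptic_off y \<omega>" for \<omega>
  proof -
    define q where "q e = 1 - hit_prob B y \<omega> (y + e)" for e
    define D where "D p = (\<Sum>e\<in>nbr. p e * q e)" for p
    define H where "H = hit_prob B y \<omega> x"
    have H0: "H \<ge> 0" using hit_prob[OF off] by (simp add: H_def)
    have q0: "0 \<le> q e" for e using hit_prob(3)[OF off] by (simp add: q_def)
    have qpos: "(\<Sum>e\<in>nbr. q e) > 0"
      using escape_prob_ge[OF y B] off unfolding q_def by (metis order_less_le_trans)
    note ssd = single_site_drift[OF q0 qpos, folded D_def]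
    have hc: "hit_prob B y (fun_upd \<omega> y p) z = hit_prob B y \<omega> z" for p z
      by (rule hit_prob_cong) auto
    \<comment> \<open>Changing the environment at \<open>y\<close> leaves all hitting probabilities
      alone, so \<open>p\<close> enters only through the linear form \<open>D p\<close>.\<close>
    have gr: "gr (fun_upd \<omega> y p) = H * (1 / D p)" for p
      by (simp add: gr_def escape_prob_def hc H_def D_def q_def)
    have D0: "0 \<le> D p" if "elliptic p" for p
      unfolding D_def using ellipticD(2)[OF that] q0 by (intro sum_nonneg) auto
    have conv: "(\<integral>\<^sup>+p. ennreal (gr (fun_upd \<omega> y p)) * ennreal (h p) \<partial>\<mu>) = ennreal (H * (\<integral>p. h p / D p \<partial>\<mu>))"
      if "integrable \<mu> (\<lambda>p. h p / D p)" "\<And>p. elliptic p \<Longrightarrow> h p \<ge> 0" for h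
    proof -
      have "(\<integral>\<^sup>+p. ennreal (gr (fun_upd \<omega> y p)) * ennreal (h p) \<partial>\<mu>) = (\<integral>\<^sup>+p. ennreal (H * (h p / D p)) \<partial>\<mu>)"
        using AE_elliptic by (intro nn_integral_cong_AE)
          (auto elim!: eventually_mono simp: gr D0 that H0 ennreal_mult''[symmetric])
      also have "\<dots> = ennreal (\<integral>p. H * (h p / D p) \<partial>\<mu>)"
        using AE_elliptic that D0 H0
        by (intro nn_integral_eq_integral integrable_mult_right) (auto elim!: eventually_mono)
      finally show ?thesis by (simp only: integral_mult_right_zero)
    qed
    have nn: "0 \<le> (\<integral>p. h p / D p \<partial>\<mu>)" if "\<And>p. elliptic p \<Longrightarrow> h p \<ge> 0" for h
      using AE_elliptic that D0 by (intro integral_nonneg_AE) (auto elim!: eventually_mono)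
    have "(\<integral>\<^sup>+p. ennreal (gr (fun_upd \<omega> y p)) * ennreal (p (- ?a)) \<partial>\<mu>)
        + ennreal cK * (\<integral>\<^sup>+p. ennreal (gr (fun_upd \<omega> y p)) * ennreal 1 \<partial>\<mu>)
       = ennreal (H * (\<integral>p. p (- ?a) / D p \<partial>\<mu>)) + ennreal cK * ennreal (H * (\<integral>p. 1 / D p \<partial>\<mu>))"
      using ssd(1,2) ellipticD(2) by (subst (1 2) conv) auto
    also have "\<dots> = ennreal (H * (\<integral>p. p (- ?a) / D p \<partial>\<mu>) + cK * (H * (\<integral>p. 1 / D p \<partial>\<mu>)))"
      using cK_pos H0 nn[of "\<lambda>p. p (- ?a)"] nn[of "\<lambda>p. 1"] ellipticD(2)
      by (subst ennreal_mult[symmetric]) (auto simp: ennreal_plus[symmetric] simp del: ennreal_plus)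
    also have "\<dots> \<le> ennreal (H * (\<integral>p. p ?a / D p \<partial>\<mu>))"
    proof (rule ennreal_leI)
      have "H * (cK * (\<integral>p. 1 / D p \<partial>\<mu>)) \<le> H * ((\<integral>p. p ?a / D p \<partial>\<mu>) - (\<integral>p. p (- ?a) / D p \<partial>\<mu>))"
        by (rule mult_left_mono[OF ssd(3) H0])
      thus "H * (\<integral>p. p (- ?a) / D p \<partial>\<mu>) + cK * (H * (\<integral>p. 1 / D p \<partial>\<mu>)) \<le> H * (\<integral>p. p ?a / D p \<partial>\<mu>)"
        by (simp add: algebra_simps)
    qed
    also have "\<dots> = (\<integral>\<^sup>+p. ennreal (gr (fun_upd \<omega> y p)) * ennreal (p ?a) \<partial>\<mu>)"
      using ssd(2) ellipticD(2) by (subst conv) auto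
    finally show ?thesis .
  qed
  have AEoff: "AE \<omega> in env. elliptic_off y \<omega>"
    using AE_env_elliptic by eventually_elim (simp add: elliptic_off_def)
  have "(\<integral>\<^sup>+\<omega>. green B x y \<omega> * ennreal (\<omega> y (- ?a)) \<partial>env)
           + ennreal cK * (\<integral>\<^sup>+\<omega>. green B x y \<omega> * ennreal 1 \<partial>env)
      = (\<integral>\<^sup>+\<omega>. (\<integral>\<^sup>+p. ennreal (gr (fun_upd \<omega> y p)) * ennreal (p (- ?a)) \<partial>\<mu>)
        + ennreal cK * (\<integral>\<^sup>+p. ennreal (gr (fun_upd \<omega> y p)) * ennreal 1 \<partial>\<mu>) \<partial>env)"
    unfolding I[OF measurable_component_mu] I[OF borel_measurable_const]
    by (simp only: nn_integral_add nn_integral_cmult borel_measurable_times_ennreal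
        borel_measurable_const Im[OF measurable_component_mu] Im[OF borel_measurable_const])
  also have "\<dots> \<le> (\<integral>\<^sup>+\<omega>. \<integral>\<^sup>+p. ennreal (gr (fun_upd \<omega> y p)) * ennreal (p ?a) \<partial>\<mu> \<partial>env)"
    using AEoff inner by (intro nn_integral_mono_AE) (auto elim!: eventually_mono)
  also have "\<dots> = (\<integral>\<^sup>+\<omega>. green B x y \<omega> * ennreal (\<omega> y ?a) \<partial>env)"
    by (rule I[symmetric]) measurable
  finally show ?thesis by simp
qed

lemma kalikow_drift_ge:
  assumes B: "nn_connected B" "B \<noteq> UNIV" and x: "x \<in> B" and y: "y \<in> B"
  shows "kalikow_drift env B x y \<bullet> axis i1 1 \<ge> cK"
proof -
  let ?a = "axis i1 1 :: int ^ 'd"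
  let ?G = "\<integral>\<^sup>+\<omega>. green B x y \<omega> \<partial>env"
  let ?I = "\<lambda>e. \<integral>\<^sup>+\<omega>. green B x y \<omega> * ennreal (\<omega> y e) \<partial>env"
  have fin: "?G < \<infinity>" by (rule green_integral_finite[OF y B(2)])
  have pos: "?G > 0" by (rule green_integral_pos[OF B(1) x y])
  define G where "G = enn2real ?G"
  have Gpos: "G > 0" using fin pos by (simp add: G_def enn2real_positive_iff)
  have G: "?G = ennreal G" using fin by (simp add: G_def)
  have "?I e \<le> ?G" for e
  proof (intro nn_integral_mono_AE)
    show "AE \<omega> in env. green B x y \<omega> * ennreal (\<omega> y e) \<le> green B x y \<omega>"
      using AE_env_elliptic
    proof eventually_elim
      case (elim \<omega>)
      hence "ennreal (\<omega> y e) \<le> 1" using elliptic_le_1 by (simp add: ennreal_le_1)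
      from mult_left_mono[OF this, of "green B x y \<omega>"] show ?case by simp
    qed
  qed
  hence finI: "?I e < \<infinity>" for e using fin by (meson le_less_trans)
  define J where "J e = enn2real (?I e)" for e
  have J: "?I e = ennreal (J e)" "J e \<ge> 0" for e using finI[of e] by (simp_all add: J_def)
  have env_eq: "kalikow_env env B x y e = J e / G" for e
    unfolding kalikow_env_def G J(1) using Gpos J(2) by (simp add: divide_ennreal)
  have "ennreal (J (- ?a) + cK * G) \<le> ennreal (J ?a)"
    using kalikow_inequality[OF y B(2), of x] cK_pos Gpos J(2) unfolding G J(1)
    by (simp add: ennreal_mult'[symmetric])
  hence "J (- ?a) + cK * G \<le> J ?a" using J(2) by simp
  hence "cK \<le> J ?a / G - J (- ?a) / G" using Gpos by (simp add: field_simps)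
  also have "\<dots> = (\<Sum>e\<in>nbr. J e / G * of_int (e $ i1))"
    by (rule sum_nbr_component[symmetric])
  also have "\<dots> = kalikow_drift env B x y \<bullet> axis i1 1"
    by (simp add: kalikow_drift_def inner_axis env_eq)
  finally show ?thesis .
qed

lemma kalikow_condition_holds: "kalikow_condition env (axis i1 1)"
proof -
  \<comment> \<open>A singleton shows that the infimum is over a nonempty set, without which a lower
    bound on its elements would say nothing about \<open>Inf\<close>.\<close>
  have "nn_connected {0 :: int ^ 'd}" by (simp add: nn_connected_def)
  moreover have "{0 :: int ^ 'd} \<noteq> UNIV"
    using axis_eq_0_iff[of i1 "1::int"] by (metis UNIV_I singletonD zero_neq_one)
  ultimately have "cK \<le> kalikow_const env (axis i1 1)"
    unfolding kalikow_const_def by (intro cInf_greatest) (auto intro: kalikow_drift_ge)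
  thus ?thesis using cK_pos by (simp add: kalikow_condition_def)
qed

end

section \<open>The annealed path measure\<close>

definition traj_wt :: "(int ^ 'd \<Rightarrow> int ^ 'd \<Rightarrow> real) \<Rightarrow> (nat \<Rightarrow> int ^ 'd) \<Rightarrow> nat \<Rightarrow> real" where
  "traj_wt \<omega> zs n = (\<Prod>k<n. \<omega> (zs k) (zs (Suc k) - zs k))"

context rwre
begin

definition ann_wt :: "(nat \<Rightarrow> int ^ 'd) \<Rightarrow> nat \<Rightarrow> real" where
  "ann_wt zs n = (\<integral>\<omega>. traj_wt \<omega> zs n \<partial>env)"

lemma measurable_traj_wt [measurable]: "(\<lambda>\<omega>. traj_wt \<omega> zs n) \<in> borel_measurable env"
  unfolding traj_wt_def by measurable

lemma measurable_traj_wt_PiM: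
  assumes "\<And>k. k < n \<Longrightarrow> zs k \<in> J"
  shows "(\<lambda>\<omega>. traj_wt \<omega> zs n) \<in> borel_measurable (\<Pi>\<^sub>M x\<in>J. \<mu>)"
  unfolding traj_wt_def
proof (intro borel_measurable_prod)
  fix k assume "k \<in> {..<n}"
  hence "zs k \<in> J" using assms by simp
  hence "(\<lambda>\<omega>. \<omega> (zs k)) \<in> measurable (\<Pi>\<^sub>M x\<in>J. \<mu>) \<mu>" by (rule measurable_component_singleton)
  thus "(\<lambda>\<omega>. \<omega> (zs k) (zs (Suc k) - zs k)) \<in> borel_measurable (\<Pi>\<^sub>M x\<in>J. \<mu>)"
    by (rule measurable_compose) (rule measurable_component_mu)
qed

lemma traj_wt_bounds:
  assumes "\<And>x. elliptic (\<omega> x)"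
  shows "0 \<le> traj_wt \<omega> zs n" "traj_wt \<omega> zs n \<le> 1"
  unfolding traj_wt_def using ellipticD(2)[OF assms] elliptic_le_1[OF assms]
  by (auto intro!: prod_nonneg prod_le_1)

lemma integrable_traj_wt [simp]: "integrable env (\<lambda>\<omega>. traj_wt \<omega> zs n)"
  using AE_env_elliptic traj_wt_bounds
  by (intro env.integrable_const_bound[of _ 1]) (auto elim!: eventually_mono)

lemma ann_wt_nonneg: "0 \<le> ann_wt zs n"
  unfolding ann_wt_def using AE_env_elliptic traj_wt_bounds
  by (intro integral_nonneg_AE) (auto elim!: eventually_mono)

lemma ann_wt_translate: "ann_wt (\<lambda>k. a + zs k) n = ann_wt zs n"
proof -
  let ?t = "\<lambda>\<omega> x. \<omega> (a + x)"
  have meas: "?t \<in> measurable env env" unfolding env_law_def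
    by (rule measurable_PiM_single') (auto simp: space_PiM)
  have "env = distr env env ?t"
    using distr_PiM_reindex[of UNIV "\<lambda>_. \<mu>" "\<lambda>x. a + x" UNIV] mu_prob
    by (simp add: env_law_def restrict_def)
  hence "ann_wt zs n = (\<integral>\<omega>. traj_wt \<omega> zs n \<partial>distr env env ?t)" by (simp add: ann_wt_def)
  also have "\<dots> = (\<integral>\<omega>. traj_wt (?t \<omega>) zs n \<partial>env)"
    by (rule integral_distr[OF meas]) simp
  also have "\<dots> = ann_wt (\<lambda>k. a + zs k) n" by (simp add: ann_wt_def traj_wt_def)
  finally show ?thesis ..
qed

lemma indep_vars_env: "env.indep_vars (\<lambda>_. \<mu>) (\<lambda>x \<omega>. \<omega> x) UNIV"
proof -
  have "distr env (\<Pi>\<^sub>M x\<in>UNIV. \<mu>) (\<lambda>\<omega>. \<lambda>x\<in>UNIV. \<omega> x) = distr env env (\<lambda>\<omega>. \<omega>)"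
    by (simp add: env_law_def restrict_def)
  also have "\<dots> = env" by simp
  also have "\<dots> = (\<Pi>\<^sub>M x\<in>UNIV. distr env \<mu> (\<lambda>\<omega>. \<omega> x))"
    unfolding env_law_def by (subst distr_PiM_component) (auto intro: mu_prob)
  finally show ?thesis by (subst env.indep_vars_iff_distr_eq_PiM) auto
qed

text \<open>Only the sites before the last one are read by a weight, so \<open>zs n\<close> may
  coincide with a site of \<open>vs\<close>. This lets the second word start where the first one
  ends.\<close>

lemma ann_wt_indep:
  assumes "\<And>j k. j < n \<Longrightarrow> k < m \<Longrightarrow> zs j \<noteq> vs k"
  shows "(\<integral>\<omega>. traj_wt \<omega> zs n * traj_wt \<omega> vs m \<partial>env) = ann_wt zs n * ann_wt vs m"
proof -
  define J1 where "J1 = zs ` {..<n}"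
  define J2 where "J2 = vs ` {..<m}"
  have "J1 \<inter> J2 = {}" using assms by (auto simp: J1_def J2_def)
  from env.indep_var_restrict[OF indep_vars_env this subset_UNIV subset_UNIV]
  have ind: "env.indep_var (\<Pi>\<^sub>M x\<in>J1. \<mu>) (\<lambda>\<omega>. restrict \<omega> J1) (\<Pi>\<^sub>M x\<in>J2. \<mu>) (\<lambda>\<omega>. restrict \<omega> J2)" .
  have r: "traj_wt (restrict \<omega> J1) zs n = traj_wt \<omega> zs n" "traj_wt (restrict \<omega> J2) vs m = traj_wt \<omega> vs m" for \<omega>
    unfolding traj_wt_def by (intro prod.cong refl; simp add: J1_def J2_def)+
  have m1: "(\<lambda>\<omega>. traj_wt \<omega> zs n) \<in> borel_measurable (\<Pi>\<^sub>M x\<in>J1. \<mu>)"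
    by (rule measurable_traj_wt_PiM) (simp add: J1_def)
  have m2: "(\<lambda>\<omega>. traj_wt \<omega> vs m) \<in> borel_measurable (\<Pi>\<^sub>M x\<in>J2. \<mu>)"
    by (rule measurable_traj_wt_PiM) (simp add: J2_def)
  have "env.indep_var borel (\<lambda>\<omega>. traj_wt \<omega> zs n) borel (\<lambda>\<omega>. traj_wt \<omega> vs m)"
    using env.indep_var_compose[OF ind m1 m2] unfolding comp_def r .
  from env.indep_var_lebesgue_integral[OF this integrable_traj_wt integrable_traj_wt]
  show ?thesis unfolding ann_wt_def .
qed

end

section \<open>Cylinders and the sigma-algebra of path space\<close>

definition cyl :: "nat \<Rightarrow> (nat \<Rightarrow> 'a) \<Rightarrow> (nat \<Rightarrow> 'a) set" where
  "cyl n zs = {X. \<forall>k\<le>n. X k = zs k}"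

lemma space_path_space [simp]: "space path_space = UNIV"
  by (simp add: path_space_def space_PiM)

lemma measurable_path_component [measurable]: "(\<lambda>X. X n) \<in> measurable path_space (count_space UNIV)"
  unfolding path_space_def by measurable

lemma cyl_in_sets [measurable]: "cyl n (zs :: nat \<Rightarrow> int ^ 'd) \<in> sets path_space"
proof -
  have "{X \<in> space path_space. \<forall>k\<in>{..n}. X k = zs k} \<in> sets path_space" by measurable
  also have "{X \<in> space path_space. \<forall>k\<in>{..n}. X k = zs k} = cyl n zs" by (auto simp: cyl_def)
  finally show ?thesis .
qed

text \<open>Words are lists because these form a countable type: an event decided by finitely many
  steps is then a countable union of cylinders.\<close>

definition prefix_of :: "(nat \<Rightarrow> 'a) \<Rightarrow> nat \<Rightarrow> 'a list" where
  "prefix_of X n = map X [0..<Suc n]"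

lemma length_prefix_of [simp]: "length (prefix_of X n) = Suc n"
  by (simp add: prefix_of_def)

lemma nth_prefix_of [simp]: "k \<le> n \<Longrightarrow> prefix_of X n ! k = X k"
  unfolding prefix_of_def by (subst nth_map) (auto simp del: upt_Suc)

lemma prefix_of_eq_iff: "prefix_of X n = w \<longleftrightarrow> length w = Suc n \<and> X \<in> cyl n (nth w)"
  by (auto simp: list_eq_iff_nth_eq cyl_def less_Suc_eq_le)

lemma mem_cyl_prefix_of [simp]: "X \<in> cyl n (nth (prefix_of X n))"
  by (simp add: cyl_def)

lemma measurable_prefix_of [measurable]:
  "(\<lambda>X :: nat \<Rightarrow> int ^ 'd. prefix_of X n) \<in> measurable path_space (count_space UNIV)"
proof (subst measurable_count_space_eq_countable)
  show "(\<lambda>X :: nat \<Rightarrow> int ^ 'd. prefix_of X n) \<in> space path_space \<rightarrow> UNIV \<and>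
    (\<forall>w\<in>UNIV. (\<lambda>X :: nat \<Rightarrow> int ^ 'd. prefix_of X n) -` {w} \<inter> space path_space \<in> sets path_space)"
  proof (intro conjI ballI)
    fix w :: "(int ^ 'd) list"
    have "(\<lambda>X. prefix_of X n) -` {w} \<inter> space path_space = (if length w = Suc n then cyl n (nth w) else {})"
      by (auto simp: prefix_of_eq_iff)
    thus "(\<lambda>X. prefix_of X n) -` {w} \<inter> space path_space \<in> sets path_space" by simp
  qed simp
qed simp

text \<open>Two cylinders are nested or disjoint, so adding the empty set makes the family closed
  under intersection.\<close>

definition cyls :: "(nat \<Rightarrow> int ^ 'd) set set" where
  "cyls = insert {} {cyl n zs | n zs. True}"

lemma Int_stable_cyls: "Int_stable cyls"
proof (rule Int_stableI)
  fix a b :: "(nat \<Rightarrow> int ^ 'd) set" assume "a \<in> cyls" "b \<in> cyls"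
  have *: "cyl n zs \<inter> cyl m vs \<in> cyls" if "n \<le> m" for n m and zs vs :: "nat \<Rightarrow> int ^ 'd"
  proof (cases "vs \<in> cyl n zs")
    case True
    hence "cyl n zs \<inter> cyl m vs = cyl m vs" using that by (auto simp: cyl_def)
    thus ?thesis by (auto simp: cyls_def)
  next
    case False
    hence "cyl n zs \<inter> cyl m vs = {}" using that by (force simp: cyl_def)
    thus ?thesis by (simp add: cyls_def)
  qed
  show "a \<inter> b \<in> cyls"
  proof (cases "a = {} \<or> b = {}")
    case False
    then obtain n zs m vs where "a = cyl n zs" "b = cyl m vs"
      using \<open>a \<in> cyls\<close> \<open>b \<in> cyls\<close> by (auto simp: cyls_def)
    thus ?thesis using *[of n m zs vs] *[of m n vs zs] by (cases "n \<le> m") (auto simp: Int_commute)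
  qed (auto simp: cyls_def)
qed

lemma sets_path_space_eq: "sets (path_space :: (nat \<Rightarrow> int ^ 'd) measure) = sigma_sets UNIV cyls"
proof
  let ?S = "sigma UNIV (cyls :: (nat \<Rightarrow> int ^ 'd) set set)"
  have S: "sets ?S = sigma_sets UNIV cyls" by (intro sets_measure_of) auto
  have "(\<lambda>X. X) \<in> measurable ?S (\<Pi>\<^sub>M n\<in>UNIV. count_space (UNIV :: (int ^ 'd) set))"
  proof (rule measurable_PiM_single')
    fix n :: nat
    show "(\<lambda>X. X n) \<in> measurable ?S (count_space (UNIV :: (int ^ 'd) set))"
    proof (subst measurable_count_space_eq_countable)
      show "(\<lambda>X. X n) \<in> space ?S \<rightarrow> UNIV \<and> (\<forall>a\<in>UNIV. (\<lambda>X. X n) -` {a} \<inter> space ?S \<in> sets ?S)"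
      proof (intro conjI ballI)
        fix a :: "int ^ 'd"
        have "(\<lambda>X. X n) -` {a} \<inter> space ?S = (\<Union>w\<in>{w. length w = Suc n \<and> w ! n = a}. cyl n (nth w))"
          (is "?l = ?r")
        proof
          show "?l \<subseteq> ?r"
          proof
            fix X assume "X \<in> ?l"
            thus "X \<in> ?r" by (intro UN_I[of "prefix_of X n"]) auto
          qed
          show "?r \<subseteq> ?l" by (auto simp: space_measure_of_conv cyl_def)
        qed
        also have "\<dots> \<in> sets ?S"
        proof (rule sets.countable_UN'')
          fix w :: "(int ^ 'd) list"
          have "cyl n (nth w) \<in> cyls" unfolding cyls_def by blast
          thus "cyl n (nth w) \<in> sets ?S" unfolding S by (rule sigma_sets.Basic)
        qed simp
        finally show "(\<lambda>X. X n) -` {a} \<inter> space ?S \<in> sets ?S" .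
      qed simp
    qed simp
  qed simp
  note m = this
  show "sets path_space \<subseteq> sigma_sets UNIV (cyls :: (nat \<Rightarrow> int ^ 'd) set set)"
  proof
    fix A :: "(nat \<Rightarrow> int ^ 'd) set" assume "A \<in> sets path_space"
    from measurable_sets[OF m this[unfolded path_space_def]]
    have "A \<inter> space ?S \<in> sigma_sets UNIV cyls" unfolding S by simp
    thus "A \<in> sigma_sets UNIV cyls" by (simp add: space_measure_of_conv)
  qed
  show "sigma_sets UNIV cyls \<subseteq> sets (path_space :: (nat \<Rightarrow> int ^ 'd) measure)"
  proof -
    have "cyls \<subseteq> sets (path_space :: (nat \<Rightarrow> int ^ 'd) measure)"
      unfolding cyls_def using cyl_in_sets by blast
    from sets.sigma_sets_subset[OF this] show ?thesis by simp
  qed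
qed

text \<open>Annealed cylinder probabilities determine everything proved about the walk, so the
  environment does not appear as a random variable next to the path.\<close>

locale annealed = rwre \<mu> i1 for \<mu> :: "(int ^ 'd \<Rightarrow> real) measure" and i1 :: 'd +
  fixes P :: "(nat \<Rightarrow> int ^ 'd) measure"
  assumes P_prob: "prob_space P" and P_sets: "sets P = sets path_space"
    and P_cyl: "measure P (cyl n zs) = (if zs 0 = 0 then ann_wt zs n else 0)"

sublocale annealed \<subseteq> prob_space P
  by (rule P_prob)

context annealed
begin

lemma space_P [simp]: "space P = UNIV"
  using sets_eq_imp_space_eq[OF P_sets] by simp

lemma sets_P [measurable_cong]: "sets P = sets path_space"
  by (rule P_sets)

lemma cyl_sets_P [simp]: "cyl n zs \<in> sets P"
  unfolding P_sets by (rule cyl_in_sets)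

lemma AE_nearest_neighbour: "AE X in P. X 0 = 0 \<and> (\<forall>k. X (Suc k) - X k \<in> nbr)"
proof -
  have null: "AE X in P. X \<notin> cyl (Suc n) (nth w)"
    if "w ! 0 \<noteq> 0 \<or> (w ! Suc n - w ! n \<notin> nbr)" for n and w :: "(int ^ 'd) list"
  proof -
    have "ann_wt (nth w) (Suc n) = 0" if "w ! Suc n - w ! n \<notin> nbr"
    proof -
      have "ann_wt (nth w) (Suc n) = (\<integral>\<omega>. 0 \<partial>env)" unfolding ann_wt_def
        using AE_env_elliptic that ellipticD(4)
        by (intro integral_cong_AE) (auto elim!: eventually_mono simp: traj_wt_def)
      thus ?thesis by simp
    qed
    hence "measure P (cyl (Suc n) (nth w)) = 0" using that by (auto simp: P_cyl)
    thus ?thesis by (intro AE_not_in) (auto simp: null_sets_def emeasure_eq_measure)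
  qed
  have "AE X in P. \<forall>n w. w ! 0 \<noteq> 0 \<or> (w ! Suc n - w ! n \<notin> nbr) \<longrightarrow> X \<notin> cyl (Suc n) (nth w)"
    unfolding AE_all_countable using null by auto
  thus ?thesis
  proof eventually_elim
    case (elim X)
    have "X \<in> cyl (Suc n) (nth (prefix_of X (Suc n)))" for n by (auto simp: cyl_def)
    with elim have "prefix_of X (Suc n) ! 0 = 0 \<and> prefix_of X (Suc n) ! Suc n - prefix_of X (Suc n) ! n \<in> nbr" for n
      by blast
    thus ?case by simp
  qed
qed

end

section \<open>Exit estimates\<close>

definition traj :: "(int ^ 'd) list \<Rightarrow> nat \<Rightarrow> int ^ 'd" where
  "traj es k = sum_list (take k es)"

lemma traj_Suc: "k < length es \<Longrightarrow> traj es (Suc k) = traj es k + es ! k"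
  by (simp add: traj_def take_Suc_conv_app_nth)

lemma traj_append: "k \<le> length es \<Longrightarrow> traj (es @ es') k = traj es k"
  by (simp add: traj_def)

lemma traj_increments:
  assumes "X 0 = 0" "k \<le> n"
  shows "traj (map (\<lambda>k. X (Suc k) - X k) [0..<n]) k = X k"
  using assms(2)
proof (induction k)
  case (Suc k)
  thus ?case by (subst traj_Suc) (auto simp: nth_append)
qed (simp add: traj_def assms(1))

lemma traj_inj:
  assumes "length es = n" "length es' = n" "\<And>k. k \<le> n \<Longrightarrow> traj es k = traj es' k"
  shows "es = es'"
proof (rule nth_equalityI)
  fix k assume k: "k < length es"
  have "traj es (Suc k) - traj es k = traj es' (Suc k) - traj es' k"
    using k assms by simp
  thus "es ! k = es' ! k" using k assms by (simp add: traj_Suc)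
qed (use assms in simp)

context annealed
begin

lemma prob_UNIV [simp]: "measure P UNIV = 1"
  using prob_space by simp

definition step_event :: "(int ^ 'd) set \<Rightarrow> nat \<Rightarrow> int ^ 'd \<Rightarrow> int ^ 'd \<Rightarrow> (nat \<Rightarrow> int ^ 'd) set" where
  "step_event B n y e = {X. (\<forall>k\<le>n. X k \<in> B) \<and> X n = y \<and> X (Suc n) = y + e}"

lemma step_event_sets [measurable]: "step_event B n y e \<in> sets P"
proof -
  have "{X \<in> space P. (\<forall>k\<in>{..n}. X k \<in> B) \<and> X n = y \<and> X (Suc n) = y + e} \<in> sets P" by measurable
  thus ?thesis by (simp add: step_event_def Ball_def)
qed

text \<open>The bridge from the quenched Green function to the annealed walk. The event splits into
  words from 0 to \<open>y\<close> inside \<open>B\<close> followed by the step \<open>e\<close>.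
  The weight of each word carries the factor \<open>\<omega> y e\<close>, and the remaining factors
  sum to \<open>path_wt\<close>.\<close>

lemma emeasure_step_event:
  assumes y: "y \<in> B" and e: "e \<in> nbr"
  shows "emeasure P (step_event B n y e) = (\<integral>\<^sup>+\<omega>. ennreal (path_wt \<omega> B y n 0) * ennreal (\<omega> y e) \<partial>env)"
proof -
  define Lw where "Lw = {es \<in> step_lists n. (\<forall>k<n. traj es k \<in> B) \<and> sum_list es = y}"
  define C where "C es = cyl (Suc n) (traj (es @ [e]))" for es
  have finL: "finite Lw" by (simp add: Lw_def)
  have len: "length es = n" if "es \<in> Lw" for es using that by (auto simp: Lw_def step_lists_def)
  have trn: "traj es n = y" if "es \<in> Lw" for es using that by (auto simp: Lw_def step_lists_def traj_def)
  have trSn: "traj (es @ [e]) (Suc n) = y + e" if "es \<in> Lw" for es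
    using that len[OF that] by (auto simp: Lw_def traj_def)
  have "AE X in P. X \<in> step_event B n y e \<longleftrightarrow> X \<in> (\<Union>es\<in>Lw. C es)"
    using AE_nearest_neighbour
  proof eventually_elim
    case (elim X)
    show ?case
    proof
      assume X: "X \<in> step_event B n y e"
      define es where "es = map (\<lambda>k. X (Suc k) - X k) [0..<n]"
      have tr: "traj es k = X k" if "k \<le> n" for k
        unfolding es_def using elim that by (intro traj_increments) auto
      have lenes: "length es = n" by (simp add: es_def)
      have "sum_list es = traj es n" using lenes by (simp add: traj_def)
      hence es: "es \<in> Lw" using X elim tr
        by (auto simp: Lw_def step_lists_def step_event_def es_def)
      have "X k = traj (es @ [e]) k" if "k \<le> Suc n" for k
      proof (cases "k = Suc n")
        case True
        thus ?thesis using trSn[OF es] X by (simp add: step_event_def)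
      next
        case False
        thus ?thesis using that tr by (simp add: traj_append lenes)
      qed
      thus "X \<in> (\<Union>es\<in>Lw. C es)" using es by (auto simp: C_def cyl_def)
    next
      assume "X \<in> (\<Union>es\<in>Lw. C es)"
      then obtain es where es: "es \<in> Lw" and "X \<in> C es" by auto
      hence X: "X k = traj (es @ [e]) k" if "k \<le> Suc n" for k using that by (auto simp: C_def cyl_def)
      have Xk: "X k = traj es k" if "k \<le> n" for k using X[of k] that len[OF es] by (simp add: traj_append)
      have "X k \<in> B" if "k \<le> n" for k
        using Xk[OF that] trn[OF es] es y that by (cases "k = n") (auto simp: Lw_def)
      thus "X \<in> step_event B n y e"
        using Xk[of n] X[of "Suc n"] trn[OF es] trSn[OF es] by (auto simp: step_event_def)
    qed
  qed
  hence "emeasure P (step_event B n y e) = emeasure P (\<Union>es\<in>Lw. C es)"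
    using finL by (intro emeasure_eq_AE) (auto simp: C_def)
  also have "\<dots> = (\<Sum>es\<in>Lw. emeasure P (C es))"
  proof (intro sum_emeasure[symmetric])
    show "disjoint_family_on C Lw"
      unfolding disjoint_family_on_def
    proof (intro ballI impI)
      fix es es' assume *: "es \<in> Lw" "es' \<in> Lw" "es \<noteq> es'"
      show "C es \<inter> C es' = {}"
      proof (rule ccontr)
        assume "C es \<inter> C es' \<noteq> {}"
        then obtain X where "X \<in> C es" "X \<in> C es'" by auto
        hence "traj es k = traj es' k" if "k \<le> n" for k
          using that traj_append[of k es "[e]"] traj_append[of k es' "[e]"] len[OF *(1)] len[OF *(2)]
          by (auto simp: C_def cyl_def)
        thus False using traj_inj[OF len[OF *(1)] len[OF *(2)]] *(3) by blast
      qed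
    qed
  qed (use finL in \<open>auto simp: C_def\<close>)
  also have "\<dots> = (\<Sum>es\<in>Lw. \<integral>\<^sup>+\<omega>. ennreal (traj_wt \<omega> (traj (es @ [e])) (Suc n)) \<partial>env)"
  proof (intro sum.cong refl)
    fix es assume "es \<in> Lw"
    have "emeasure P (C es) = ennreal (ann_wt (traj (es @ [e])) (Suc n))"
      unfolding emeasure_eq_measure C_def P_cyl by (simp add: traj_def)
    also have "\<dots> = (\<integral>\<^sup>+\<omega>. ennreal (traj_wt \<omega> (traj (es @ [e])) (Suc n)) \<partial>env)"
      unfolding ann_wt_def using AE_env_elliptic traj_wt_bounds
      by (intro nn_integral_eq_integral[symmetric]) (auto elim!: eventually_mono)
    finally show "emeasure P (C es) = (\<integral>\<^sup>+\<omega>. ennreal (traj_wt \<omega> (traj (es @ [e])) (Suc n)) \<partial>env)" .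
  qed
  also have "\<dots> = (\<integral>\<^sup>+\<omega>. (\<Sum>es\<in>Lw. ennreal (traj_wt \<omega> (traj (es @ [e])) (Suc n))) \<partial>env)"
    by (rule nn_integral_sum[symmetric]) measurable
  also have "\<dots> = (\<integral>\<^sup>+\<omega>. ennreal (path_wt \<omega> B y n 0) * ennreal (\<omega> y e) \<partial>env)"
  proof (intro nn_integral_cong_AE)
    show "AE \<omega> in env. (\<Sum>es\<in>Lw. ennreal (traj_wt \<omega> (traj (es @ [e])) (Suc n)))
        = ennreal (path_wt \<omega> B y n 0) * ennreal (\<omega> y e)"
      using AE_env_elliptic
    proof eventually_elim
      case (elim \<omega>)
      hence el: "\<And>x. elliptic (\<omega> x)" by simp
      have tw: "traj_wt \<omega> (traj (es @ [e])) (Suc n) = (\<Prod>k<n. \<omega> (traj es k) (es ! k)) * \<omega> y e" if "es \<in> Lw" for es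
      proof -
        have "traj (es @ [e]) (Suc k) - traj (es @ [e]) k = es ! k" if "k < n" for k
          using that len[OF \<open>es \<in> Lw\<close>] by (simp add: traj_append traj_Suc nth_append)
        moreover have "traj (es @ [e]) (Suc n) - traj (es @ [e]) n = e" "traj (es @ [e]) n = y"
          using trSn[OF that] trn[OF that] len[OF that] by (simp_all add: traj_append)
        ultimately show ?thesis using len[OF that] by (simp add: traj_wt_def traj_append)
      qed
      have "(\<Sum>es\<in>Lw. ennreal (traj_wt \<omega> (traj (es @ [e])) (Suc n)))
          = ennreal (\<Sum>es\<in>Lw. traj_wt \<omega> (traj (es @ [e])) (Suc n))"
        using traj_wt_bounds(1)[OF el] by (intro sum_ennreal) auto
      also have "(\<Sum>es\<in>Lw. traj_wt \<omega> (traj (es @ [e])) (Suc n)) = (\<Sum>es\<in>Lw. \<Prod>k<n. \<omega> (traj es k) (es ! k)) * \<omega> y e"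
        by (simp add: tw sum_distrib_right)
      also have "(\<Sum>es\<in>Lw. \<Prod>k<n. \<omega> (traj es k) (es ! k)) = path_wt \<omega> B y n 0"
        unfolding path_wt_eq Lw_def traj_def add_0_left by (rule sum.inter_filter) simp
      finally show ?case using ellipticD(2)[OF el] path_wt_nonneg[of B \<omega>, OF el] by (simp add: ennreal_mult)
    qed
  qed
  finally show ?thesis .
qed

text \<open>\<open>J e\<close> is the mean number of steps from \<open>y\<close> to
  \<open>y + e\<close> before the exit from \<open>B\<close>. Since \<open>\<omega> y\<close> sums
  to 1, the sum of the \<open>J e\<close> is the mean of the Green function, and Kalikow's
  inequality becomes a statement about the annealed walk alone.\<close>

lemma step_event_sums:
  assumes y: "y \<in> B" and B: "B \<noteq> UNIV"
  obtains J where "\<And>e. e \<in> nbr \<Longrightarrow> (\<lambda>n. measure P (step_event B n y e)) sums J e"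
    "\<And>e. e \<in> nbr \<Longrightarrow> 0 \<le> J e"
    "cK * (\<Sum>e\<in>nbr. J e) \<le> J (axis i1 1) - J (- axis i1 1)"
proof -
  let ?a = "axis i1 1 :: int ^ 'd"
  let ?I = "\<lambda>e. \<integral>\<^sup>+\<omega>. green B 0 y \<omega> * ennreal (\<omega> y e) \<partial>env"
  have I: "(\<Sum>n. emeasure P (step_event B n y e)) = ?I e" if "e \<in> nbr" for e
  proof -
    have "(\<Sum>n. emeasure P (step_event B n y e)) = (\<integral>\<^sup>+\<omega>. (\<Sum>n. ennreal (path_wt \<omega> B y n 0) * ennreal (\<omega> y e)) \<partial>env)"
      unfolding emeasure_step_event[OF y that] by (rule nn_integral_suminf[symmetric]) measurable
    thus ?thesis by (simp add: green_eq_suminf)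
  qed
  have G: "(\<integral>\<^sup>+\<omega>. green B 0 y \<omega> \<partial>env) = (\<Sum>e\<in>nbr. ?I e)"
  proof -
    have "(\<integral>\<^sup>+\<omega>. green B 0 y \<omega> \<partial>env) = (\<integral>\<^sup>+\<omega>. (\<Sum>e\<in>nbr. green B 0 y \<omega> * ennreal (\<omega> y e)) \<partial>env)"
    proof (intro nn_integral_cong_AE)
      show "AE \<omega> in env. green B 0 y \<omega> = (\<Sum>e\<in>nbr. green B 0 y \<omega> * ennreal (\<omega> y e))"
        using AE_env_elliptic
      proof eventually_elim
        case (elim \<omega>)
        have "(\<Sum>e\<in>nbr. ennreal (\<omega> y e)) = 1"
          using elim ellipticD(2,3)[of "\<omega> y"] by (subst sum_ennreal) auto
        thus ?case by (simp add: sum_distrib_left[symmetric])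
      qed
    qed
    also have "\<dots> = (\<Sum>e\<in>nbr. ?I e)" by (rule nn_integral_sum) measurable
    finally show ?thesis .
  qed
  have fin: "?I e < \<infinity>" if "e \<in> nbr" for e
  proof -
    have "?I e \<le> (\<Sum>e\<in>nbr. ?I e)" using that by (intro member_le_sum) auto
    also have "\<dots> < \<infinity>" using green_integral_finite[OF y B, of 0] unfolding G .
    finally show ?thesis .
  qed
  define J where "J e = enn2real (?I e)" for e
  have J: "?I e = ennreal (J e)" if "e \<in> nbr" for e using fin[OF that] by (simp add: J_def)
  have J0: "0 \<le> J e" for e by (simp add: J_def)
  show ?thesis
  proof (rule that[of J])
    fix e :: "int ^ 'd" assume e: "e \<in> nbr"
    have *: "(\<Sum>n. ennreal (measure P (step_event B n y e))) = ennreal (J e)"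
      using I[OF e] J[OF e] by (simp add: emeasure_eq_measure)
    hence "summable (\<lambda>n. measure P (step_event B n y e))"
      by (intro summable_suminf_not_top) auto
    moreover from this have "(\<Sum>n. measure P (step_event B n y e)) = J e"
      using * J0 by (simp add: suminf_ennreal2 suminf_nonneg)
    ultimately show "(\<lambda>n. measure P (step_event B n y e)) sums J e" by (simp add: sums_iff)
  next
    have "ennreal (J (- ?a) + cK * (\<Sum>e\<in>nbr. J e)) \<le> ennreal (J ?a)"
    proof -
      have "(\<Sum>e\<in>nbr. ?I e) = ennreal (\<Sum>e\<in>nbr. J e)"
        using J0 by (simp add: J sum_ennreal)
      hence "ennreal (J (- ?a)) + ennreal cK * ennreal (\<Sum>e\<in>nbr. J e) \<le> ennreal (J ?a)"
        using kalikow_inequality[OF y B, of 0] by (simp only: G J axis_in_nbr)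
      thus ?thesis using J0 cK_pos by (simp add: ennreal_mult'[symmetric] sum_nonneg)
    qed
    hence "J (- ?a) + cK * (\<Sum>e\<in>nbr. J e) \<le> J ?a" using J0 by simp
    thus "cK * (\<Sum>e\<in>nbr. J e) \<le> J ?a - J (- ?a)" by simp
  qed (rule J0)
qed

text \<open>Along a nearest-neighbour path this telescopes to \<open>f\<close> at time \<open>N\<close> or at the exit from \<open>B\<close>.\<close>
definition stopped_sum :: "(int ^ 'd) set \<Rightarrow> (int ^ 'd \<Rightarrow> real) \<Rightarrow> nat \<Rightarrow> (nat \<Rightarrow> int ^ 'd) \<Rightarrow> real" where
  "stopped_sum B f N X = f 0 + (\<Sum>n<N. \<Sum>y\<in>B. \<Sum>e\<in>nbr. indicator (step_event B n y e) X * (f (y + e) - f y))"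

lemma stopped_sum_eq:
  assumes B: "finite B" and X: "X 0 = 0" "\<And>k. X (Suc k) - X k \<in> nbr"
  obtains m where "m \<le> N" "stopped_sum B f N X = f (X m)" "\<And>k. k < m \<Longrightarrow> X k \<in> B"
    "m < N \<Longrightarrow> X m \<notin> B"
proof -
  have step: "(\<Sum>y\<in>B. \<Sum>e\<in>nbr. indicator (step_event B n y e) X * (f (y + e) - f y))
      = (if \<forall>k\<le>n. X k \<in> B then f (X (Suc n)) - f (X n) else 0)" for n
  proof (cases "\<forall>k\<le>n. X k \<in> B")
    case True
    define e0 where "e0 = X (Suc n) - X n"
    have ind: "indicator (step_event B n y e) X = (if y = X n then if e = e0 then 1 else 0 else (0::real))" for y e
      using True by (auto simp: step_event_def e0_def indicator_def)
    have "(\<Sum>y\<in>B. \<Sum>e\<in>nbr. indicator (step_event B n y e) X * (f (y + e) - f y))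
       = (\<Sum>y\<in>B. if y = X n then (\<Sum>e\<in>nbr. if e = e0 then f (y + e) - f y else 0) else 0)"
    proof (intro sum.cong refl)
      fix y
      show "(\<Sum>e\<in>nbr. indicator (step_event B n y e) X * (f (y + e) - f y)) =
          (if y = X n then (\<Sum>e\<in>nbr. if e = e0 then f (y + e) - f y else 0) else 0)"
      proof (cases "y = X n")
        case True
        have "(\<Sum>e\<in>nbr. indicator (step_event B n y e) X * (f (y + e) - f y)) =
            (\<Sum>e\<in>nbr. if e = e0 then f (y + e) - f y else 0)"
          by (rule sum.cong[OF refl]) (simp only: ind True if_True, simp)
        thus ?thesis unfolding if_P[OF True] .
      next
        case False
        thus ?thesis by (simp only: ind if_False mult_zero_left sum.neutral_const)
      qed
    qed
    also have "\<dots> = f (X n + e0) - f (X n)"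
      using B True X(2)[of n] by (simp add: e0_def)
    finally show ?thesis using True by (simp add: e0_def)
  qed (auto simp: step_event_def)
  have "\<exists>m\<le>N. stopped_sum B f N X = f (X m) \<and> (\<forall>k<m. X k \<in> B) \<and> (m < N \<longrightarrow> X m \<notin> B)"
  proof (induction N)
    case 0
    thus ?case by (simp add: stopped_sum_def X)
  next
    case (Suc N)
    then obtain m where m: "m \<le> N" "stopped_sum B f N X = f (X m)" "\<forall>k<m. X k \<in> B" "m < N \<longrightarrow> X m \<notin> B" by auto
    have eq: "stopped_sum B f (Suc N) X = f (X m) + (if \<forall>k\<le>N. X k \<in> B then f (X (Suc N)) - f (X N) else 0)"
      using m(2) step[of N] by (simp add: stopped_sum_def)
    show ?case
    proof (cases "\<forall>k\<le>N. X k \<in> B")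
      case True
      hence "m = N" using m by (meson le_neq_implies_less)
      thus ?thesis using eq True by (intro exI[of _ "Suc N"]) (auto simp: less_Suc_eq_le)
    next
      case False
      have "X m \<notin> B"
      proof
        assume "X m \<in> B"
        with m have "m = N" by auto
        thus False using False m \<open>X m \<in> B\<close> by (auto simp: le_less)
      qed
      thus ?thesis using eq False m by (intro exI[of _ m]) auto
    qed
  qed
  thus ?thesis using that by blast
qed

lemma stopped_sum_integral:
  assumes "finite B"
  shows "integrable P (stopped_sum B f N)"
    and "(\<integral>X. stopped_sum B f N X \<partial>P) =
       f 0 + (\<Sum>y\<in>B. \<Sum>e\<in>nbr. (\<Sum>n<N. measure P (step_event B n y e)) * (f (y + e) - f y))"
proof -
  define g where "g n y e X = indicator (step_event B n y e) X * (f (y + e) - f y)" for n y e X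
  have S: "stopped_sum B f N = (\<lambda>X. f 0 + (\<Sum>n<N. \<Sum>y\<in>B. \<Sum>e\<in>nbr. g n y e X))"
    unfolding stopped_sum_def g_def ..
  have i: "integrable P (g n y e)" for n y e
    unfolding g_def by (intro integrable_mult_left integrable_real_indicator) (auto simp: emeasure_eq_measure)
  have ig: "(\<integral>X. g n y e X \<partial>P) = measure P (step_event B n y e) * (f (y + e) - f y)" for n y e
    unfolding g_def by simp
  show "integrable P (stopped_sum B f N)" unfolding S
    by (intro Bochner_Integration.integrable_add Bochner_Integration.integrable_sum i) simp
  have "(\<integral>X. stopped_sum B f N X \<partial>P) =
      f 0 + (\<Sum>n<N. \<Sum>y\<in>B. \<Sum>e\<in>nbr. measure P (step_event B n y e) * (f (y + e) - f y))"
    unfolding S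
    by (simp add: Bochner_Integration.integral_add Bochner_Integration.integral_sum
        Bochner_Integration.integrable_sum i ig)
  also have "(\<Sum>n<N. \<Sum>y\<in>B. \<Sum>e\<in>nbr. measure P (step_event B n y e) * (f (y + e) - f y))
     = (\<Sum>y\<in>B. \<Sum>e\<in>nbr. (\<Sum>n<N. measure P (step_event B n y e)) * (f (y + e) - f y))"
    by (subst sum.swap, intro sum.cong refl, subst sum.swap) (simp add: sum_distrib_right)
  finally show "(\<integral>X. stopped_sum B f N X \<partial>P) =
       f 0 + (\<Sum>y\<in>B. \<Sum>e\<in>nbr. (\<Sum>n<N. measure P (step_event B n y e)) * (f (y + e) - f y))" .
qed

end

lemma finite_box: "finite {x :: int ^ 'd. \<forall>i. \<bar>x $ i\<bar> \<le> R}"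
proof -
  have "{x :: int ^ 'd. \<forall>i. \<bar>x $ i\<bar> \<le> R} \<subseteq> vec_lambda ` (\<Pi>\<^sub>E i\<in>UNIV. {-R..R})"
  proof
    fix x :: "int ^ 'd" assume "x \<in> {x. \<forall>i. \<bar>x $ i\<bar> \<le> R}"
    hence "vec_nth x \<in> (\<Pi>\<^sub>E i\<in>UNIV. {-R..R})" by (auto simp: abs_le_iff minus_le_iff)
    moreover have "x = vec_lambda (vec_nth x)" by simp
    ultimately show "x \<in> vec_lambda ` (\<Pi>\<^sub>E i\<in>UNIV. {-R..R})" by blast
  qed
  moreover have "finite (vec_lambda ` (\<Pi>\<^sub>E i\<in>(UNIV :: 'd set). {-R..R}) :: (int ^ 'd) set)"
    by (intro finite_imageI finite_PiE) auto
  ultimately show ?thesis by (rule finite_subset)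
qed

lemma nbr_component_le: "e \<in> nbr \<Longrightarrow> \<bar>e $ i\<bar> \<le> 1"
  by (simp add: nbr_component)

lemma nn_path_component_le:
  fixes X :: "nat \<Rightarrow> int ^ 'd"
  assumes "X 0 = 0" "\<And>k. X (Suc k) - X k \<in> nbr"
  shows "\<bar>X n $ i\<bar> \<le> int n"
proof (induction n)
  case (Suc n)
  have "X (Suc n) $ i = X n $ i + (X (Suc n) - X n) $ i" by simp
  thus ?case using Suc nbr_component_le[OF assms(2)[of n], of i] by linarith
qed (simp add: assms)

section \<open>Mean hitting times and the probability of never backtracking\<close>

context annealed
begin

lemma pred_site: "Measurable.pred P (\<lambda>X. Q (X n))"
proof -
  have "(\<lambda>X. X n) \<in> measurable P (count_space UNIV)" by measurable
  thus ?thesis by (rule measurable_compose) simp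
qed

lemma pred_level [measurable]:
  "Measurable.pred P (\<lambda>X. X n $ i1 < c)" "Measurable.pred P (\<lambda>X. c \<le> X n $ i1)"
  "Measurable.pred P (\<lambda>X. X n \<in> B)"
  by (rule pred_site)+

text \<open>A substitute for Dynkin's formula. The counts \<open>J\<close> depend on
  \<open>B\<close> only and are fixed before \<open>f\<close>, so one choice serves every test
  function. Finiteness of \<open>B\<close> reduces the limit to finitely many series.\<close>

lemma stopped_sum_tendsto:
  assumes B: "finite B" "B \<noteq> UNIV"
  obtains J where "\<And>y e. y \<in> B \<Longrightarrow> e \<in> nbr \<Longrightarrow> (\<lambda>n. measure P (step_event B n y e)) sums J y e"
    "\<And>y e. y \<in> B \<Longrightarrow> e \<in> nbr \<Longrightarrow> 0 \<le> J y e"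
    "\<And>y. y \<in> B \<Longrightarrow> cK * (\<Sum>e\<in>nbr. J y e) \<le> J y (axis i1 1) - J y (- axis i1 1)"
    "\<And>f. (\<lambda>N. \<integral>X. stopped_sum B f N X \<partial>P) \<longlonglongrightarrow> f 0 + (\<Sum>y\<in>B. \<Sum>e\<in>nbr. J y e * (f (y + e) - f y))"
proof -
  have "\<forall>y\<in>B. \<exists>J. (\<forall>e\<in>nbr. (\<lambda>n. measure P (step_event B n y e)) sums J e) \<and> (\<forall>e\<in>nbr. 0 \<le> J e) \<and>
      cK * (\<Sum>e\<in>nbr. J e) \<le> J (axis i1 1) - J (- axis i1 1)"
  proof
    fix y assume "y \<in> B"
    show "\<exists>J. (\<forall>e\<in>nbr. (\<lambda>n. measure P (step_event B n y e)) sums J e) \<and> (\<forall>e\<in>nbr. 0 \<le> J e) \<and>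
      cK * (\<Sum>e\<in>nbr. J e) \<le> J (axis i1 1) - J (- axis i1 1)"
      by (rule step_event_sums[OF \<open>y \<in> B\<close> B(2)]) blast
  qed
  from bchoice[OF this] obtain J where J0: "\<forall>y\<in>B. (\<forall>e\<in>nbr. (\<lambda>n. measure P (step_event B n y e)) sums J y e) \<and>
      (\<forall>e\<in>nbr. 0 \<le> J y e) \<and> cK * (\<Sum>e\<in>nbr. J y e) \<le> J y (axis i1 1) - J y (- axis i1 1)" ..
  have J: "\<And>y e. y \<in> B \<Longrightarrow> e \<in> nbr \<Longrightarrow> (\<lambda>n. measure P (step_event B n y e)) sums J y e"
    "\<And>y e. y \<in> B \<Longrightarrow> e \<in> nbr \<Longrightarrow> 0 \<le> J y e"
    "\<And>y. y \<in> B \<Longrightarrow> cK * (\<Sum>e\<in>nbr. J y e) \<le> J y (axis i1 1) - J y (- axis i1 1)"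
    using J0 by blast+
  show ?thesis
  proof (rule that[of J])
    fix f :: "int ^ 'd \<Rightarrow> real"
    show "(\<lambda>N. \<integral>X. stopped_sum B f N X \<partial>P) \<longlonglongrightarrow> f 0 + (\<Sum>y\<in>B. \<Sum>e\<in>nbr. J y e * (f (y + e) - f y))"
      unfolding stopped_sum_integral(2)[OF B(1)]
      by (intro tendsto_intros) (rule J(1)[unfolded sums_def])
  qed (fact J)+
qed

text \<open>Test function: the level. Its mean at the exit is at most \<open>L\<close>, since steps
  raise the level by at most 1, while each step spent in \<open>B\<close> contributes at least
  \<open>cK\<close> on average.\<close>

lemma expected_exit_time:
  assumes B: "finite B" "\<And>x. x \<in> B \<Longrightarrow> x $ i1 < int L"
  shows "(\<Sum>n<N. measure P {X. \<forall>k\<le>n. X k \<in> B}) \<le> real L / cK"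
proof -
  have "axis i1 (int L) \<notin> B" using B(2)[of "axis i1 (int L)"] by (auto simp: axis_def)
  hence BU: "B \<noteq> UNIV" by auto
  obtain J where J: "\<And>y e. y \<in> B \<Longrightarrow> e \<in> nbr \<Longrightarrow> (\<lambda>n. measure P (step_event B n y e)) sums J y e"
    "\<And>y e. y \<in> B \<Longrightarrow> e \<in> nbr \<Longrightarrow> 0 \<le> J y e"
    "\<And>y. y \<in> B \<Longrightarrow> cK * (\<Sum>e\<in>nbr. J y e) \<le> J y (axis i1 1) - J y (- axis i1 1)"
    and lim: "\<And>f. (\<lambda>N. \<integral>X. stopped_sum B f N X \<partial>P) \<longlonglongrightarrow> f 0 + (\<Sum>y\<in>B. \<Sum>e\<in>nbr. J y e * (f (y + e) - f y))"
    using stopped_sum_tendsto[OF B(1) BU] by blast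
  define f where "f x = real_of_int (x $ i1)" for x :: "int ^ 'd"
  have "(\<Sum>y\<in>B. cK * (\<Sum>e\<in>nbr. J y e)) \<le> (\<Sum>y\<in>B. J y (axis i1 1) - J y (- axis i1 1))"
    by (intro sum_mono J(3))
  also have "\<dots> = f 0 + (\<Sum>y\<in>B. \<Sum>e\<in>nbr. J y e * (f (y + e) - f y))"
    by (simp add: f_def sum_nbr_component)
  also have "\<dots> \<le> real L"
  proof (rule LIMSEQ_le_const2[OF lim], intro exI allI impI)
    fix N :: nat
    show "(\<integral>X. stopped_sum B f N X \<partial>P) \<le> real L"
    proof (rule integral_le_const[OF stopped_sum_integral(1)[OF B(1)]])
      show "AE X in P. stopped_sum B f N X \<le> real L" using AE_nearest_neighbour
      proof eventually_elim
        case (elim X)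
        then obtain m where m: "stopped_sum B f N X = f (X m)" "\<And>k. k < m \<Longrightarrow> X k \<in> B"
          using stopped_sum_eq[OF B(1), of X N f] by blast
        have "X m $ i1 \<le> int L"
        proof (cases m)
          case 0
          thus ?thesis using elim by simp
        next
          case (Suc k)
          have "X k $ i1 < int L" using m(2)[of k] B(2) Suc by simp
          moreover have "X (Suc k) $ i1 = X k $ i1 + (X (Suc k) - X k) $ i1" by simp
          moreover have "(X (Suc k) - X k) $ i1 \<le> 1"
            using elim nbr_component_le[of "X (Suc k) - X k" i1] by auto
          ultimately have "X (Suc k) $ i1 \<le> int L" by linarith
          thus ?thesis using Suc by simp
        qed
        thus ?case by (simp add: m f_def)
      qed
    qed
  qed
  finally have bound: "cK * (\<Sum>y\<in>B. \<Sum>e\<in>nbr. J y e) \<le> real L" by (simp add: sum_distrib_left)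
  \<comment> \<open>Being in \<open>B\<close> up to time \<open>n\<close> means that the step after
    time \<open>n\<close> starts at some \<open>y\<close> in \<open>B\<close>, so the probability is
    covered by the step events counted in \<open>J\<close>.\<close>
  have "measure P {X. \<forall>k\<le>n. X k \<in> B} \<le> (\<Sum>y\<in>B. \<Sum>e\<in>nbr. measure P (step_event B n y e))" for n
  proof -
    have "measure P {X. \<forall>k\<le>n. X k \<in> B} \<le> measure P (\<Union>z\<in>B \<times> nbr. step_event B n (fst z) (snd z))"
    proof (rule finite_measure_mono_AE)
      show "AE X in P. X \<in> {X. \<forall>k\<le>n. X k \<in> B} \<longrightarrow> X \<in> (\<Union>z\<in>B \<times> nbr. step_event B n (fst z) (snd z))"
        using AE_nearest_neighbour
      proof eventually_elim
        case (elim X)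
        show ?case
        proof
          assume "X \<in> {X. \<forall>k\<le>n. X k \<in> B}"
          thus "X \<in> (\<Union>z\<in>B \<times> nbr. step_event B n (fst z) (snd z))"
            using elim by (intro UN_I[of "(X n, X (Suc n) - X n)"]) (auto simp: step_event_def)
        qed
      qed
    qed (use B in auto)
    also have "\<dots> \<le> (\<Sum>z\<in>B \<times> nbr. measure P (step_event B n (fst z) (snd z)))"
      using B by (intro finite_measure_subadditive_finite) auto
    finally show ?thesis by (simp add: sum.cartesian_product case_prod_unfold)
  qed
  hence "(\<Sum>n<N. measure P {X. \<forall>k\<le>n. X k \<in> B}) \<le> (\<Sum>n<N. \<Sum>y\<in>B. \<Sum>e\<in>nbr. measure P (step_event B n y e))"
    by (intro sum_mono)
  also have "\<dots> = (\<Sum>y\<in>B. \<Sum>e\<in>nbr. \<Sum>n<N. measure P (step_event B n y e))"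
    by (subst sum.swap, intro sum.cong refl, subst sum.swap) simp
  also have "\<dots> \<le> (\<Sum>y\<in>B. \<Sum>e\<in>nbr. J y e)"
  proof (intro sum_mono)
    fix y e :: "int ^ 'd" assume "y \<in> B" "e \<in> nbr"
    from J(1)[OF this] show "(\<Sum>n<N. measure P (step_event B n y e)) \<le> J y e"
      using sum_le_suminf[of "\<lambda>n. measure P (step_event B n y e)" "{..<N}"] by (simp add: sums_iff)
  qed
  also have "\<dots> \<le> real L / cK" using bound cK_pos by (simp add: field_simps)
  finally show ?thesis .
qed

text \<open>The half-space is cut by a box of radius \<open>N\<close>, which a nearest-neighbour
  walk cannot leave before time \<open>N\<close>. This supplies the finite set required for the exit
  estimate, and the bound does not involve the box.\<close>

lemma hitting_time_mean:
  "(\<Sum>n<N. measure P {X. \<forall>k\<le>n. X k $ i1 < int L}) \<le> real L / cK"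
proof -
  define B where "B = {x :: int ^ 'd. \<forall>i. \<bar>x $ i\<bar> \<le> int N} \<inter> {x. x $ i1 < int L}"
  have "(\<Sum>n<N. measure P {X. \<forall>k\<le>n. X k $ i1 < int L}) = (\<Sum>n<N. measure P {X. \<forall>k\<le>n. X k \<in> B})"
  proof (intro sum.cong refl measure_eq_AE)
    fix n assume n: "n \<in> {..<N}"
    show "AE X in P. (X \<in> {X. \<forall>k\<le>n. X k $ i1 < int L}) = (X \<in> {X. \<forall>k\<le>n. X k \<in> B})"
      using AE_nearest_neighbour
    proof eventually_elim
      case (elim X)
      have "\<bar>X k $ i\<bar> \<le> int N" if "k \<le> n" for k i
        using nn_path_component_le[of X k i] elim that n by force
      thus ?case by (auto simp: B_def)
    qed
    have "{X \<in> space P. \<forall>k\<in>{..n}. X k $ i1 < int L} \<in> sets P" "{X \<in> space P. \<forall>k\<in>{..n}. X k \<in> B} \<in> sets P"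
      by measurable
    thus "{X. \<forall>k\<le>n. X k $ i1 < int L} \<in> sets P" "{X. \<forall>k\<le>n. X k \<in> B} \<in> sets P"
      by (simp_all add: Ball_def)
  qed
  also have "\<dots> \<le> real L / cK"
    by (rule expected_exit_time) (auto simp: B_def finite_box)
  finally show ?thesis .
qed

definition nonneg_paths :: "(nat \<Rightarrow> int ^ 'd) set" where
  "nonneg_paths = {X. \<forall>n. 0 \<le> X n $ i1}"

lemma nonneg_paths_sets [measurable]: "nonneg_paths \<in> sets P"
proof -
  have "{X \<in> space P. \<forall>n. 0 \<le> X n $ i1} \<in> sets P" by measurable
  thus ?thesis by (simp add: nonneg_paths_def)
qed

text \<open>Under Kalikow's drift, \<open>r\<close> to the power of the level is a supersolution for \<open>r = 1 - c\<close>.\<close>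
lemma nonneg_paths_pos: "measure P nonneg_paths > 0"
proof -
  let ?a = "axis i1 1 :: int ^ 'd"
  \<comment> \<open>The cap at 1/2 keeps \<open>r\<close> positive.\<close>
  define c where "c = min cK (1/2)"
  define r where "r = 1 - c"
  have c: "0 < c" "c \<le> cK" "c \<le> 1/2" using cK_pos by (auto simp: c_def)
  have r: "0 < r" "r < 1" using c by (auto simp: r_def)
  have dip: "measure P {X. \<exists>m\<le>n. X m $ i1 < 0} \<le> r" for n
  proof -
    \<comment> \<open>Within the first \<open>n\<close> steps the walk can leave this box only
      through the negative levels.\<close>
    define B where "B = {x :: int ^ 'd. \<forall>i. \<bar>x $ i\<bar> \<le> int n} \<inter> {x. 0 \<le> x $ i1}"
    have finB: "finite B" by (auto simp: B_def finite_box)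
    have "- ?a \<notin> B" by (simp add: B_def axis_def)
    hence BU: "B \<noteq> UNIV" by auto
    obtain J where "\<And>y e. y \<in> B \<Longrightarrow> e \<in> nbr \<Longrightarrow> (\<lambda>n. measure P (step_event B n y e)) sums J y e"
      and J: "\<And>y e. y \<in> B \<Longrightarrow> e \<in> nbr \<Longrightarrow> 0 \<le> J y e"
      "\<And>y. y \<in> B \<Longrightarrow> cK * (\<Sum>e\<in>nbr. J y e) \<le> J y ?a - J y (- ?a)"
      and lim: "\<And>f. (\<lambda>N. \<integral>X. stopped_sum B f N X \<partial>P) \<longlonglongrightarrow> f 0 + (\<Sum>y\<in>B. \<Sum>e\<in>nbr. J y e * (f (y + e) - f y))"
      using stopped_sum_tendsto[OF finB BU] by blast
    define f where "f x = r powi (x $ i1)" for x :: "int ^ 'd"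
    have f0: "f x > 0" for x using r by (simp add: f_def)
    have "(\<Sum>e\<in>nbr. J y e * (f (y + e) - f y)) \<le> 0" if y: "y \<in> B" for y
    proof -
      have "(\<Sum>e\<in>nbr. J y e * (f (y + e) - f y)) = (\<Sum>e\<in>{?a, - ?a}. J y e * (f (y + e) - f y))"
        by (rule sum.mono_neutral_right) (auto simp: f_def nbr_component)
      also have "\<dots> = J y ?a * (f (y + ?a) - f y) + J y (- ?a) * (f (y - ?a) - f y)"
        using axis_neq_uminus[of i1 i1] by simp
      \<comment> \<open>Steps across the axis do not change \<open>f\<close>; a step up multiplies
        it by \<open>r\<close>, a step down by \<open>1 / r\<close>.\<close>
      also have "\<dots> = f y * (1 - r) * (J y (- ?a) / r - J y ?a)"
      proof -
        have 1: "f (y + ?a) = f y * r" using r by (simp add: f_def axis_def power_int_add)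
        have 2: "f (y - ?a) = f y / r" using r by (simp add: f_def axis_def power_int_diff)
        show ?thesis unfolding 1 2 using r by (simp add: field_simps)
      qed
      also have "\<dots> \<le> 0"
      proof -
        \<comment> \<open>Kalikow's inequality with the total count replaced by the upward one:
          \<open>J y (- ?a) \<le> (1 - c) * J y ?a\<close>, which fixes the choice of
          \<open>r\<close>.\<close>
        have "J y ?a \<le> (\<Sum>e\<in>nbr. J y e)" using J(1)[OF y] by (intro member_le_sum) auto
        hence "c * J y ?a \<le> cK * (\<Sum>e\<in>nbr. J y e)"
          using c J(1)[OF y] by (intro mult_mono) auto
        hence "J y (- ?a) \<le> r * J y ?a" using J(2)[OF y] by (simp add: r_def algebra_simps)
        hence "J y (- ?a) / r \<le> J y ?a" using r by (simp add: field_simps)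
        thus ?thesis using f0[of y] r by (intro mult_nonneg_nonpos) auto
      qed
      finally show ?thesis .
    qed
    hence "(\<Sum>y\<in>B. \<Sum>e\<in>nbr. J y e * (f (y + e) - f y)) \<le> 0" by (rule sum_nonpos)
    hence lim_le: "f 0 + (\<Sum>y\<in>B. \<Sum>e\<in>nbr. J y e * (f (y + e) - f y)) \<le> 1" by (simp add: f_def)
    have meas: "{X. \<exists>m\<le>n. X m $ i1 < 0} \<in> sets P"
    proof -
      have "{X \<in> space P. \<exists>m\<in>{..n}. X m $ i1 < 0} \<in> sets P" by measurable
      thus ?thesis by (simp add: Bex_def)
    qed
    have "measure P {X. \<exists>m\<le>n. X m $ i1 < 0} / r \<le> (\<integral>X. stopped_sum B f N X \<partial>P)" if N: "N > n" for N
    proof -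
      have "measure P {X. \<exists>m\<le>n. X m $ i1 < 0} / r = (\<integral>X. indicator {X. \<exists>m\<le>n. X m $ i1 < 0} X / r \<partial>P)"
        using meas by simp
      also have "\<dots> \<le> (\<integral>X. stopped_sum B f N X \<partial>P)"
      proof (rule integral_mono_AE[OF _ stopped_sum_integral(1)[OF finB]])
        show "integrable P (\<lambda>X. indicator {X. \<exists>m\<le>n. X m $ i1 < 0} X / r)"
          using meas by (intro integrable_divide integrable_real_indicator) (auto simp: emeasure_eq_measure)
        show "AE X in P. indicator {X. \<exists>m\<le>n. X m $ i1 < 0} X / r \<le> stopped_sum B f N X"
          using AE_nearest_neighbour
        proof eventually_elim
          case (elim X)
          then obtain m where m: "m \<le> N" "stopped_sum B f N X = f (X m)" "\<And>k. k < m \<Longrightarrow> X k \<in> B" "m < N \<Longrightarrow> X m \<notin> B"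
            using stopped_sum_eq[OF finB, of X N f] by metis
          show ?case
          proof (cases "\<exists>m\<le>n. X m $ i1 < 0")
            case True
            then obtain k where k: "k \<le> n" "X k $ i1 < 0" by auto
            have "\<not> k < m" using m(3)[of k] k by (auto simp: B_def)
            hence mk: "m \<le> k" by simp
            hence "X m \<notin> B" using m(4) k N by simp
            moreover have "\<bar>X m $ i\<bar> \<le> int n" for i
              using nn_path_component_le[of X m i] elim mk k by force
            ultimately have neg: "X m $ i1 < 0" by (auto simp: B_def)
            \<comment> \<open>At a dip the level is at most -1, so \<open>f\<close> is at least
              \<open>1 / r\<close>. Its mean at the exit is at most \<open>f 0 = 1\<close>, so a dip
              has probability at most \<open>r\<close>.\<close>
            have "r * f (X m) = r powi (1 + X m $ i1)" using r by (simp add: f_def power_int_add)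
            also have "\<dots> \<ge> 1"
            proof -
              have "r powi 0 \<le> r powi (1 + X m $ i1)"
                using neg r by (intro power_int_decreasing) auto
              thus ?thesis by simp
            qed
            finally have "1 / r \<le> f (X m)" using r by (simp add: field_simps)
            thus ?thesis using True m(2) by (simp add: indicator_def)
          next
            case False
            thus ?thesis using m(2) f0[of "X m"] by (simp add: less_imp_le)
          qed
        qed
      qed
      finally show ?thesis .
    qed
    hence "measure P {X. \<exists>m\<le>n. X m $ i1 < 0} / r \<le> f 0 + (\<Sum>y\<in>B. \<Sum>e\<in>nbr. J y e * (f (y + e) - f y))"
      by (intro LIMSEQ_le_const[OF lim] exI[of _ "Suc n"]) auto
    with lim_le have "measure P {X. \<exists>m\<le>n. X m $ i1 < 0} / r \<le> 1" by simp
    thus ?thesis using r by (simp add: field_simps)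
  qed
  have sets: "{X. \<exists>m\<le>n. X m $ i1 < 0} \<in> sets P" for n
  proof -
    have "{X \<in> space P. \<exists>m\<in>{..n}. X m $ i1 < 0} \<in> sets P" by measurable
    thus ?thesis by (simp add: Bex_def)
  qed
  have "(\<lambda>n. measure P {X. \<exists>m\<le>n. X m $ i1 < 0}) \<longlonglongrightarrow> measure P (\<Union>n. {X. \<exists>m\<le>n. X m $ i1 < 0})"
    using sets by (intro finite_Lim_measure_incseq) (auto simp: incseq_def intro: order.trans)
  hence "measure P (\<Union>n. {X. \<exists>m\<le>n. X m $ i1 < 0}) \<le> r"
    by (rule LIMSEQ_le_const2) (use dip in auto)
  moreover have "(\<Union>n. {X. \<exists>m\<le>n. X m $ i1 < 0}) = space P - nonneg_paths"
    by (simp add: nonneg_paths_def set_eq_iff) (metis not_le order_refl)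
  ultimately have "1 - measure P nonneg_paths \<le> r" by (simp add: prob_compl[OF nonneg_paths_sets, simplified])
  thus ?thesis using r by simp
qed

end

section \<open>Fresh starts\<close>

definition path_shift :: "nat \<Rightarrow> (nat \<Rightarrow> int ^ 'd) \<Rightarrow> nat \<Rightarrow> int ^ 'd" where
  "path_shift n X = (\<lambda>j. X (n + j) - X n)"

lemma cyl_concat:
  fixes vs :: "nat \<Rightarrow> int ^ 'd"
  assumes "vs 0 = 0"
  shows "X \<in> cyl (n + m) (\<lambda>k. if k \<le> n then zs k else zs n + vs (k - n)) \<longleftrightarrow> X \<in> cyl n zs \<and> path_shift n X \<in> cyl m vs"
    (is "?l \<longleftrightarrow> ?r")
proof
  assume l: ?l
  have 1: "X k = zs k" if "k \<le> n" for k using l that by (auto simp: cyl_def)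
  have "X (n + j) = zs n + vs j" if "j \<le> m" for j
  proof (cases "j = 0")
    case False
    thus ?thesis using l that unfolding cyl_def by (auto dest: spec[of _ "n + j"])
  qed (simp add: 1 assms)
  thus ?r using 1 by (auto simp: cyl_def path_shift_def)
next
  assume r: ?r
  have "X k = (if k \<le> n then zs k else zs n + vs (k - n))" if "k \<le> n + m" for k
  proof (cases "k \<le> n")
    case False
    define j where "j = k - n"
    have j: "k = n + j" "j \<le> m" using False that by (auto simp: j_def)
    have "X (n + j) - X n = vs j" using r j by (auto simp: cyl_def path_shift_def)
    moreover have "X n = zs n" using r by (auto simp: cyl_def)
    ultimately have "X k = zs n + vs j" unfolding j(1) by (simp add: algebra_simps)
    thus ?thesis using False by (simp add: j_def)
  qed (use r in \<open>auto simp: cyl_def\<close>)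
  thus ?l by (auto simp: cyl_def)
qed

lemma traj_wt_concat:
  assumes "vs 0 = 0"
  shows "traj_wt \<omega> (\<lambda>k. if k \<le> n then zs k else zs n + vs (k - n)) (n + m)
    = traj_wt \<omega> zs n * traj_wt \<omega> (\<lambda>k. zs n + vs k) m"
proof (induction m)
  case 0
  show ?case by (simp add: traj_wt_def)
next
  case (Suc m)
  let ?w = "\<lambda>k. if k \<le> n then zs k else zs n + vs (k - n)"
  have w: "?w (n + j) = zs n + vs j" for j using assms by (cases "j = 0") auto
  have "traj_wt \<omega> ?w (n + Suc m) = traj_wt \<omega> ?w (n + m) * \<omega> (?w (n + m)) (?w (n + Suc m) - ?w (n + m))"
    by (simp add: traj_wt_def)
  also have "\<dots> = traj_wt \<omega> zs n * traj_wt \<omega> (\<lambda>k. zs n + vs k) m * \<omega> (zs n + vs m) (zs n + vs (Suc m) - (zs n + vs m))"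
    unfolding w Suc ..
  also have "\<dots> = traj_wt \<omega> zs n * traj_wt \<omega> (\<lambda>k. zs n + vs k) (Suc m)"
    by (simp add: traj_wt_def)
  finally show ?case .
qed

lemma measurable_path_shift [measurable]: "path_shift n \<in> measurable path_space path_space"
proof -
  have "(\<lambda>X. path_shift n X) \<in> measurable path_space (\<Pi>\<^sub>M n\<in>UNIV. count_space UNIV)"
  proof (rule measurable_PiM_single')
    fix j :: nat
    have eq: "(\<lambda>X :: nat \<Rightarrow> int ^ 'd. path_shift n X j) = (\<lambda>X. (\<lambda>w. w ! (n + j) - w ! n) (prefix_of X (n + j)))"
      by (auto simp: path_shift_def)
    show "(\<lambda>X :: nat \<Rightarrow> int ^ 'd. path_shift n X j) \<in> measurable path_space (count_space UNIV)"
      unfolding eq by (rule measurable_compose[OF measurable_prefix_of]) simp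
  qed simp
  thus ?thesis by (simp add: path_space_def)
qed

context annealed
begin

lemma measurable_from_prefix: "(\<lambda>X. f (prefix_of X n)) \<in> measurable P (count_space UNIV)"
  using measurable_compose[OF measurable_prefix_of, of f "count_space UNIV" n]
  by (simp add: measurable_cong_sets[OF P_sets refl])

lemma pred_prefix: "Measurable.pred P (\<lambda>X. Q (prefix_of X n))"
  by (rule measurable_from_prefix)

text \<open>The word \<open>zs\<close> only uses the environment at levels below its last one, the word \<open>vs\<close>
  started there only the environment at or above that level.\<close>
lemma measure_cyl_concat:
  assumes zs: "\<And>k. k < n \<Longrightarrow> zs k $ i1 < zs n $ i1" and vs: "\<And>j. j < m \<Longrightarrow> 0 \<le> vs j $ i1"
  shows "measure P {X \<in> cyl n zs. path_shift n X \<in> cyl m vs} = measure P (cyl n zs) * measure P (cyl m vs)"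
proof (cases "vs 0 = 0 \<and> zs 0 = 0")
  case True
  let ?w = "\<lambda>k. if k \<le> n then zs k else zs n + vs (k - n)"
  have "{X \<in> cyl n zs. path_shift n X \<in> cyl m vs} = cyl (n + m) ?w" using cyl_concat[of vs _ n m zs] True by blast
  hence "measure P {X \<in> cyl n zs. path_shift n X \<in> cyl m vs} = ann_wt ?w (n + m)"
    using True by (simp add: P_cyl)
  also have "\<dots> = (\<integral>\<omega>. traj_wt \<omega> zs n * traj_wt \<omega> (\<lambda>k. zs n + vs k) m \<partial>env)"
    unfolding ann_wt_def by (subst traj_wt_concat) (use True in auto)
  also have "\<dots> = ann_wt zs n * ann_wt (\<lambda>k. zs n + vs k) m"
  proof (rule ann_wt_indep)
    fix j k assume "j < n" "k < m"
    hence "zs j $ i1 < (zs n + vs k) $ i1" using zs[of j] vs[of k] by simp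
    thus "zs j \<noteq> zs n + vs k" by auto
  qed
  also have "\<dots> = measure P (cyl n zs) * measure P (cyl m vs)"
    using True by (simp add: P_cyl ann_wt_translate)
  finally show ?thesis .
next
  case False
  hence *: "measure P (cyl n zs) * measure P (cyl m vs) = 0" by (auto simp: P_cyl)
  show ?thesis
  proof (cases "zs 0 = 0")
    case True
    hence "{X \<in> cyl n zs. path_shift n X \<in> cyl m vs} = {}" using False by (auto simp: cyl_def path_shift_def)
    thus ?thesis unfolding * by (simp only: measure_empty)
  next
    case f: False
    have "measure P {X \<in> cyl n zs. path_shift n X \<in> cyl m vs} \<le> measure P (cyl n zs)"
      by (intro finite_measure_mono) auto
    also have "\<dots> = 0" using f by (simp add: P_cyl)
    finally show ?thesis using * by (simp add: measure_le_0_iff)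
  qed
qed

text \<open>The condition on \<open>S\<close> stops before the last letter because no environment is
  read there. \<open>S'\<close> discards words of the wrong length, after which distinct words have
  disjoint cylinders.\<close>

lemma measure_fresh_prefix:
  assumes zs: "\<And>k. k < n \<Longrightarrow> zs k $ i1 < zs n $ i1"
    and S: "\<And>w j. w \<in> S \<Longrightarrow> j < t \<Longrightarrow> 0 \<le> w ! j $ i1"
  shows "emeasure P {X \<in> cyl n zs. prefix_of (path_shift n X) t \<in> S}
     = emeasure P (cyl n zs) * emeasure P {X. prefix_of X t \<in> S}"
proof -
  define S' where "S' = {w \<in> S. length w = Suc t}"
  have e1: "{X \<in> cyl n zs. prefix_of (path_shift n X) t \<in> S} = (\<Union>w\<in>S'. {X \<in> cyl n zs. path_shift n X \<in> cyl t (nth w)})"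
  proof (intro equalityI subsetI)
    fix X assume "X \<in> {X \<in> cyl n zs. prefix_of (path_shift n X) t \<in> S}"
    thus "X \<in> (\<Union>w\<in>S'. {X \<in> cyl n zs. path_shift n X \<in> cyl t (nth w)})"
      by (intro UN_I[of "prefix_of (path_shift n X) t"]) (auto simp: S'_def)
  next
    fix X assume "X \<in> (\<Union>w\<in>S'. {X \<in> cyl n zs. path_shift n X \<in> cyl t (nth w)})"
    then obtain w where "w \<in> S'" "X \<in> cyl n zs" "path_shift n X \<in> cyl t (nth w)" by auto
    thus "X \<in> {X \<in> cyl n zs. prefix_of (path_shift n X) t \<in> S}"
      using prefix_of_eq_iff[of "path_shift n X" t w] by (auto simp: S'_def)
  qed
  have e2: "{X. prefix_of X t \<in> S} = (\<Union>w\<in>S'. cyl t (nth w))"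
  proof (intro equalityI subsetI)
    fix X assume "X \<in> {X. prefix_of X t \<in> S}"
    thus "X \<in> (\<Union>w\<in>S'. cyl t (nth w))"
      by (intro UN_I[of "prefix_of X t"]) (auto simp: S'_def)
  next
    fix X assume "X \<in> (\<Union>w\<in>S'. cyl t (nth w))"
    then obtain w where "w \<in> S'" "X \<in> cyl t (nth w)" by auto
    thus "X \<in> {X. prefix_of X t \<in> S}"
      using prefix_of_eq_iff[of X t w] by (auto simp: S'_def)
  qed
  have dis: "w = w'" if "w \<in> S'" "w' \<in> S'" "X \<in> cyl t (nth w)" "X \<in> cyl t (nth w')" for w w' and X :: "nat \<Rightarrow> int ^ 'd"
    using that prefix_of_eq_iff[of X t w] prefix_of_eq_iff[of X t w'] by (auto simp: S'_def)
  have sets1: "{X \<in> cyl n zs. path_shift n X \<in> cyl t vs} \<in> sets P" for vs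
  proof -
    have "{X \<in> space P. X \<in> cyl n zs \<and> path_shift n X \<in> cyl t vs} \<in> sets P" by measurable
    thus ?thesis by simp
  qed
  have "emeasure P {X \<in> cyl n zs. prefix_of (path_shift n X) t \<in> S}
      = (\<integral>\<^sup>+w. emeasure P {X \<in> cyl n zs. path_shift n X \<in> cyl t (nth w)} \<partial>count_space S')"
    unfolding e1
  proof (rule emeasure_UN_countable)
    show "disjoint_family_on (\<lambda>w. {X \<in> cyl n zs. path_shift n X \<in> cyl t (nth w)}) S'"
      unfolding disjoint_family_on_def using dis by blast
  qed (use sets1 in auto)
  also have "\<dots> = (\<integral>\<^sup>+w. emeasure P (cyl n zs) * emeasure P (cyl t (nth w)) \<partial>count_space S')"
  proof (intro nn_integral_cong)
    fix w assume w: "w \<in> space (count_space S')"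
    have "measure P {X \<in> cyl n zs. path_shift n X \<in> cyl t (nth w)} = measure P (cyl n zs) * measure P (cyl t (nth w))"
      by (rule measure_cyl_concat) (use zs S w in \<open>auto simp: S'_def\<close>)
    thus "emeasure P {X \<in> cyl n zs. path_shift n X \<in> cyl t (nth w)} = emeasure P (cyl n zs) * emeasure P (cyl t (nth w))"
      by (simp add: emeasure_eq_measure ennreal_mult)
  qed
  also have "\<dots> = emeasure P (cyl n zs) * (\<integral>\<^sup>+w. emeasure P (cyl t (nth w)) \<partial>count_space S')"
    by (rule nn_integral_cmult) simp
  also have "(\<integral>\<^sup>+w. emeasure P (cyl t (nth w)) \<partial>count_space S') = emeasure P {X. prefix_of X t \<in> S}"
    unfolding e2
  proof (rule emeasure_UN_countable[symmetric])
    show "disjoint_family_on (\<lambda>w. cyl t (nth w)) S'"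
      unfolding disjoint_family_on_def using dis by blast
  qed auto
  finally show ?thesis .
qed

text \<open>Never going negative is not decided by a finite prefix, but it is the decreasing limit
  of staying nonnegative up to time \<open>m + t\<close>. The product formula survives the limit by
  continuity from above.\<close>

lemma emeasure_fresh_cyl:
  assumes zs: "\<And>k. k < n \<Longrightarrow> zs k $ i1 < zs n $ i1"
  shows "emeasure P {X \<in> cyl n zs. path_shift n X \<in> cyl m vs \<inter> nonneg_paths}
     = emeasure P (cyl n zs) * emeasure P (cyl m vs \<inter> nonneg_paths)"
proof -
  define S where "S t = {w :: (int ^ 'd) list. (\<forall>j\<le>m. w ! j = vs j) \<and> (\<forall>j\<le>m+t. 0 \<le> w ! j $ i1)}" for t
  define E where "E t = {X. prefix_of X (m + t) \<in> S t}" for t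
  have E: "E t = {X \<in> cyl m vs. \<forall>j\<le>m+t. 0 \<le> X j $ i1}" for t by (auto simp: E_def S_def cyl_def)
  have Es: "E t \<in> sets P" for t
  proof -
    have "{X \<in> space P. prefix_of X (m + t) \<in> S t} \<in> sets P" using pred_prefix by (rule predE)
    thus ?thesis by (simp add: E_def)
  qed
  have dec: "decseq E" by (auto simp: decseq_def E)
  have IE: "(\<Inter>t. E t) = cyl m vs \<inter> nonneg_paths"
  proof -
    have "(\<forall>t. \<forall>j\<le>m+t. Q j) \<longleftrightarrow> (\<forall>j. Q j)" for Q :: "nat \<Rightarrow> bool" by (meson le_add2)
    thus ?thesis by (auto simp: E nonneg_paths_def)
  qed
  define F where "F t = {X \<in> cyl n zs. path_shift n X \<in> E t}" for t
  have Fs: "F t \<in> sets P" for t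
  proof -
    note Es[measurable]
    have "{X \<in> space P. X \<in> cyl n zs \<and> path_shift n X \<in> E t} \<in> sets P" by measurable
    thus ?thesis by (simp add: F_def)
  qed
  have decF: "decseq F" using dec by (auto simp: F_def decseq_def)
  have IF: "(\<Inter>t. F t) = {X \<in> cyl n zs. path_shift n X \<in> cyl m vs \<inter> nonneg_paths}"
    unfolding IE[symmetric] by (auto simp: F_def)
  have eq: "emeasure P (F t) = emeasure P (cyl n zs) * emeasure P (E t)" for t
    unfolding F_def E_def mem_Collect_eq by (rule measure_fresh_prefix) (auto simp: S_def zs)
  have "(\<lambda>t. emeasure P (F t)) \<longlonglongrightarrow> emeasure P (\<Inter>t. F t)"
    by (rule Lim_emeasure_decseq) (use Fs decF in auto)
  moreover have "(\<lambda>t. emeasure P (F t)) \<longlonglongrightarrow> emeasure P (cyl n zs) * emeasure P (\<Inter>t. E t)"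
    unfolding eq
    by (rule ennreal_tendsto_cmult[OF _ Lim_emeasure_decseq]) (use Es dec in \<open>auto simp: emeasure_eq_measure\<close>)
  ultimately have "emeasure P (\<Inter>t. F t) = emeasure P (cyl n zs) * emeasure P (\<Inter>t. E t)"
    by (rule LIMSEQ_unique)
  thus ?thesis unfolding IE IF .
qed

text \<open>In their dependence on \<open>G\<close> both sides are finite measures on path space,
  and the cylinders determine such a measure.\<close>

lemma emeasure_fresh:
  assumes zs: "\<And>k. k < n \<Longrightarrow> zs k $ i1 < zs n $ i1" and G [measurable]: "G \<in> sets P"
  shows "emeasure P {X \<in> cyl n zs. path_shift n X \<in> G \<inter> nonneg_paths}
     = emeasure P (cyl n zs) * emeasure P (G \<inter> nonneg_paths)"
proof -
  define Z where "Z = {X \<in> cyl n zs. path_shift n X \<in> nonneg_paths}"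
  have Z [measurable]: "Z \<in> sets P"
  proof -
    have "{X \<in> space P. X \<in> cyl n zs \<and> path_shift n X \<in> nonneg_paths} \<in> sets P" by measurable
    thus ?thesis by (simp add: Z_def)
  qed
  define M1 where "M1 = distr (density P (indicator Z)) P (path_shift n)"
  define M2 where "M2 = density P (\<lambda>X. emeasure P (cyl n zs) * indicator nonneg_paths X)"
  have e1: "emeasure M1 A = emeasure P {X \<in> cyl n zs. path_shift n X \<in> A \<inter> nonneg_paths}" if [measurable]: "A \<in> sets P" for A
  proof -
    have [measurable]: "path_shift n -` A \<in> sets P" using measurable_sets[OF measurable_path_shift, of A n] that by (simp add: P_sets)
    have "emeasure M1 A = emeasure (density P (indicator Z)) (path_shift n -` A \<inter> space P)"
      unfolding M1_def by (subst emeasure_distr) auto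
    also have "\<dots> = (\<integral>\<^sup>+X. indicator Z X * indicator (path_shift n -` A) X \<partial>P)"
      by (subst emeasure_density) auto
    also have "\<dots> = emeasure P (Z \<inter> path_shift n -` A)"
      by (simp add: indicator_inter_arith[symmetric])
    finally show ?thesis by (auto simp: Z_def intro!: arg_cong[where f = "emeasure P"])
  qed
  have e2: "emeasure M2 A = emeasure P (cyl n zs) * emeasure P (A \<inter> nonneg_paths)" if [measurable]: "A \<in> sets P" for A
  proof -
    have "emeasure M2 A = (\<integral>\<^sup>+X. emeasure P (cyl n zs) * indicator (A \<inter> nonneg_paths) X \<partial>P)"
      unfolding M2_def by (subst emeasure_density) (auto simp: indicator_inter_arith ac_simps intro!: nn_integral_cong)
    thus ?thesis by (simp add: nn_integral_cmult)
  qed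
  have "M1 = M2"
  proof (rule measure_eqI_generator_eq_countable[where E = cyls and \<Omega> = UNIV and A = "range (\<lambda>x. cyl 0 (\<lambda>_. x))"])
    show "emeasure M1 A = emeasure M2 A" if "A \<in> cyls" for A
    proof -
      have "A = {} \<or> (\<exists>m vs. A = cyl m vs)" using that by (auto simp: cyls_def)
      thus ?thesis
      proof
        assume "\<exists>m vs. A = cyl m vs"
        then obtain m vs where A: "A = cyl m vs" by blast
        show ?thesis using emeasure_fresh_cyl[of n zs m vs, OF zs] e1[of A] e2[of A] by (simp add: A)
      qed simp
    qed
    show "sets M1 = sigma_sets UNIV cyls" by (simp add: M1_def P_sets sets_path_space_eq)
    show "sets M2 = sigma_sets UNIV cyls" by (simp add: M2_def P_sets sets_path_space_eq)
    show "range (\<lambda>x. cyl 0 (\<lambda>_. x)) \<subseteq> cyls" by (auto simp: cyls_def)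
    show "\<Union> (range (\<lambda>x :: int ^ 'd. cyl 0 (\<lambda>_. x))) = UNIV" by (auto simp: cyl_def)
    show "emeasure M1 a \<noteq> \<infinity>" if "a \<in> range (\<lambda>x. cyl 0 (\<lambda>_. x))" for a
      using that by (auto simp: e1)
  qed (auto simp: Int_stable_cyls)
  thus ?thesis using e1[OF G] e2[OF G] by simp
qed

end

section \<open>Hitting times of levels and the recentred future\<close>

context annealed
begin

definition hit_time :: "nat \<Rightarrow> (nat \<Rightarrow> int ^ 'd) \<Rightarrow> nat" where
  "hit_time k X = (LEAST n. int k \<le> X n $ i1)"

text \<open>The almost sure properties under which all pathwise arguments run. The last clause
  matters for \<open>hit_time\<close>, since \<open>LEAST\<close> is unspecified for a level that is
  never reached.\<close>

definition climbing :: "(nat \<Rightarrow> int ^ 'd) \<Rightarrow> bool" where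
  "climbing X \<longleftrightarrow> X 0 = 0 \<and> (\<forall>k. X (Suc k) - X k \<in> nbr) \<and> (\<forall>k. \<exists>n. int k \<le> X n $ i1)"

definition after :: "nat \<Rightarrow> (nat \<Rightarrow> int ^ 'd) \<Rightarrow> nat \<Rightarrow> int ^ 'd" where
  "after k X = path_shift (hit_time k X) X"

lemma hit_timeI:
  assumes "int k \<le> X n $ i1" "\<And>m. m < n \<Longrightarrow> X m $ i1 < int k"
  shows "hit_time k X = n"
  unfolding hit_time_def using assms by (intro Least_equality) (auto simp: not_less[symmetric] intro: leI)

lemma less_hit_time: "n < hit_time k X \<Longrightarrow> X n $ i1 < int k"
  unfolding hit_time_def by (drule not_less_Least) simp

lemma le_hit_time: "int k \<le> X n $ i1 \<Longrightarrow> hit_time k X \<le> n"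
  unfolding hit_time_def by (rule Least_le)

lemma level_hit_time:
  assumes "climbing X"
  shows "X (hit_time k X) $ i1 = int k"
proof (rule antisym)
  have "\<exists>n. int k \<le> X n $ i1" using assms by (simp add: climbing_def)
  thus "int k \<le> X (hit_time k X) $ i1" unfolding hit_time_def by (rule LeastI_ex)
  show "X (hit_time k X) $ i1 \<le> int k"
  proof (cases "hit_time k X")
    case 0
    thus ?thesis using assms by (simp add: climbing_def)
  next
    case (Suc n)
    have "X n $ i1 < int k" using Suc by (intro less_hit_time) simp
    moreover have "X (Suc n) $ i1 = X n $ i1 + (X (Suc n) - X n) $ i1" by simp
    moreover have "(X (Suc n) - X n) $ i1 \<le> 1"
      using assms nbr_component_le[of "X (Suc n) - X n" i1] by (auto simp: climbing_def)
    ultimately have "X (Suc n) $ i1 \<le> int k" by linarith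
    thus ?thesis using Suc by simp
  qed
qed

lemma hit_time_mono: assumes "climbing X" "j \<le> k" shows "hit_time j X \<le> hit_time k X"
  using level_hit_time[OF assms(1), of k] assms(2) by (intro le_hit_time) simp

lemma hit_time_strict_mono: assumes "climbing X" "j < k" shows "hit_time j X < hit_time k X"
proof -
  have "hit_time j X \<noteq> hit_time k X"
    using level_hit_time[OF assms(1), of k] level_hit_time[OF assms(1), of j] assms(2) by auto
  thus ?thesis using hit_time_mono[OF assms(1), of j k] assms(2) by simp
qed

lemma hit_time_ge: assumes "climbing X" shows "k \<le> hit_time k X"
proof (induction k)
  case (Suc k)
  thus ?case using hit_time_strict_mono[OF assms, of k "Suc k"] by simp
qed simp

text \<open>Because level \<open>k\<close> is hit exactly and not overshot, recentring there shifts
  levels by \<open>k\<close>. Statements about the future of a level thus become statements about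
  differences of hitting times.\<close>

lemma hit_time_after:
  assumes "climbing X"
  shows "hit_time (k + j) X = hit_time k X + hit_time j (after k X)"
proof -
  let ?T = "hit_time k X" and ?S = "hit_time (k + j) X"
  have le: "?T \<le> ?S" by (rule hit_time_mono[OF assms]) simp
  have "hit_time j (after k X) = ?S - ?T"
  proof (rule hit_timeI)
    show "int j \<le> after k X (?S - ?T) $ i1"
      using le level_hit_time[OF assms, of k] level_hit_time[OF assms, of "k + j"]
      by (simp add: after_def path_shift_def)
    fix m assume "m < ?S - ?T"
    hence "X (?T + m) $ i1 < int (k + j)" by (intro less_hit_time) simp
    thus "after k X m $ i1 < int j"
      using level_hit_time[OF assms, of k] by (simp add: after_def path_shift_def)
  qed
  thus ?thesis using le by simp
qed

lemma after_after:
  assumes "climbing X"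
  shows "after j (after k X) = after (k + j) X"
proof
  fix i
  show "after j (after k X) i = after (k + j) X i"
    unfolding after_def[of "k + j"] hit_time_after[OF assms]
    by (simp add: after_def[of j] after_def[of k] path_shift_def add.assoc)
qed

lemma measurable_hit_time [measurable]: "hit_time k \<in> measurable P (count_space UNIV)"
  unfolding hit_time_def by measurable

lemma measurable_after [measurable]: "after k \<in> measurable P path_space"
proof -
  have *: "path_shift n \<in> measurable P path_space" for n by measurable
  show ?thesis unfolding after_def
    by (rule measurable_compose_countable[OF * measurable_hit_time])
qed

lemma after_vimage_sets: "G \<in> sets P \<Longrightarrow> {X. after k X \<in> G} \<in> sets P"
  using measurable_sets[OF measurable_after, of G k] by (simp add: P_sets vimage_def)

text \<open>If level \<open>L\<close> were missed with positive probability, the sums in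
  \<open>hitting_time_mean\<close> would grow linearly in \<open>N\<close> instead of staying
  bounded.\<close>

lemma AE_climbing: "AE X in P. climbing X"
proof -
  have sets: "{X. \<forall>k\<le>n. X k $ i1 < int L} \<in> sets P" for n L
  proof -
    have "{X \<in> space P. \<forall>k\<in>{..n}. X k $ i1 < int L} \<in> sets P" by measurable
    thus ?thesis by (simp add: Ball_def)
  qed
  have "AE X in P. \<exists>n. int L \<le> X n $ i1" for L
  proof -
    let ?N = "{X. \<forall>k. X k $ i1 < int L}"
    have N: "?N \<in> sets P"
    proof -
      have "{X \<in> space P. \<forall>k. X k $ i1 < int L} \<in> sets P" by measurable
      thus ?thesis by simp
    qed
    have le: "real N * measure P ?N \<le> real L / cK" for N
    proof -
      have "real N * measure P ?N = (\<Sum>n<N. measure P ?N)" by simp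
      also have "\<dots> \<le> (\<Sum>n<N. measure P {X. \<forall>k\<le>n. X k $ i1 < int L})"
        by (intro sum_mono finite_measure_mono sets) auto
      also have "\<dots> \<le> real L / cK" by (rule hitting_time_mean)
      finally show ?thesis .
    qed
    have "measure P ?N = 0"
    proof (rule ccontr)
      assume "measure P ?N \<noteq> 0"
      hence pos: "measure P ?N > 0" by (simp add: zero_less_measure_iff)
      obtain N :: nat where "real L / cK < real N * measure P ?N"
        using reals_Archimedean3[OF pos] by blast
      thus False using le[of N] by simp
    qed
    hence "?N \<in> null_sets P" using N by (simp add: null_sets_def emeasure_eq_measure)
    hence "AE X in P. X \<notin> ?N" by (rule AE_not_in)
    thus ?thesis by eventually_elim (auto simp: not_less)
  qed
  hence "AE X in P. \<forall>L. \<exists>n. int L \<le> X n $ i1" by (simp add: AE_all_countable)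
  with AE_nearest_neighbour show ?thesis by eventually_elim (auto simp: climbing_def)
qed

lemma hit_time_mean: "(\<integral>\<^sup>+X. of_nat (hit_time L X) \<partial>P) \<le> ennreal (real L / cK)"
proof -
  have sets: "{X. \<forall>k\<le>n. X k $ i1 < int L} \<in> sets P" for n L
  proof -
    have "{X \<in> space P. \<forall>k\<in>{..n}. X k $ i1 < int L} \<in> sets P" by measurable
    thus ?thesis by (simp add: Ball_def)
  qed
  have "(\<integral>\<^sup>+X. of_nat (hit_time L X) \<partial>P) = (\<Sum>t. emeasure P {X \<in> space P. t < hit_time L X})"
    by (rule nn_integral_nat_function) measurable
  also have "\<dots> = (\<Sum>t. ennreal (measure P {X \<in> space P. t < hit_time L X}))"
    by (simp add: emeasure_eq_measure)
  also have "\<dots> \<le> (\<Sum>t. ennreal (measure P {X. \<forall>k\<le>t. X k $ i1 < int L}))"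
    by (intro suminf_le ennreal_leI finite_measure_mono sets) (auto intro!: less_hit_time)
  also have "\<dots> \<le> ennreal (real L / cK)"
    unfolding suminf_eq_SUP
  proof (rule SUP_least)
    fix N
    show "(\<Sum>t<N. ennreal (measure P {X. \<forall>k\<le>t. X k $ i1 < int L})) \<le> ennreal (real L / cK)"
      by (subst sum_ennreal) (auto intro!: ennreal_leI hitting_time_mean)
  qed
  finally show ?thesis .
qed

text \<open>The environment at or above level \<open>k\<close> is fresh at the hitting time of level \<open>k\<close>, and
  a walk that never goes back below \<open>k\<close> sees nothing else.\<close>
lemma fresh_start:
  assumes G: "G \<in> sets P"
  shows "measure P {X. Q (prefix_of X (hit_time k X)) \<and> after k X \<in> G \<inter> nonneg_paths}
     = measure P {X. Q (prefix_of X (hit_time k X))} * measure P (G \<inter> nonneg_paths)"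
proof -
  \<comment> \<open>\<open>W\<close> collects the words stopped on first reaching level
    \<open>k\<close>. Their cylinders are disjoint and almost surely exhaust the event of
    \<open>Q\<close>. On each of them the hitting time is deterministic, so the formula for a fixed
    time applies.\<close>
  define W where "W = {w :: (int ^ 'd) list. w \<noteq> [] \<and> Q w \<and> (\<forall>j<length w - 1. w ! j $ i1 < int k)
      \<and> int k \<le> w ! (length w - 1) $ i1}"
  define C where "C w = cyl (length w - 1) (nth w)" for w :: "(int ^ 'd) list"
  have ht: "hit_time k X = length w - 1" "prefix_of X (hit_time k X) = w" if "w \<in> W" "X \<in> C w" for w X
  proof -
    have X: "X j = w ! j" if "j \<le> length w - 1" for j using \<open>X \<in> C w\<close> that by (auto simp: C_def cyl_def)
    show 1: "hit_time k X = length w - 1"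
      using that(1) X by (intro hit_timeI) (auto simp: W_def)
    show "prefix_of X (hit_time k X) = w" unfolding 1 prefix_of_eq_iff
      using that by (auto simp: W_def C_def)
  qed
  have hits: "prefix_of X (hit_time k X) \<in> W \<and> X \<in> C (prefix_of X (hit_time k X))"
    if "climbing X" "Q (prefix_of X (hit_time k X))" for X
    using that level_hit_time[OF that(1), of k] less_hit_time[of _ k X]
    by (auto simp: W_def C_def) (auto simp: prefix_of_def)
  have dis: "w = w'" if "w \<in> W" "w' \<in> W" "X \<in> C w" "X \<in> C w'" for w w' X
    using ht(2)[of w X] ht(2)[of w' X] that by simp
  have sC: "C w \<in> sets P" for w by (simp add: C_def)
  have sD: "{X \<in> C w. path_shift (length w - 1) X \<in> G \<inter> nonneg_paths} \<in> sets P" for w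
  proof -
    note G[measurable] sC[measurable]
    have "{X \<in> space P. X \<in> C w \<and> path_shift (length w - 1) X \<in> G \<inter> nonneg_paths} \<in> sets P" by measurable
    thus ?thesis by simp
  qed
  have pm: "(\<lambda>X. prefix_of X (hit_time k X)) \<in> measurable P (count_space UNIV)"
  proof (rule measurable_compose_countable[OF _ measurable_hit_time])
    show "(\<lambda>X. prefix_of X n) \<in> measurable P (count_space UNIV)" for n by measurable
  qed
  have sQ: "{X. Q (prefix_of X (hit_time k X))} \<in> sets P"
  proof -
    have "{X \<in> space P. Q (prefix_of X (hit_time k X))} \<in> sets P"
      using measurable_compose[OF pm, of Q "count_space UNIV"] by (intro predE) auto
    thus ?thesis by simp
  qed
  have sQ': "{X. Q (prefix_of X (hit_time k X)) \<and> after k X \<in> G \<inter> nonneg_paths} \<in> sets P"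
    using sets.Int[OF sQ after_vimage_sets[OF sets.Int[OF G nonneg_paths_sets]]] by (simp add: Int_def)
  have "emeasure P {X. Q (prefix_of X (hit_time k X)) \<and> after k X \<in> G \<inter> nonneg_paths}
     = emeasure P (\<Union>w\<in>W. {X \<in> C w. path_shift (length w - 1) X \<in> G \<inter> nonneg_paths})"
  proof (rule emeasure_eq_AE)
    show "AE X in P. (X \<in> {X. Q (prefix_of X (hit_time k X)) \<and> after k X \<in> G \<inter> nonneg_paths}) =
      (X \<in> (\<Union>w\<in>W. {X \<in> C w. path_shift (length w - 1) X \<in> G \<inter> nonneg_paths}))"
      using AE_climbing
    proof eventually_elim
      case (elim X)
      show ?case
      proof
        assume "X \<in> {X. Q (prefix_of X (hit_time k X)) \<and> after k X \<in> G \<inter> nonneg_paths}"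
        thus "X \<in> (\<Union>w\<in>W. {X \<in> C w. path_shift (length w - 1) X \<in> G \<inter> nonneg_paths})"
          using hits[OF elim] by (intro UN_I[of "prefix_of X (hit_time k X)"]) (auto simp: after_def)
      next
        assume "X \<in> (\<Union>w\<in>W. {X \<in> C w. path_shift (length w - 1) X \<in> G \<inter> nonneg_paths})"
        then obtain w where w: "w \<in> W" "X \<in> C w" "path_shift (length w - 1) X \<in> G \<inter> nonneg_paths" by auto
        thus "X \<in> {X. Q (prefix_of X (hit_time k X)) \<and> after k X \<in> G \<inter> nonneg_paths}"
          using ht[OF w(1,2)] by (auto simp: after_def W_def)
      qed
    qed
  qed (use sQ' sD in auto)
  also have "\<dots> = (\<integral>\<^sup>+w. emeasure P {X \<in> C w. path_shift (length w - 1) X \<in> G \<inter> nonneg_paths} \<partial>count_space W)"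
  proof (rule emeasure_UN_countable)
    show "disjoint_family_on (\<lambda>w. {X \<in> C w. path_shift (length w - 1) X \<in> G \<inter> nonneg_paths}) W"
      unfolding disjoint_family_on_def using dis by blast
  qed (use sD in auto)
  also have "\<dots> = (\<integral>\<^sup>+w. emeasure P (C w) * emeasure P (G \<inter> nonneg_paths) \<partial>count_space W)"
  proof (intro nn_integral_cong)
    fix w assume w: "w \<in> space (count_space W)"
    show "emeasure P {X \<in> C w. path_shift (length w - 1) X \<in> G \<inter> nonneg_paths} = emeasure P (C w) * emeasure P (G \<inter> nonneg_paths)"
      unfolding C_def by (rule emeasure_fresh[OF _ G]) (use w in \<open>auto simp: W_def intro: order.strict_trans2\<close>)
  qed
  also have "\<dots> = (\<integral>\<^sup>+w. emeasure P (C w) \<partial>count_space W) * emeasure P (G \<inter> nonneg_paths)"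
    by (rule nn_integral_multc) simp
  also have "(\<integral>\<^sup>+w. emeasure P (C w) \<partial>count_space W) = emeasure P (\<Union>w\<in>W. C w)"
  proof (rule emeasure_UN_countable[symmetric])
    show "disjoint_family_on C W"
      unfolding disjoint_family_on_def using dis by blast
  qed (use sC in auto)
  also have "emeasure P (\<Union>w\<in>W. C w) = emeasure P {X. Q (prefix_of X (hit_time k X))}"
  proof (rule emeasure_eq_AE)
    show "AE X in P. (X \<in> (\<Union>w\<in>W. C w)) = (X \<in> {X. Q (prefix_of X (hit_time k X))})"
      using AE_climbing
    proof eventually_elim
      case (elim X)
      show ?case
      proof
        assume "X \<in> (\<Union>w\<in>W. C w)"
        then obtain w where w: "w \<in> W" "X \<in> C w" by auto
        thus "X \<in> {X. Q (prefix_of X (hit_time k X))}" using ht(2)[OF w] by (simp add: W_def)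
      next
        assume "X \<in> {X. Q (prefix_of X (hit_time k X))}"
        thus "X \<in> (\<Union>w\<in>W. C w)" using hits[OF elim] by blast
      qed
    qed
  qed (use sQ sC in auto)
  finally have "ennreal (measure P {X. Q (prefix_of X (hit_time k X)) \<and> after k X \<in> G \<inter> nonneg_paths})
     = ennreal (measure P {X. Q (prefix_of X (hit_time k X))} * measure P (G \<inter> nonneg_paths))"
    by (simp only: emeasure_eq_measure ennreal_mult measure_nonneg)
  thus ?thesis by (simp only: ennreal_inj measure_nonneg mult_nonneg_nonneg)
qed

end

section \<open>Regeneration levels and speed\<close>

text \<open>The combinatorial core of the maximal inequality: disjoint intervals on which \<open>T\<close> grows
  faster than \<open>a\<close> are chosen greedily.\<close>
lemma card_fast_growth:
  fixes T :: "nat \<Rightarrow> nat"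
  assumes mono: "\<And>i j. i \<le> j \<Longrightarrow> T i \<le> T j"
  shows "a * card {k \<in> {..<M}. \<exists>n\<in>{1..N}. T k + a * n < T (k + n)} \<le> T (M + N)"
proof -
  \<comment> \<open>The claim is proved for the indices from \<open>k\<close> on, with
    \<open>T k\<close> added as credit, so that a whole interval can be skipped at once.\<close>
  define Z where "Z k = {i \<in> {k..<M}. \<exists>n\<in>{1..N}. T i + a * n < T (i + n)}" for k
  have finZ: "finite (Z k)" for k by (simp add: Z_def)
  have "a * card (Z k) + T k \<le> T (M + N)" if "k \<le> M + N" for k
    using that
  proof (induction "M + N - k" arbitrary: k rule: less_induct)
    case less
    show ?case
    proof (cases "k < M")
      case False
      thus ?thesis using less.prems mono[of k "M + N"] by (simp add: Z_def)
    next
      case True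
      show ?thesis
      proof (cases "k \<in> Z k")
        case True': True
        then obtain n where n: "1 \<le> n" "n \<le> N" "T k + a * n < T (k + n)" by (auto simp: Z_def)
        \<comment> \<open>The \<open>n\<close> skipped indices cost at most \<open>a * n\<close>,
          which the growth of \<open>T\<close> from \<open>k\<close> to \<open>k + n\<close> pays
          for.\<close>
        have "Z k \<subseteq> {k..<k+n} \<union> Z (k + n)" by (auto simp: Z_def)
        hence "card (Z k) \<le> card ({k..<k+n} \<union> Z (k + n))" using finZ by (intro card_mono) auto
        also have "\<dots> \<le> n + card (Z (k + n))" using card_Un_le[of "{k..<k+n}" "Z (k + n)"] by simp
        finally have "a * card (Z k) \<le> a * n + a * card (Z (k + n))"
          by (metis add_mult_distrib2 mult_le_mono2)
        moreover have "a * card (Z (k + n)) + T (k + n) \<le> T (M + N)"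
          using n True less.prems by (intro less.hyps) auto
        ultimately show ?thesis using n by linarith
      next
        case False
        hence "Z k = Z (Suc k)" using True by (auto simp: Z_def Suc_le_eq le_less)
        moreover have "a * card (Z (Suc k)) + T (Suc k) \<le> T (M + N)"
          using True less.prems by (intro less.hyps) auto
        ultimately show ?thesis using mono[of k "Suc k"] by simp
      qed
    qed
  qed
  from this[of 0] show ?thesis by (simp add: Z_def lessThan_atLeast0)
qed

lemma sum_emeasure_eq_card:
  assumes "finite K" "\<And>k. k \<in> K \<Longrightarrow> E k \<in> sets M"
  shows "(\<Sum>k\<in>K. emeasure M (E k)) = (\<integral>\<^sup>+x. of_nat (card {k \<in> K. x \<in> E k}) \<partial>M)"
proof -
  have "(\<Sum>k\<in>K. emeasure M (E k)) = (\<Sum>k\<in>K. \<integral>\<^sup>+x. indicator (E k) x \<partial>M)"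
    using assms by simp
  also have "\<dots> = (\<integral>\<^sup>+x. (\<Sum>k\<in>K. indicator (E k) x) \<partial>M)"
    using assms by (intro nn_integral_sum[symmetric]) auto
  also have "\<dots> = (\<integral>\<^sup>+x. of_nat (card {k \<in> K. x \<in> E k}) \<partial>M)"
  proof (intro nn_integral_cong)
    fix x
    have "(\<Sum>k\<in>K. indicator (E k) x :: ennreal) = (\<Sum>k\<in>K. if x \<in> E k then 1 else 0)"
      by (intro sum.cong) (auto simp: indicator_def)
    also have "\<dots> = (\<Sum>k\<in>{k \<in> K. x \<in> E k}. 1)" by (rule sum.inter_filter[OF assms(1), symmetric])
    finally show "(\<Sum>k\<in>K. indicator (E k) x :: ennreal) = of_nat (card {k \<in> K. x \<in> E k})" by simp
  qed
  finally show ?thesis .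
qed

section \<open>The maximal inequality and linear growth of hitting times\<close>

context annealed
begin

lemma measure_after:
  assumes "G \<in> sets P"
  shows "measure P {X. after k X \<in> G \<inter> nonneg_paths} = measure P (G \<inter> nonneg_paths)"
  using fresh_start[OF assms, of "\<lambda>_. True" k] by simp

lemma after_sets [simp]: "G \<in> sets P \<Longrightarrow> {X. after k X \<in> G \<inter> nonneg_paths} \<in> sets P"
  by (rule after_vimage_sets) auto

definition slow :: "nat \<Rightarrow> nat \<Rightarrow> (nat \<Rightarrow> int ^ 'd) set" where
  "slow a N = {X. \<exists>n\<in>{1..N}. a * n < hit_time n X}"

lemma slow_sets [simp]: "slow a N \<in> sets P"
proof -
  have "{X \<in> space P. \<exists>n\<in>{1..N}. a * n < hit_time n X} \<in> sets P" by measurable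
  thus ?thesis by (simp add: slow_def)
qed

text \<open>A weak-type bound of the maximal ergodic kind. By stationarity \<open>M\<close> times
  the probability is the mean number of slow starts below level \<open>M\<close>, and
  \<open>a\<close> times that number is at most the hitting time of level \<open>M + N\<close>,
  whose mean is linear.\<close>

lemma measure_slow_le:
  assumes a: "a \<ge> 1"
  shows "measure P (slow a N \<inter> nonneg_paths) \<le> 1 / (real a * cK)"
proof (rule ccontr)
  define p where "p = measure P (slow a N \<inter> nonneg_paths)"
  assume "\<not> measure P (slow a N \<inter> nonneg_paths) \<le> 1 / (real a * cK)"
  hence p: "real a * p * cK - 1 > 0" using a cK_pos by (simp add: p_def field_simps)
  \<comment> \<open>Rearranged from \<open>a * M * p \<le> (M + N) / cK\<close>. With
    \<open>N\<close> fixed, large \<open>M\<close> contradicts a positive factor on the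
    left.\<close>
  have bound: "real M * (real a * p * cK - 1) \<le> real N" for M
  proof -
    define E where "E k = {X. after k X \<in> slow a N \<inter> nonneg_paths}" for k
    have sE: "E k \<in> sets P" for k unfolding E_def by (rule after_sets[OF slow_sets])
    have mE: "emeasure P (E k) = ennreal p" for k
      unfolding E_def emeasure_eq_measure measure_after[OF slow_sets] p_def ..
    have "ennreal (real a * (real M * p)) = of_nat a * (\<Sum>k<M. emeasure P (E k))"
      by (simp add: mE p_def ennreal_mult ennreal_of_nat_eq_real_of_nat)
    also have "\<dots> = of_nat a * (\<integral>\<^sup>+X. of_nat (card {k \<in> {..<M}. X \<in> E k}) \<partial>P)"
      by (subst sum_emeasure_eq_card) (auto simp: sE)
    also have "\<dots> = (\<integral>\<^sup>+X. of_nat a * of_nat (card {k \<in> {..<M}. X \<in> E k}) \<partial>P)"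
    proof (rule nn_integral_cmult[symmetric])
      have *: "(\<lambda>X. of_nat (card {k \<in> {..<M}. X \<in> E k}) :: ennreal) = (\<lambda>X. \<Sum>k<M. indicator (E k) X)"
      proof
        fix X
        have "(\<Sum>k<M. indicator (E k) X :: ennreal) = (\<Sum>k<M. if X \<in> E k then 1 else 0)"
          by (intro sum.cong) (auto simp: indicator_def)
        also have "\<dots> = (\<Sum>k\<in>{k \<in> {..<M}. X \<in> E k}. 1)" by (rule sum.inter_filter[symmetric]) simp
        finally show "of_nat (card {k \<in> {..<M}. X \<in> E k}) = (\<Sum>k<M. indicator (E k) X :: ennreal)" by simp
      qed
      show "(\<lambda>X. of_nat (card {k \<in> {..<M}. X \<in> E k}) :: ennreal) \<in> borel_measurable P"
        unfolding * by (intro borel_measurable_sum borel_measurable_indicator) (rule sE)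
    qed
    also have "\<dots> \<le> (\<integral>\<^sup>+X. of_nat (hit_time (M + N) X) \<partial>P)"
    proof (intro nn_integral_mono_AE)
      show "AE X in P. of_nat a * of_nat (card {k \<in> {..<M}. X \<in> E k}) \<le> (of_nat (hit_time (M + N) X) :: ennreal)"
        using AE_climbing
      proof eventually_elim
        case (elim X)
        have "{k \<in> {..<M}. X \<in> E k} \<subseteq> {k \<in> {..<M}. \<exists>n\<in>{1..N}. hit_time k X + a * n < hit_time (k + n) X}"
          using hit_time_after[OF elim] by (auto simp: slow_def E_def)
        hence "a * card {k \<in> {..<M}. X \<in> E k} \<le> a * card {k \<in> {..<M}. \<exists>n\<in>{1..N}. hit_time k X + a * n < hit_time (k + n) X}"
          by (intro mult_le_mono2 card_mono) auto
        also have "\<dots> \<le> hit_time (M + N) X"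
          by (rule card_fast_growth) (rule hit_time_mono[OF elim])
        finally show ?case by (metis of_nat_mono of_nat_mult)
      qed
    qed
    also have "\<dots> \<le> ennreal (real (M + N) / cK)" by (rule hit_time_mean)
    finally have "real a * (real M * p) \<le> real (M + N) / cK"
      using cK_pos by simp
    thus ?thesis using cK_pos by (simp add: field_simps)
  qed
  obtain M :: nat where "real N < real M * (real a * p * cK - 1)"
    using reals_Archimedean3[OF p] by blast
  thus False using bound[of M] by simp
qed

definition steady :: "(nat \<Rightarrow> int ^ 'd) set" where
  "steady = {X. \<exists>a. \<forall>n\<ge>1. hit_time n X \<le> a * n}"

lemma steady_sets: "steady \<in> sets P"
proof -
  have "{X \<in> space P. \<exists>a. \<forall>n. n \<ge> 1 \<longrightarrow> hit_time n X \<le> a * n} \<in> sets P" by measurable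
  thus ?thesis by (simp add: steady_def)
qed

lemma measure_not_steady: "measure P (- steady \<inter> nonneg_paths) = 0"
proof -
  have le: "measure P (- steady \<inter> nonneg_paths) \<le> 1 / (real a * cK)" if a: "a \<ge> 1" for a
  proof -
    have inc: "incseq (\<lambda>N. slow a N \<inter> nonneg_paths)" by (force simp: incseq_def slow_def)
    have "(\<lambda>N. measure P (slow a N \<inter> nonneg_paths)) \<longlonglongrightarrow> measure P (\<Union>N. slow a N \<inter> nonneg_paths)"
      by (rule finite_Lim_measure_incseq[OF _ inc]) auto
    hence "measure P (\<Union>N. slow a N \<inter> nonneg_paths) \<le> 1 / (real a * cK)"
      by (rule LIMSEQ_le_const2) (use measure_slow_le[OF a] in auto)
    moreover have "- steady \<inter> nonneg_paths \<subseteq> (\<Union>N. slow a N \<inter> nonneg_paths)"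
    proof
      fix X assume X: "X \<in> - steady \<inter> nonneg_paths"
      then obtain n where n: "n \<ge> 1" "a * n < hit_time n X" by (auto simp: steady_def not_le)
      hence "X \<in> slow a n" by (auto simp: slow_def)
      thus "X \<in> (\<Union>N. slow a N \<inter> nonneg_paths)" using X by auto
    qed
    hence "measure P (- steady \<inter> nonneg_paths) \<le> measure P (\<Union>N. slow a N \<inter> nonneg_paths)"
      by (rule finite_measure_mono) (rule sets.countable_UN', auto)
    ultimately show ?thesis by linarith
  qed
  show ?thesis
  proof (rule ccontr)
    assume "measure P (- steady \<inter> nonneg_paths) \<noteq> 0"
    hence pos: "cK * measure P (- steady \<inter> nonneg_paths) > 0" using cK_pos by (simp add: zero_less_measure_iff)
    obtain a :: nat where a: "1 < real a * (cK * measure P (- steady \<inter> nonneg_paths))"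
      using reals_Archimedean3[OF pos] by blast
    hence "a \<ge> 1" by (cases a) auto
    from le[OF this] a this cK_pos show False by (simp add: field_simps)
  qed
qed

lemma AE_after_steady: "AE X in P. \<forall>k. after k X \<in> nonneg_paths \<longrightarrow> after k X \<in> steady"
  unfolding AE_all_countable
proof
  fix k
  have s: "- steady \<in> sets P" using sets.compl_sets[OF steady_sets] by (simp add: Compl_eq_Diff_UNIV)
  have "measure P {X. after k X \<in> - steady \<inter> nonneg_paths} = 0"
    using measure_after[OF s] measure_not_steady by simp
  hence "AE X in P. X \<notin> {X. after k X \<in> - steady \<inter> nonneg_paths}"
    using after_sets[OF s, of k] by (intro AE_not_in) (simp only: null_sets_def emeasure_eq_measure mem_Collect_eq ennreal_0)
  thus "AE X in P. after k X \<in> nonneg_paths \<longrightarrow> after k X \<in> steady"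
    by eventually_elim auto
qed

section \<open>Gaps between regeneration levels\<close>

definition gap :: "nat \<Rightarrow> (nat \<Rightarrow> int ^ 'd) set" where
  "gap t = {X. \<forall>j\<in>{1..t}. after j X \<notin> nonneg_paths}"

lemma reg_sets: "{X. after j X \<in> nonneg_paths} \<in> sets P"
  by (rule after_vimage_sets) auto

lemma gap_sets [simp]: "gap t \<in> sets P"
proof -
  note reg_sets[measurable]
  have "Measurable.pred P (\<lambda>X. X \<in> {X. after j X \<in> nonneg_paths})" for j by measurable
  hence [measurable]: "Measurable.pred P (\<lambda>X. after j X \<in> nonneg_paths)" for j by simp
  have "{X \<in> space P. \<forall>j\<in>{1..t}. after j X \<notin> nonneg_paths} \<in> sets P" by measurable
  thus ?thesis by (simp add: gap_def)
qed

text \<open>The events that \<open>k\<close> is the last regeneration level up to \<open>M\<close> are disjoint, and their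
  probabilities only depend on \<open>M - k\<close>.\<close>
lemma sum_gap_le_1: "(\<Sum>t\<le>M. measure P (gap t \<inter> nonneg_paths)) \<le> 1"
proof -
  define E where "E k = {X. after k X \<in> gap (M - k) \<inter> nonneg_paths}" for k
  have sE: "E k \<in> sets P" for k unfolding E_def by (rule after_sets[OF gap_sets])
  have "ennreal (\<Sum>t\<le>M. measure P (gap t \<inter> nonneg_paths)) = ennreal (\<Sum>k\<le>M. measure P (E k))"
    unfolding E_def measure_after[OF gap_sets]
    by (rule arg_cong[where f = ennreal], rule sum.reindex_bij_witness[of _ "\<lambda>k. M - k" "\<lambda>k. M - k"]) auto
  also have "\<dots> = (\<Sum>k\<le>M. emeasure P (E k))" by (simp add: emeasure_eq_measure sum_ennreal)
  also have "\<dots> = (\<integral>\<^sup>+X. of_nat (card {k \<in> {..M}. X \<in> E k}) \<partial>P)"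
    by (rule sum_emeasure_eq_card) (auto simp: sE)
  also have "\<dots> \<le> (\<integral>\<^sup>+X. 1 \<partial>P)"
  proof (intro nn_integral_mono_AE)
    show "AE X in P. of_nat (card {k \<in> {..M}. X \<in> E k}) \<le> (1 :: ennreal)"
      using AE_climbing
    proof eventually_elim
      case (elim X)
      have no: False if "k < k'" "k' \<le> M" "X \<in> E k" "X \<in> E k'" for k k'
      proof -
        have "after (k' - k) (after k X) = after k' X" using after_after[OF elim, of "k' - k" k] that by simp
        moreover have "after (k' - k) (after k X) \<notin> nonneg_paths"
        proof -
          have "k' - k \<in> {1..M - k}" using that by auto
          thus ?thesis using that(3) unfolding E_def gap_def by blast
        qed
        ultimately show False using that by (simp add: E_def)
      qed
      have "k = k'" if "k \<in> {k \<in> {..M}. X \<in> E k}" "k' \<in> {k \<in> {..M}. X \<in> E k}" for k k'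
        using no[of k k'] no[of k' k] that by (cases k k' rule: linorder_cases) auto
      hence "card {k \<in> {..M}. X \<in> E k} \<le> 1"
        by (subst One_nat_def, subst card_le_Suc0_iff_eq) auto
      thus ?case by (metis of_nat_1 of_nat_mono)
    qed
  qed
  also have "\<dots> = ennreal 1" by (simp add: emeasure_eq_measure)
  finally show ?thesis by simp
qed

text \<open>By stationarity the event at level \<open>k\<close> has the probability of
  \<open>gap k \<inter> nonneg_paths\<close>, which is summable in \<open>k\<close>, so
  Borel-Cantelli applies. Taking the gap length equal to the level bounds the next regeneration
  level by \<open>2 * k\<close>, a loss of a constant factor in the speed.\<close>

lemma AE_gap: "AE X in P. \<exists>k1. \<forall>k\<ge>k1. after k X \<in> nonneg_paths \<longrightarrow> (\<exists>j\<in>{k+1..2*k}. after j X \<in> nonneg_paths)"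
proof -
  define E where "E k = {X. after k X \<in> gap k \<inter> nonneg_paths}" for k
  have sE: "E k \<in> sets P" for k unfolding E_def by (rule after_sets[OF gap_sets])
  have "summable (\<lambda>t. measure P (gap t \<inter> nonneg_paths))"
  proof (rule summableI_nonneg_bounded)
    fix n
    have "(\<Sum>t<n. measure P (gap t \<inter> nonneg_paths)) \<le> (\<Sum>t\<le>n. measure P (gap t \<inter> nonneg_paths))"
      by (intro sum_mono2) auto
    also have "\<dots> \<le> 1" by (rule sum_gap_le_1)
    finally show "(\<Sum>t<n. measure P (gap t \<inter> nonneg_paths)) \<le> 1" .
  qed simp
  hence "summable (\<lambda>k. measure P (E k))" by (simp only: E_def measure_after[OF gap_sets])
  hence "AE X in P. eventually (\<lambda>k. X \<in> space P - E k) sequentially"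
    by (intro borel_cantelli_AE1 sE) (auto simp: emeasure_eq_measure)
  with AE_climbing show ?thesis
  proof eventually_elim
    case (elim X)
    then obtain k1 where k1: "\<And>k. k \<ge> k1 \<Longrightarrow> X \<notin> E k" by (auto simp: eventually_sequentially)
    have "\<exists>j\<in>{k+1..2*k}. after j X \<in> nonneg_paths" if "k \<ge> k1" "after k X \<in> nonneg_paths" for k
    proof -
      have "after k X \<notin> gap k" using k1[OF that(1)] that(2) by (auto simp: E_def)
      then obtain j where "j \<in> {1..k}" "after j (after k X) \<in> nonneg_paths" by (auto simp: gap_def)
      thus ?thesis using after_after[OF elim(1), of j k] by (intro bexI[of _ "k + j"]) auto
    qed
    thus ?case by blast
  qed
qed

lemma reg_iff: "climbing X \<Longrightarrow> after k X \<in> nonneg_paths \<longleftrightarrow> (\<forall>n\<ge>hit_time k X. int k \<le> X n $ i1)"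
  using level_hit_time[of X k]
  by (auto simp: nonneg_paths_def after_def path_shift_def nat_le_iff_add)

text \<open>Failures of the levels \<open>m0..m\<close> to regenerate are witnessed before the hitting time of a high
  level \<open>k\<close>, at which a new independent attempt is made.\<close>
lemma AE_infinitely_many_regenerations: "AE X in P. \<forall>m0. \<exists>k\<ge>m0. after k X \<in> nonneg_paths"
  unfolding AE_all_countable
proof
  fix m0
  define rho where "rho = measure P nonneg_paths"
  have rho: "rho > 0" unfolding rho_def by (rule nonneg_paths_pos)
  note reg_sets[measurable]
  have "Measurable.pred P (\<lambda>X. X \<in> {X. after j X \<in> nonneg_paths})" for j by measurable
  hence pred [measurable]: "Measurable.pred P (\<lambda>X. after j X \<in> nonneg_paths)" for j by simp
  define A where "A = {X. \<forall>k\<ge>m0. after k X \<notin> nonneg_paths}"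
  define Am where "Am m = {X. \<forall>k\<in>{m0..m}. after k X \<notin> nonneg_paths}" for m
  have sA: "A \<in> sets P"
  proof -
    have "{X \<in> space P. \<forall>k. k \<ge> m0 \<longrightarrow> after k X \<notin> nonneg_paths} \<in> sets P" by measurable
    thus ?thesis by (simp add: A_def)
  qed
  have sAm: "Am m \<in> sets P" for m
  proof -
    have "{X \<in> space P. \<forall>k\<in>{m0..m}. after k X \<notin> nonneg_paths} \<in> sets P" by measurable
    thus ?thesis by (simp add: Am_def)
  qed
  \<comment> \<open>A level \<open>j\<close> has failed once the walk was at or above
    \<open>j\<close> and is later below it. Asking for both times inside the word makes the failure
    visible to the past of the hitting time of \<open>k\<close>.\<close>
  define Q where "Q m w \<longleftrightarrow> (\<forall>j\<in>{m0..m}. \<exists>i n. i \<le> n \<and> n < length w \<and> int j \<le> w ! i $ i1 \<and> w ! n $ i1 < int j)"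
    for m and w :: "(int ^ 'd) list"
  define E where "E m k = {X. Q m (prefix_of X (hit_time k X))}" for m k
  have sE: "E m k \<in> sets P" for m k
  proof -
    have pm: "(\<lambda>X. prefix_of X (hit_time k X)) \<in> measurable P (count_space UNIV)"
    proof (rule measurable_compose_countable[OF _ measurable_hit_time])
      show "(\<lambda>X. prefix_of X n) \<in> measurable P (count_space UNIV)" for n by measurable
    qed
    have "{X \<in> space P. Q m (prefix_of X (hit_time k X))} \<in> sets P"
      using measurable_compose[OF pm, of "Q m" "count_space UNIV"] by (intro predE) auto
    thus ?thesis by (simp add: E_def)
  qed
  have Q_iff: "X \<in> E m k \<longleftrightarrow> (\<forall>j\<in>{m0..m}. \<exists>i n. i \<le> n \<and> n \<le> hit_time k X \<and> int j \<le> X i $ i1 \<and> X n $ i1 < int j)" for X m k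
  proof -
    have "(\<exists>i n. i \<le> n \<and> n < Suc (hit_time k X) \<and> int j \<le> prefix_of X (hit_time k X) ! i $ i1
        \<and> prefix_of X (hit_time k X) ! n $ i1 < int j)
      \<longleftrightarrow> (\<exists>i n. i \<le> n \<and> n \<le> hit_time k X \<and> int j \<le> X i $ i1 \<and> X n $ i1 < int j)" for j
      by (intro ex_cong1 conj_cong refl) (auto simp: less_Suc_eq_le)
    thus ?thesis by (simp add: E_def Q_def)
  qed
  have E_sub: "X \<in> Am m" if "climbing X" "X \<in> E m k" for X m k
  proof -
    have "after j X \<notin> nonneg_paths" if j: "j \<in> {m0..m}" for j
    proof -
      obtain i n where *: "i \<le> n" "int j \<le> X i $ i1" "X n $ i1 < int j"
        using \<open>X \<in> E m k\<close> j unfolding Q_iff by blast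
      have "hit_time j X \<le> n" using le_hit_time[of j X i] * by simp
      thus ?thesis unfolding reg_iff[OF \<open>climbing X\<close>] using * by (auto simp: not_le)
    qed
    thus ?thesis by (simp add: Am_def)
  qed
  have E_sup: "\<exists>k0. \<forall>k\<ge>k0. X \<in> E m k" if X: "climbing X" "X \<in> Am m" for X m
  proof -
    have "\<exists>n\<ge>hit_time j X. X n $ i1 < int j" if "j \<in> {m0..m}" for j
      using X that unfolding Am_def by (auto simp: reg_iff not_le)
    then obtain n where n: "\<And>j. j \<in> {m0..m} \<Longrightarrow> hit_time j X \<le> n j \<and> X (n j) $ i1 < int j" by metis
    define k0 where "k0 = Max (insert 0 (n ` {m0..m}))"
    have "X \<in> E m k" if k: "k \<ge> k0" for k
      unfolding Q_iff
    proof
      fix j assume j: "j \<in> {m0..m}"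
      have "n j \<le> k0" unfolding k0_def using j by (intro Max_ge) auto
      also have "k0 \<le> hit_time k X" using k hit_time_ge[OF X(1), of k] by simp
      finally show "\<exists>i n. i \<le> n \<and> n \<le> hit_time k X \<and> int j \<le> X i $ i1 \<and> X n $ i1 < int j"
        using n[OF j] level_hit_time[OF X(1), of j] by (intro exI[of _ "hit_time j X"] exI[of _ "n j"]) auto
    qed
    thus ?thesis by blast
  qed
  \<comment> \<open>On \<open>A\<close> the level \<open>k\<close> does not regenerate either. Given
    the past it would do so with probability \<open>rho\<close>, since \<open>E m k\<close> depends
    only on the path up to the hitting time of \<open>k\<close>.\<close>
  have step: "measure P (A \<inter> E m k) \<le> (1 - rho) * measure P (Am m)" if k: "k \<ge> m0" for m k
  proof -
    have "measure P {X. Q m (prefix_of X (hit_time k X)) \<and> after k X \<in> UNIV \<inter> nonneg_paths}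
        = measure P {X. Q m (prefix_of X (hit_time k X))} * measure P (UNIV \<inter> nonneg_paths)"
      by (rule fresh_start) (metis sets.top space_P)
    hence fr: "measure P (E m k \<inter> {X. after k X \<in> nonneg_paths}) = measure P (E m k) * rho"
      by (simp add: E_def rho_def Int_def)
    have "measure P (A \<inter> E m k) \<le> measure P (E m k - E m k \<inter> {X. after k X \<in> nonneg_paths})"
      using sE reg_sets k by (intro finite_measure_mono) (auto simp: A_def)
    also have "\<dots> = measure P (E m k) - measure P (E m k) * rho"
      using sE reg_sets by (subst finite_measure_Diff) (auto simp: fr)
    also have "\<dots> = (1 - rho) * measure P (E m k)" by (simp add: algebra_simps)
    also have "\<dots> \<le> (1 - rho) * measure P (Am m)"
    proof (rule mult_left_mono)
      show "measure P (E m k) \<le> measure P (Am m)"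
        using AE_climbing E_sub sAm by (intro finite_measure_mono_AE) (auto elim!: eventually_mono)
    qed (simp add: rho_def)
    finally show ?thesis .
  qed
  have A_le: "measure P A \<le> (1 - rho) * measure P (Am m)" for m
  proof -
    \<comment> \<open>On \<open>A\<close> every climbing path lies in \<open>E m k'\<close> for all
      large \<open>k'\<close>, so the increasing sets \<open>D k\<close> exhaust \<open>A\<close> up
      to a null set.\<close>
    define D where "D k = (\<Inter>k'\<in>{k..}. A \<inter> E m k')" for k
    have sD: "D k \<in> sets P" for k unfolding D_def using sA sE by (intro sets.countable_INT' ) auto
    have "(\<lambda>k. measure P (D k)) \<longlonglongrightarrow> measure P (\<Union>k. D k)"
      using sD by (intro finite_Lim_measure_incseq) (auto simp: incseq_def D_def)
    moreover have "measure P (D k) \<le> (1 - rho) * measure P (Am m)" if "k \<ge> m0" for k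
    proof -
      have "measure P (D k) \<le> measure P (A \<inter> E m k)"
        using sA sE by (intro finite_measure_mono) (auto simp: D_def)
      thus ?thesis using step[OF that, of m] by linarith
    qed
    ultimately have "measure P (\<Union>k. D k) \<le> (1 - rho) * measure P (Am m)"
      by (intro LIMSEQ_le_const2[of "\<lambda>k. measure P (D k)"]) auto
    moreover have "measure P A \<le> measure P (\<Union>k. D k)"
    proof (rule finite_measure_mono_AE)
      show "AE X in P. X \<in> A \<longrightarrow> X \<in> (\<Union>k. D k)" using AE_climbing
      proof eventually_elim
        case (elim X)
        show ?case
        proof
          assume XA: "X \<in> A"
          hence "X \<in> Am m" by (auto simp: A_def Am_def)
          from E_sup[OF elim this] obtain k0 where "\<And>k. k \<ge> k0 \<Longrightarrow> X \<in> E m k" by blast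
          thus "X \<in> (\<Union>k. D k)" using XA by (intro UN_I[of k0]) (auto simp: D_def)
        qed
      qed
    qed (use sD in auto)
    ultimately show ?thesis by linarith
  qed
  have "(\<lambda>m. measure P (Am m)) \<longlonglongrightarrow> measure P (\<Inter>m. Am m)"
    using sAm by (intro finite_Lim_measure_decseq) (auto simp: decseq_def Am_def)
  moreover have "(\<Inter>m. Am m) = A"
    by (auto simp: Am_def A_def) (metis atLeastAtMost_iff order_refl)
  ultimately have "(\<lambda>m. (1 - rho) * measure P (Am m)) \<longlonglongrightarrow> (1 - rho) * measure P A"
    by (intro tendsto_mult_left) simp
  \<comment> \<open>Letting \<open>m\<close> grow replaces \<open>Am m\<close> by \<open>A\<close>
    itself, and \<open>rho > 0\<close> forces measure zero.\<close>
  hence "measure P A \<le> (1 - rho) * measure P A"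
    by (rule LIMSEQ_le_const) (use A_le in auto)
  hence "rho * measure P A \<le> 0" by (simp add: algebra_simps)
  hence "measure P A = 0" using rho by (simp add: mult_le_0_iff measure_le_0_iff)
  hence "AE X in P. X \<notin> A" using sA by (intro AE_not_in) (simp add: null_sets_def emeasure_eq_measure)
  thus "AE X in P. \<exists>k\<ge>m0. after k X \<in> nonneg_paths"
    by eventually_elim (auto simp: A_def)
qed

text \<open>At time \<open>n\<close> let \<open>m\<close> be the highest level reached and
  \<open>j\<close> the last regeneration level up to \<open>m\<close>. The walk is at level
  \<open>j\<close> or above, the gap bound gives \<open>m < 2 * j\<close>, and linear growth of
  hitting times after one fixed regeneration level makes \<open>m\<close> of order
  \<open>n\<close>.\<close>

lemma positive_speed:
  assumes X: "climbing X"
    and st: "\<forall>k. after k X \<in> nonneg_paths \<longrightarrow> after k X \<in> steady"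
    and gp: "\<exists>k1. \<forall>k\<ge>k1. after k X \<in> nonneg_paths \<longrightarrow> (\<exists>j\<in>{k+1..2*k}. after j X \<in> nonneg_paths)"
    and inf: "\<forall>m0. \<exists>k\<ge>m0. after k X \<in> nonneg_paths"
  shows "liminf (\<lambda>n. ereal (real_of_int (X n $ i1) / real n)) > 0"
proof -
  obtain k1 where k1: "\<And>k. k \<ge> k1 \<Longrightarrow> after k X \<in> nonneg_paths \<Longrightarrow> \<exists>j\<in>{k+1..2*k}. after j X \<in> nonneg_paths"
    using gp by blast
  obtain k0 where k0: "k0 \<ge> k1" "after k0 X \<in> nonneg_paths" using inf by blast
  then obtain b where b: "\<And>n. n \<ge> 1 \<Longrightarrow> hit_time n (after k0 X) \<le> b * n" using st by (auto simp: steady_def)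
  \<comment> \<open>The successor keeps \<open>a\<close> positive for the divisions below.\<close>
  define a where "a = Suc b"
  define T0 where "T0 = hit_time k0 X"
  \<comment> \<open>The condition on \<open>n\<close> absorbs \<open>T0\<close> into half of
    \<open>n\<close>: from \<open>n < T0 + 2 * a * j\<close> it follows that
    \<open>n < 4 * a * j\<close>.\<close>
  have lower: "real n / (4 * real a) \<le> real_of_int (X n $ i1)" if n: "n \<ge> 2 * T0" for n
  proof -
    define Ms where "Ms = {m. hit_time m X \<le> n}"
    have "Ms \<subseteq> {..n}" using hit_time_ge[OF X] by (auto simp: Ms_def intro: order.trans)
    hence finM: "finite Ms" by (rule finite_subset) simp
    have k0M: "k0 \<in> Ms" using n by (auto simp: Ms_def T0_def)
    define m where "m = Max Ms"
    have mM: "m \<in> Ms" unfolding m_def using finM k0M by (intro Max_in) auto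
    have mk0: "k0 \<le> m" unfolding m_def using finM k0M by (intro Max_ge) auto
    have "Suc m \<notin> Ms"
    proof
      assume "Suc m \<in> Ms"
      hence "Suc m \<le> m" unfolding m_def using finM by (intro Max_ge) auto
      thus False by simp
    qed
    hence "n < hit_time (Suc m) X" by (simp add: Ms_def)
    also have "\<dots> = T0 + hit_time (Suc m - k0) (after k0 X)"
      using hit_time_after[OF X, of k0 "Suc m - k0"] mk0 by (simp add: T0_def)
    also have "hit_time (Suc m - k0) (after k0 X) \<le> b * (Suc m - k0)" using mk0 by (intro b) simp
    also have "\<dots> \<le> a * Suc m" unfolding a_def by (intro mult_le_mono) auto
    finally have nm: "n < T0 + a * Suc m" by simp
    define R where "R = {j. j \<le> m \<and> after j X \<in> nonneg_paths}"
    have finR: "finite R" by (rule finite_subset[of _ "{..m}"]) (auto simp: R_def)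
    have k0R: "k0 \<in> R" using k0 mk0 by (simp add: R_def)
    define j where "j = Max R"
    have jR: "j \<in> R" unfolding j_def using finR k0R by (intro Max_in) auto
    have "k0 \<le> j" unfolding j_def using finR k0R by (intro Max_ge) auto
    then obtain j' where j': "j' \<in> {j+1..2*j}" "after j' X \<in> nonneg_paths"
      using k1[of j] k0 jR by (auto simp: R_def)
    \<comment> \<open>The next regeneration level lies beyond \<open>m\<close> by maximality of
      \<open>j\<close>, and the gap bound keeps it within \<open>2 * j\<close>.\<close>
    have "\<not> j' \<le> m"
    proof
      assume "j' \<le> m"
      hence "j' \<in> R" using j' by (simp add: R_def)
      hence "j' \<le> j" unfolding j_def using finR by (intro Max_ge) auto
      thus False using j' by simp
    qed
    hence "Suc m \<le> 2 * j" using j' by simp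
    hence "a * Suc m \<le> a * (2 * j)" by (rule mult_le_mono2)
    with nm have "n < T0 + a * (2 * j)" by linarith
    hence "n < 4 * a * j" using n by linarith
    hence "real n < real (4 * a * j)" by linarith
    hence nj: "real n / (4 * real a) \<le> real j" by (simp add: a_def field_simps)
    have "hit_time j X \<le> n" using hit_time_mono[OF X, of j m] jR mM by (auto simp: R_def Ms_def)
    hence "int j \<le> X n $ i1" using jR reg_iff[OF X, of j] by (simp add: R_def)
    thus ?thesis using nj by linarith
  qed
  have "0 < ereal (1 / (4 * real a))" by (simp add: a_def)
  also have "\<dots> \<le> liminf (\<lambda>n. ereal (real_of_int (X n $ i1) / real n))"
  proof (rule Liminf_bounded)
    show "\<forall>\<^sub>F n in sequentially. ereal (1 / (4 * real a)) \<le> ereal (real_of_int (X n $ i1) / real n)"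
      using eventually_ge_at_top[of "2 * T0"] eventually_gt_at_top[of 0]
    proof eventually_elim
      case (elim n)
      have "1 / (4 * real a) = real n / (4 * real a) / real n" using elim(2) by simp
      also have "\<dots> \<le> real_of_int (X n $ i1) / real n"
        using lower[OF elim(1)] by (intro divide_right_mono) auto
      finally show ?case by simp
    qed
  qed
  finally show ?thesis .
qed

lemma AE_positive_speed: "AE X in P. liminf (\<lambda>n. ereal (real_of_int (X n $ i1) / real n)) > 0"
  using AE_climbing AE_after_steady AE_gap AE_infinitely_many_regenerations
  by eventually_elim (rule positive_speed)

end

section \<open>From quenched laws to the annealed law\<close>

lemma (in rwre) pred_probvecs: "Measurable.pred env (\<lambda>\<omega>. \<forall>y. \<omega> y \<in> probvecs)"
proof -
  have "Measurable.pred \<mu> (\<lambda>p. p \<in> probvecs)" unfolding probvecs_def mem_Collect_eq by measurable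
  hence "Measurable.pred env (\<lambda>\<omega>. \<omega> y \<in> probvecs)" for y
    by (rule measurable_compose[OF measurable_site])
  thus ?thesis by measurable
qed

text \<open>The quenched laws are only prescribed for environments in \<open>probvecs\<close>; elsewhere they are
  replaced by a fixed one, which makes them a measurable kernel.\<close>
lemma (in rwre) annealed_law_exists:
  fixes Pq :: "(int ^ 'd \<Rightarrow> int ^ 'd \<Rightarrow> real) \<Rightarrow> (nat \<Rightarrow> int ^ 'd) measure"
  assumes quenched: "\<And>\<omega>. (\<forall>y. \<omega> y \<in> probvecs) \<Longrightarrow> is_quenched_law \<omega> 0 (Pq \<omega>)"
  obtains K where "K \<in> measurable env (subprob_algebra path_space)" "annealed \<mu> i1 (env \<bind> K)"
    "\<And>\<omega>. (\<forall>y. \<omega> y \<in> probvecs) \<Longrightarrow> K \<omega> = Pq \<omega>"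
proof -
  define ok where "ok \<omega> \<longleftrightarrow> (\<forall>y. \<omega> y \<in> probvecs)" for \<omega> :: "int ^ 'd \<Rightarrow> int ^ 'd \<Rightarrow> real"
  have [measurable]: "Measurable.pred env ok" unfolding ok_def by (rule pred_probvecs)
  have AE_ok: "AE \<omega> in env. ok \<omega>"
    using AE_env_elliptic by eventually_elim (auto simp: ok_def elliptic_def)
  have "\<exists>\<omega>0. ok \<omega>0"
  proof (rule ccontr)
    assume "\<not> (\<exists>\<omega>0. ok \<omega>0)"
    hence "AE \<omega> in env. False" using AE_ok by simp
    thus False using env.AE_False by blast
  qed
  then obtain \<omega>0 where w0: "ok \<omega>0" ..
  define rep where "rep \<omega> = (if ok \<omega> then \<omega> else \<omega>0)" for \<omega>
  define K where "K \<omega> = Pq (rep \<omega>)" for \<omega>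
  have ql: "is_quenched_law (rep \<omega>) 0 (K \<omega>)" for \<omega>
    unfolding K_def by (rule quenched) (use w0 in \<open>auto simp: rep_def ok_def\<close>)
  have setsK: "sets (K \<omega>) = sets path_space" and probK: "prob_space (K \<omega>)" for \<omega>
    using ql[of \<omega>] by (auto simp: is_quenched_law_def)
  have spaceK: "space (K \<omega>) = UNIV" for \<omega> using sets_eq_imp_space_eq[OF setsK[of \<omega>]] by simp
  have cylK: "emeasure (K \<omega>) (cyl n zs) = ennreal (if zs 0 = 0 then traj_wt (rep \<omega>) zs n else 0)" for \<omega> n zs
  proof -
    interpret prob_space "K \<omega>" by (rule probK)
    have "measure (K \<omega>) (cyl n zs) = (if zs 0 = 0 then traj_wt (rep \<omega>) zs n else 0)"
      using ql[of \<omega>] by (simp add: is_quenched_law_def spaceK cyl_def traj_wt_def)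
    thus ?thesis by (simp add: emeasure_eq_measure)
  qed
  have rep_meas: "(\<lambda>\<omega>. traj_wt (rep \<omega>) zs n) \<in> borel_measurable env" for zs n
  proof -
    have "(\<lambda>\<omega>. traj_wt (rep \<omega>) zs n) = (\<lambda>\<omega>. if ok \<omega> then traj_wt \<omega> zs n else traj_wt \<omega>0 zs n)"
      by (auto simp: rep_def)
    thus ?thesis by simp
  qed
  \<comment> \<open>No measurability of \<open>Pq\<close> is assumed. It follows for
    \<open>K\<close> because the quenched cylinder probabilities are measurable in \<omega> and
    cylinders generate the path sigma-algebra.\<close>
  have "K \<in> measurable env (prob_algebra path_space)"
  proof (rule measurable_prob_algebra_generated[OF sets_path_space_eq Int_stable_cyls])
    show "(\<lambda>\<omega>. emeasure (K \<omega>) A) \<in> borel_measurable env" if "A \<in> cyls" for A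
    proof -
      have "A = {} \<or> (\<exists>n zs. A = cyl n zs)" using that by (auto simp: cyls_def)
      thus ?thesis
      proof
        assume "\<exists>n zs. A = cyl n zs"
        then obtain n zs where "A = cyl n zs" by blast
        thus ?thesis using rep_meas[of zs n] by (cases "zs 0 = 0") (simp_all add: cylK)
      qed simp
    qed
  qed (use probK setsK in auto)
  hence Km: "K \<in> measurable env (subprob_algebra path_space)" by (rule measurable_prob_algebraD)
  have ne: "space env \<noteq> {}" by (rule env.not_empty)
  have "annealed \<mu> i1 (env \<bind> K)"
  proof (intro annealed.intro annealed_axioms.intro)
    show "rwre \<mu> i1" by (rule rwre_axioms)
    show prob: "prob_space (env \<bind> K)"
      by (rule env.prob_space_bind[OF _ Km]) (simp add: probK)
    show "sets (env \<bind> K) = sets path_space" by (rule sets_bind[OF _ ne]) (rule setsK)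
    fix n and zs :: "nat \<Rightarrow> int ^ 'd"
    interpret prob_space "env \<bind> K" by (rule prob)
    have "ennreal (measure (env \<bind> K) (cyl n zs)) = (\<integral>\<^sup>+\<omega>. emeasure (K \<omega>) (cyl n zs) \<partial>env)"
      unfolding emeasure_eq_measure[symmetric] by (rule emeasure_bind[OF ne Km cyl_in_sets])
    also have "\<dots> = ennreal (if zs 0 = 0 then ann_wt zs n else 0)"
    proof (cases "zs 0 = 0")
      case True
      have "(\<integral>\<^sup>+\<omega>. emeasure (K \<omega>) (cyl n zs) \<partial>env) = (\<integral>\<^sup>+\<omega>. ennreal (traj_wt \<omega> zs n) \<partial>env)"
        using AE_ok by (intro nn_integral_cong_AE) (auto elim!: eventually_mono simp: cylK True rep_def)
      also have "\<dots> = ennreal (ann_wt zs n)"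
        unfolding ann_wt_def using AE_env_elliptic traj_wt_bounds
        by (intro nn_integral_eq_integral) (auto elim!: eventually_mono)
      finally show ?thesis using True by simp
    qed (simp add: cylK)
    finally show "measure (env \<bind> K) (cyl n zs) = (if zs 0 = 0 then ann_wt zs n else 0)"
      by (subst (asm) ennreal_inj) (auto simp: ann_wt_nonneg)
  qed
  with Km show ?thesis
    by (rule that) (simp add: K_def rep_def ok_def)
qed

theorem theorem1p2:
  fixes \<mu> :: "(int ^ 'd \<Rightarrow> real) measure"
    and i1 :: 'd
    and Pq :: "(int ^ 'd \<Rightarrow> int ^ 'd \<Rightarrow> real) \<Rightarrow> (nat \<Rightarrow> int ^ 'd) measure"
  assumes dim: "CARD('d) \<ge> 2"
    and mu_prob: "prob_space \<mu>"
    and mu_sets: "sets \<mu> = sets (\<Pi>\<^sub>M e\<in>UNIV. (borel :: real measure))"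
    and mu_supp: "AE p in \<mu>. p \<in> probvecs"
    and A2: "0 < eps_of \<mu>" "eps_of \<mu> < 1"
    and quenched: "\<And>\<omega>. (\<forall>y. \<omega> y \<in> probvecs) \<Longrightarrow> is_quenched_law \<omega> 0 (Pq \<omega>)"
    and drift: "lambda_of \<mu> i1 > 4 * real CARD('d) * (sigma_of \<mu>)\<^sup>2 * (1 + 9 * eps_of \<mu>)"
  shows "kalikow_condition (env_law \<mu>) (axis i1 1)
       \<and> (AE \<omega> in env_law \<mu>. AE X in Pq \<omega>.
            liminf (\<lambda>n. ereal (real_of_int (X n $ i1) / real n)) > 0)"
proof
  interpret rwre \<mu> i1
    using mu_prob mu_sets mu_supp A2 drift by (rule rwre.intro)
  show "kalikow_condition (env_law \<mu>) (axis i1 1)" by (rule kalikow_condition_holds)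
  obtain K where K: "K \<in> measurable env (subprob_algebra path_space)" "annealed \<mu> i1 (env \<bind> K)"
    "\<And>\<omega>. (\<forall>y. \<omega> y \<in> probvecs) \<Longrightarrow> K \<omega> = Pq \<omega>"
    using annealed_law_exists[OF quenched] by blast
  interpret annealed \<mu> i1 "env \<bind> K" by (rule K(2))
  have "(\<lambda>X :: nat \<Rightarrow> int ^ 'd. ereal (real_of_int (X n $ i1) / real n)) \<in> borel_measurable path_space" for n
    by (rule measurable_compose[OF measurable_path_component[of n]]) simp
  hence "Measurable.pred path_space (\<lambda>X :: nat \<Rightarrow> int ^ 'd. liminf (\<lambda>n. ereal (real_of_int (X n $ i1) / real n)) > 0)"
    by measurable
  \<comment> \<open>A null set of the mixture is null for almost every component, which turns the
    annealed statement into the quenched one.\<close>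
  from AE_bind[OF K(1) this] AE_positive_speed
  have "AE \<omega> in env. AE X in K \<omega>. liminf (\<lambda>n. ereal (real_of_int (X n $ i1) / real n)) > 0" by simp
  with AE_env_elliptic
  show "AE \<omega> in env. AE X in Pq \<omega>. liminf (\<lambda>n. ereal (real_of_int (X n $ i1) / real n)) > 0"
  proof eventually_elim
    case (elim \<omega>)
    have "\<forall>y. \<omega> y \<in> probvecs" using elim(1) by (simp add: elliptic_def)
    hence eq: "K \<omega> = Pq \<omega>" by (rule K(3))
    show ?case using elim(2) unfolding eq .
  qed
qed

end
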